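(* Let $\mathcal{L}$ be a second-order linear operator on $\mathbb{R}^N$ satisfying assumptions (H1), (H2), (H3), (FS), (G), (L), (D) stated in the context. Let $\Omega\subseteq\mathbb{R}^N$ be an open set satisfying one of the following conditions: (i) $\mathbb{R}^N\setminus\Omega$ is $\mathcal{L}$-large at infinity; (ii) $\mathbb{R}^N\setminus\Omega$ is $p_{\mathcal{L}}$-unbounded for some $p>1$; (iii) $\mathbb{R}^N\setminus\Omega$ contains a $\Gamma$-cone. Moreover, let $f:\Omega\times\mathbb{R}\to\mathbb{R}$ be such that $f(x,z)\le 0$ for every $x\in\Omega$ and every $z\ge 0$. If $u\in C^2(\Omega,\mathbb{R})$ is bounded above and satisfies $$\mathcal{L}u+f(x,u)\ge 0\ \text{ in }\Omega,\qquad \limsup_{x\to y}u(x)\le 0\ \text{ for every }y\in\partial\Omega,$$ then $u\le 0$ throughout $\Omega$.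
   Context: Operator: $\mathcal{L}=\frac{1}{V(x)}\sum_{i=1}^N\frac{\partial}{\partial x_i}\Big(\sum_{j=1}^N V(x)a_{i,j}(x)\frac{\partial}{\partial x_j}\Big)$ on $\mathbb{R}^N$, where: (H1) $V,a_{i,j}\in C^\infty(\mathbb{R}^N,\mathbb{R})$ for all $i,j$ and $V>0$ on $\mathbb{R}^N$; (H2) the matrix $A(x)=(a_{i,j}(x))_{i,j}$ is symmetric, positive semi-definite and $\mathrm{trace}(A(x))>0$ for every $x\in\mathbb{R}^N$; (H3) there is $\varepsilon>0$ such that both $\mathcal{L}$ and $\mathcal{L}-\varepsilon$ are $C^\infty$-hypoelliptic in every open subset of $\mathbb{R}^N$ (an operator $P$ is $C^\infty$-hypoelliptic in $\Omega$ if every distributional solution $u$ of $Pu=f$ is smooth in $\Omega$ whenever $f$ is smooth). (FS) There is a function $\Gamma:\{(x,y)\in\mathbb{R}^N\times\mathbb{R}^N:x\ne y\}\to\mathbb{R}$ which is $C^\infty$, strictly positive and symmetric, such that for every $x\in\mathbb{R}^N$: $\Gamma(x,\cdot)\in L^1_{\mathrm{loc}}(\mathbb{R}^N)$ and $\int_{\mathbb{R}^N}\Gamma(x,y)\,\mathcal{L}\varphi(y)\,V(y)\,dy=-\varphi(x)$ for all $\varphi\in C_0^\infty(\mathbb{R}^N,\mathbb{R})$; $\lim_{y\to x}\Gamma(x,y)=\infty$; $\lim_{\|y\|\to\infty}\Gamma(x,y)=0$. Set $\gamma(x,y)=1/\Gamma(x,y)$ for $x\neq y$, $\gamma(x,x)=0$,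 and define the $\Gamma$-ball $\Omega(x,r)=\{y\in\mathbb{R}^N:\gamma(x,y)<r\}$ for $x\in\mathbb{R}^N$, $r>0$. (G) There is $\theta\in(0,1)$ such that $x\notin\Omega(y,r)$ implies $\Omega(x,\theta r)\cap\Omega(y,\theta r)=\varnothing$, for all $x,y\in\mathbb{R}^N$, $r>0$. (L) Every $\mathcal{L}$-harmonic function on $\mathbb{R}^N$ which is bounded from above (or from below) is constant. (D) There are constants $2<\alpha'<\alpha''$ such that $\alpha'|\Omega(x,r)|\le|\Omega(x,2r)|\le\alpha''|\Omega(x,r)|$ for every $x\in\mathbb{R}^N$, $r>0$, where $|\cdot|$ is Lebesgue measure. Potential theory: a function is $\mathcal{L}$-harmonic in an open set if it is a smooth solution of $\mathcal{L}u=0$ there. For $\Omega\subseteq\mathbb{R}^N$ open, an upper semicontinuous function $u:\Omega\to[-\infty,\infty)$ is $\mathcal{L}$-subharmonic in $\Omega$ if (i) $\{x\in\Omega:u(x)>-\infty\}$ is dense in $\Omega$; (ii) for every bounded open set $W$ with $\overline W\subseteq\Omega$ and every $h$ that is $\mathcal{L}$-harmonic in $W$, continuous up to $\partial W$ and satisfies $u\le h$ on $\partial W$, one has $u\le h$ in $W$. $\underline{\mathcal{L}}_b(\Omega)$ denotes the set of $\mathcal{L}$-subharmonic functions in $\Omega$ that are bounded above. Thin/large sets: an unbounded set $F\subseteq\mathbb{R}^N$ is $\mathcal{L}$-thin at infinity if there is $u\in\underline{\mathcal{L}}_b(\mathbb{R}^N)$ with $\limsup_{x\to\infty,\,x\in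 F}u(x)<\limsup_{x\to\infty}u(x)$. A bounded set $F$ (possibly empty) is $\mathcal{L}$-thin at infinity if there is $u\in\underline{\mathcal{L}}_b(\mathbb{R}^N)$ with $\sup_F u<\sup_{\mathbb{R}^N}u$ (where $\sup_\varnothing u=-\infty$). $F$ is $\mathcal{L}$-large at infinity if it is not $\mathcal{L}$-thin at infinity. $p_{\mathcal{L}}$-boundedness: for $p\in(1,\infty)$, $F\subseteq\mathbb{R}^N$ is $p_{\mathcal{L}}$-bounded if there is a countable family $\{\Omega(x_n,r_n)\}_{n\in J}$ of $\Gamma$-balls such that $F\subseteq\bigcup_{n\in J}\Omega(x_n,r_n)$ and $\sum_{n\in J}\big(r_n/\gamma(0,x_n)\big)^p<\infty$ (a term with $x_n=0$ counts as $+\infty$). $F$ is $p_{\mathcal{L}}$-unbounded if it is not $p_{\mathcal{L}}$-bounded. $\Gamma$-cone: a set $K\subseteq\mathbb{R}^N$ is a $\Gamma$-cone if there is a sequence of $\Gamma$-balls $\{\Omega(z_j,R_j)\}_{j\in\mathbb{N}}$, all contained in $K$, such that $\|z_j\|\to\infty$ as $j\to\infty$ and $\liminf_{j\to\infty}R_j/\gamma(0,z_j)>0$. *)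

theory Defs
  imports "HOL-Analysis.Analysis"
begin

section \<open>Functions of class C^k\<close>

text \<open>Meant for open \<open>S\<close>: a function is of class C^(k+1) iff it is differentiable and all its
  directional derivatives are of class C^k. Only the values of \<open>f\<close> on \<open>S\<close> matter then.\<close>

primrec Ck_on ::
  "nat \<Rightarrow> 'a::real_normed_vector set \<Rightarrow> ('a \<Rightarrow> 'b::real_normed_vector) \<Rightarrow> bool" where
  "Ck_on 0 S f \<longleftrightarrow> continuous_on S f"
| "Ck_on (Suc k) S f \<longleftrightarrow>
     (\<forall>x\<in>S. f differentiable (at x)) \<and>
     (\<forall>v. Ck_on k S (\<lambda>x. frechet_derivative f (at x) v))"

definition smooth_on :: "'a::real_normed_vector set \<Rightarrow> ('a \<Rightarrow> 'b::real_normed_vector) \<Rightarrow> bool" where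
  "smooth_on S f \<longleftrightarrow> (\<forall>k. Ck_on k S f)"

definition partial :: "'n::finite \<Rightarrow> (real^'n \<Rightarrow> real) \<Rightarrow> real^'n \<Rightarrow> real" where
  "partial i f x = frechet_derivative f (at x) (axis i 1)"

section \<open>Distributions\<close>

definition test_fun :: "(real^'n::finite) set \<Rightarrow> (real^'n \<Rightarrow> real) \<Rightarrow> bool" where
  "test_fun U \<phi> \<longleftrightarrow> smooth_on UNIV \<phi> \<and>
     compact (closure {x. \<phi> x \<noteq> 0}) \<and> closure {x. \<phi> x \<noteq> 0} \<subseteq> U"

text \<open>Iterated partial derivatives are indexed by lists of coordinate indices instead of
  multi-indices, so in the seminorm \<open>test_seminorm m\<close> equal mixed derivatives are counted
  several times.\<close>

definition test_seminorm :: "nat \<Rightarrow> (real^'n::finite \<Rightarrow> real) \<Rightarrow> real" where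
  "test_seminorm m \<phi> = (\<Sum>is\<in>{is. length is \<le> m}. SUP x. \<bar>foldr partial is \<phi> x\<bar>)"

type_synonym 'n functional = "(real^'n \<Rightarrow> real) \<Rightarrow> real"

definition distribution_on :: "(real^'n::finite) set \<Rightarrow> 'n functional \<Rightarrow> bool" where
  "distribution_on U T \<longleftrightarrow>
     (\<forall>\<phi> \<psi> a b. test_fun U \<phi> \<longrightarrow> test_fun U \<psi> \<longrightarrow>
        T (\<lambda>x. a * \<phi> x + b * \<psi> x) = a * T \<phi> + b * T \<psi>) \<and>
     (\<forall>K. compact K \<and> K \<subseteq> U \<longrightarrow>
        (\<exists>C m. \<forall>\<phi>. test_fun K \<phi> \<longrightarrow> \<bar>T \<phi>\<bar> \<le> C * test_seminorm m \<phi>))"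

definition dist_partial :: "'n::finite \<Rightarrow> 'n functional \<Rightarrow> 'n functional" where
  "dist_partial i T = (\<lambda>\<phi>. - T (partial i \<phi>))"

definition dist_mult :: "(real^'n::finite \<Rightarrow> real) \<Rightarrow> 'n functional \<Rightarrow> 'n functional" where
  "dist_mult g T = (\<lambda>\<phi>. T (\<lambda>x. g x * \<phi> x))"

definition dist_sum :: "('n::finite \<Rightarrow> 'n functional) \<Rightarrow> 'n functional" where
  "dist_sum T = (\<lambda>\<phi>. \<Sum>i\<in>UNIV. T i \<phi>)"

text \<open>On \<open>U\<close>, the distribution \<open>T\<close> is given by the function \<open>g\<close>.\<close>

definition dist_eq_fun ::
  "(real^'n::finite) set \<Rightarrow> 'n functional \<Rightarrow> (real^'n \<Rightarrow> real) \<Rightarrow> bool" where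
  "dist_eq_fun U T g \<longleftrightarrow> (\<forall>\<phi>. test_fun U \<phi> \<longrightarrow> T \<phi> = (LINT x|lebesgue. g x * \<phi> x))"

definition hypoelliptic_on ::
  "(real^'n::finite) set \<Rightarrow> ('n functional \<Rightarrow> 'n functional) \<Rightarrow> bool" where
  "hypoelliptic_on U P \<longleftrightarrow>
     (\<forall>T f. distribution_on U T \<and> smooth_on U f \<and> dist_eq_fun U (P T) f \<longrightarrow>
        (\<exists>g. smooth_on U g \<and> dist_eq_fun U T g))"

section \<open>The operator and the structural assumptions\<close>

text \<open>The operator with density \<open>V\<close> and matrix \<open>A\<close>, first on functions, then (minus a multiple
  \<open>c\<close> of the identity) on distributions.\<close>

definition Lop ::
  "(real^'n::finite \<Rightarrow> real) \<Rightarrow> (real^'n \<Rightarrow> real^'n^'n) \<Rightarrow> (real^'n \<Rightarrow> real) \<Rightarrow> real^'n \<Rightarrow> real" where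
  "Lop V A u x =
     1 / V x * (\<Sum>i\<in>UNIV. partial i (\<lambda>y. \<Sum>j\<in>UNIV. V y * A y $ i $ j * partial j u y) x)"

definition dist_Lop_minus ::
  "(real^'n::finite \<Rightarrow> real) \<Rightarrow> (real^'n \<Rightarrow> real^'n^'n) \<Rightarrow> real \<Rightarrow> 'n functional \<Rightarrow> 'n functional" where
  "dist_Lop_minus V A c T = (\<lambda>\<phi>.
     dist_mult (\<lambda>x. 1 / V x)
       (dist_sum (\<lambda>i. dist_partial i
          (dist_sum (\<lambda>j. dist_mult (\<lambda>x. V x * A x $ i $ j) (dist_partial j T))))) \<phi>
     - c * T \<phi>)"

definition smooth_coefficients ::
  "(real^'n::finite \<Rightarrow> real) \<Rightarrow> (real^'n \<Rightarrow> real^'n^'n) \<Rightarrow> bool" where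
  "smooth_coefficients V A \<longleftrightarrow>
     smooth_on UNIV V \<and> (\<forall>i j. smooth_on UNIV (\<lambda>x. A x $ i $ j)) \<and> (\<forall>x. V x > 0)"

definition degenerate_elliptic :: "(real^'n::finite \<Rightarrow> real^'n^'n) \<Rightarrow> bool" where
  "degenerate_elliptic A \<longleftrightarrow>
     (\<forall>x. transpose (A x) = A x \<and> (\<forall>\<xi>. \<xi> \<bullet> (A x *v \<xi>) \<ge> 0) \<and> trace (A x) > 0)"

definition hypoelliptic_assumption ::
  "(real^'n::finite \<Rightarrow> real) \<Rightarrow> (real^'n \<Rightarrow> real^'n^'n) \<Rightarrow> bool" where
  "hypoelliptic_assumption V A \<longleftrightarrow>
     (\<exists>\<epsilon>>0. \<forall>U. open U \<longrightarrow>
        hypoelliptic_on U (dist_Lop_minus V A 0) \<and> hypoelliptic_on U (dist_Lop_minus V A \<epsilon>))"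

text \<open>The values of \<open>\<Gamma>\<close> on the diagonal are arbitrary; no condition depends on them.\<close>

definition fundamental_solution ::
  "(real^'n::finite \<Rightarrow> real) \<Rightarrow> (real^'n \<Rightarrow> real^'n^'n) \<Rightarrow> (real^'n \<Rightarrow> real^'n \<Rightarrow> real) \<Rightarrow> bool" where
  "fundamental_solution V A \<Gamma> \<longleftrightarrow>
     smooth_on {(x, y). x \<noteq> y} (\<lambda>(x, y). \<Gamma> x y) \<and>
     (\<forall>x y. x \<noteq> y \<longrightarrow> \<Gamma> x y > 0 \<and> \<Gamma> x y = \<Gamma> y x) \<and>
     (\<forall>x.
        (\<forall>K. compact K \<longrightarrow> \<Gamma> x absolutely_integrable_on K) \<and>
        (\<forall>\<phi>. test_fun UNIV \<phi> \<longrightarrow>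
           (LINT y|lebesgue. \<Gamma> x y * Lop V A \<phi> y * V y) = - \<phi> x) \<and>
        filterlim (\<Gamma> x) at_top (at x) \<and>
        (\<Gamma> x \<longlongrightarrow> 0) at_infinity)"

definition gam :: "('a \<Rightarrow> 'a \<Rightarrow> real) \<Rightarrow> 'a \<Rightarrow> 'a \<Rightarrow> real" where
  "gam \<Gamma> x y = (if x = y then 0 else 1 / \<Gamma> x y)"

definition Gball :: "('a \<Rightarrow> 'a \<Rightarrow> real) \<Rightarrow> 'a \<Rightarrow> real \<Rightarrow> 'a set" where
  "Gball \<Gamma> x r = {y. gam \<Gamma> x y < r}"

definition ball_separation :: "('a \<Rightarrow> 'a \<Rightarrow> real) \<Rightarrow> bool" where
  "ball_separation \<Gamma> \<longleftrightarrow>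
     (\<exists>\<theta>\<in>{0<..<1}. \<forall>x y. \<forall>r>0. x \<notin> Gball \<Gamma> y r \<longrightarrow>
        Gball \<Gamma> x (\<theta> * r) \<inter> Gball \<Gamma> y (\<theta> * r) = {})"

text \<open>For a fundamental solution \<open>\<Gamma>\<close>, every \<open>Gball\<close> is bounded since \<open>\<Gamma> x\<close> vanishes at infinity,
  so the real-valued \<open>measure\<close> is the true volume.\<close>

definition ball_doubling :: "(real^'n::finite \<Rightarrow> real^'n \<Rightarrow> real) \<Rightarrow> bool" where
  "ball_doubling \<Gamma> \<longleftrightarrow>
     (\<exists>\<alpha>1 \<alpha>2. 2 < \<alpha>1 \<and> \<alpha>1 < \<alpha>2 \<and>
        (\<forall>x. \<forall>r>0.
           \<alpha>1 * measure lebesgue (Gball \<Gamma> x r) \<le> measure lebesgue (Gball \<Gamma> x (2 * r)) \<and>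
           measure lebesgue (Gball \<Gamma> x (2 * r)) \<le> \<alpha>2 * measure lebesgue (Gball \<Gamma> x r)))"

section \<open>Potential theory\<close>

definition L_harmonic_on ::
  "(real^'n::finite \<Rightarrow> real) \<Rightarrow> (real^'n \<Rightarrow> real^'n^'n) \<Rightarrow> (real^'n) set \<Rightarrow> (real^'n \<Rightarrow> real) \<Rightarrow> bool" where
  "L_harmonic_on V A W h \<longleftrightarrow> smooth_on W h \<and> (\<forall>x\<in>W. Lop V A h x = 0)"

definition liouville_property ::
  "(real^'n::finite \<Rightarrow> real) \<Rightarrow> (real^'n \<Rightarrow> real^'n^'n) \<Rightarrow> bool" where
  "liouville_property V A \<longleftrightarrow>
     (\<forall>h. L_harmonic_on V A UNIV h \<and> (bdd_above (range h) \<or> bdd_below (range h)) \<longrightarrow>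
        h constant_on UNIV)"

definition usc_on :: "'a::topological_space set \<Rightarrow> ('a \<Rightarrow> ereal) \<Rightarrow> bool" where
  "usc_on S u \<longleftrightarrow> (\<forall>c. openin (top_of_set S) {x\<in>S. u x < c})"

definition L_subharmonic_on ::
  "(real^'n::finite \<Rightarrow> real) \<Rightarrow> (real^'n \<Rightarrow> real^'n^'n) \<Rightarrow> (real^'n) set \<Rightarrow> (real^'n \<Rightarrow> ereal) \<Rightarrow> bool" where
  "L_subharmonic_on V A U u \<longleftrightarrow>
     (\<forall>x\<in>U. u x < \<infinity>) \<and> usc_on U u \<and>
     U \<subseteq> closure {x\<in>U. u x > -\<infinity>} \<and>
     (\<forall>W h. open W \<and> bounded W \<and> closure W \<subseteq> U \<and>
        L_harmonic_on V A W h \<and> continuous_on (closure W) h \<and>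
        (\<forall>x\<in>frontier W. u x \<le> ereal (h x)) \<longrightarrow>
        (\<forall>x\<in>W. u x \<le> ereal (h x)))"

definition bounded_above_subharmonic ::
  "(real^'n::finite \<Rightarrow> real) \<Rightarrow> (real^'n \<Rightarrow> real^'n^'n) \<Rightarrow> (real^'n) set \<Rightarrow> (real^'n \<Rightarrow> ereal) set" where
  "bounded_above_subharmonic V A U =
     {u. L_subharmonic_on V A U u \<and> (\<exists>c::real. \<forall>x\<in>U. u x \<le> ereal c)}"

definition L_thin_at_infinity ::
  "(real^'n::finite \<Rightarrow> real) \<Rightarrow> (real^'n \<Rightarrow> real^'n^'n) \<Rightarrow> (real^'n) set \<Rightarrow> bool" where
  "L_thin_at_infinity V A F \<longleftrightarrow>
     (\<exists>u\<in>bounded_above_subharmonic V A UNIV.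
        if bounded F then (SUP x\<in>F. u x) < (SUP x. u x)
        else Limsup (inf at_infinity (principal F)) u < Limsup at_infinity u)"

definition L_large_at_infinity ::
  "(real^'n::finite \<Rightarrow> real) \<Rightarrow> (real^'n \<Rightarrow> real^'n^'n) \<Rightarrow> (real^'n) set \<Rightarrow> bool" where
  "L_large_at_infinity V A F \<longleftrightarrow> \<not> L_thin_at_infinity V A F"

text \<open>A ball centred at the origin contributes an infinite term to the series, so such balls are
  excluded explicitly (in HOL, \<open>r / gam \<Gamma> 0 0 = 0\<close>). The index set \<open>J\<close> may be finite or empty.\<close>

definition p_bounded :: "(real^'n::finite \<Rightarrow> real^'n \<Rightarrow> real) \<Rightarrow> real \<Rightarrow> (real^'n) set \<Rightarrow> bool" where
  "p_bounded \<Gamma> p F \<longleftrightarrow>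
     (\<exists>(J::nat set) x r.
        (\<forall>n\<in>J. r n > 0 \<and> x n \<noteq> 0) \<and>
        F \<subseteq> (\<Union>n\<in>J. Gball \<Gamma> (x n) (r n)) \<and>
        (\<lambda>n. (r n / gam \<Gamma> 0 (x n)) powr p) summable_on J)"

definition Gcone :: "(real^'n::finite \<Rightarrow> real^'n \<Rightarrow> real) \<Rightarrow> (real^'n) set \<Rightarrow> bool" where
  "Gcone \<Gamma> K \<longleftrightarrow>
     (\<exists>(z :: nat \<Rightarrow> real^'n) R.
        (\<forall>j. R j > 0 \<and> Gball \<Gamma> (z j) (R j) \<subseteq> K) \<and>
        filterlim (\<lambda>j. norm (z j)) at_top sequentially \<and>
        liminf (\<lambda>j. ereal (R j / gam \<Gamma> 0 (z j))) > 0)"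

end

theory Submission
  imports Defs
begin

text \<open>
Suppose \<open>u\<close> is positive somewhere. For small \<open>d > 0\<close> the extension by zero of \<open>(u - d)\<^sub>+\<^sup>3\<close> is a bounded,
nonnegative function \<open>g\<close> of class \<open>C\<^sup>2\<close> on the whole space with \<open>L g \<ge> 0\<close> and \<open>g = 0\<close> off \<open>\<Omega>\<close>, and
\<open>g > 0\<close> somewhere. The defining identity of \<open>\<Gamma>\<close> extends to compactly supported \<open>C\<^sup>2\<close> functions, which
already gives the weak maximum principle; hence \<open>g\<close> is subharmonic and case (i) is immediate.

In the other cases let \<open>p\<close> be the potential of the density \<open>V L g \<ge> 0\<close>. Testing with
smooth truncations of \<open>\<Gamma> x\<close> gives mean value formulas, from which \<open>g + p \<le> sup g\<close>. So \<open>g + p\<close> is a bounded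
distributional solution, by hypoellipticity and the Liouville property it is a constant \<open>k > 0\<close>,
first weakly and then, by the mean value formula, at every point. Thus \<open>p = k\<close> off \<open>\<Omega>\<close>. On a cone
\<open>p (z\<^sub>j) \<rightarrow> 0\<close> by dominated convergence, a contradiction. In general, a Cartan type
estimate finds around each \<open>x\<close> with \<open>p x \<ge> k\<close> a ball whose radius is controlled by its mass, and a Vitali
selection in each dyadic annulus produces the required covering of the set \<open>p \<ge> k\<close> for every exponent above \<open>1\<close>.
\<close>

text \<open>Three is the least power for which the truncated function is C^2; it is convex and
  nondecreasing, so the second order chain rule only adds a nonnegative quadratic term. C^2 is also
  the regularity of the cutoffs and truncated kernels, which are built from truncated cubics; this
  is why the identity for \<Gamma> has to be extended beyond test functions. The main obstacle is
  that p is an integral against a singular kernel and is not known to be continuous. Hypoellipticity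
  identifies g + p with a smooth function only in the weak sense, whereas the value of p is needed
  on the complement of \<Omega>, possibly a null set. Pointwise values are recovered by averaging
  over level shells of \<Gamma> that escape to infinity: the averages of p tend to 0, those of g to
  g + p at the centre. The threshold 1 for the exponent comes from a geometric series. If the mass
  within distance 2^-n were below a multiple of 2^(-n s), the dyadic shell at that scale would
  contribute a multiple of 2^(-n (s - 1)) to the potential, which is summable exactly when s >
  1.\<close>

section \<open>Functions of class \<open>C\<^sup>1\<close> and \<open>C\<^sup>2\<close> via partial derivatives\<close>

text \<open>The operator involves coordinate partials, so regularity is recorded for them;
  \<open>C2_on_Ck\<close> is the passage from \<open>Ck_on\<close>.\<close>

definition C1_on :: "(real^'n::finite) set \<Rightarrow> (real^'n \<Rightarrow> real) \<Rightarrow> bool" where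
  "C1_on S f \<longleftrightarrow> (\<forall>x\<in>S. f differentiable (at x)) \<and> (\<forall>i. continuous_on S (partial i f))"

definition C2_on :: "(real^'n::finite) set \<Rightarrow> (real^'n \<Rightarrow> real) \<Rightarrow> bool" where
  "C2_on S f \<longleftrightarrow> (\<forall>x\<in>S. f differentiable (at x)) \<and> (\<forall>i. C1_on S (partial i f))"

lemma partial_eqI: "(f has_derivative D) (at x) \<Longrightarrow> partial i f x = D (axis i 1)"
  unfolding partial_def using frechet_derivative_at by metis

lemma frechet_derivative_partials:
  assumes "f differentiable (at x)"
  shows "frechet_derivative f (at x) v = (\<Sum>i\<in>UNIV. v $ i * partial i f x)"
proof -
  interpret linear "frechet_derivative f (at x)"
    using assms linear_frechet_derivative by blast
  have "frechet_derivative f (at x) v = frechet_derivative f (at x) (\<Sum>i\<in>UNIV. v $ i *\<^sub>R axis i 1)"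
    using basis_expansion[of v] by (simp add: scalar_mult_eq_scaleR)
  also have "\<dots> = (\<Sum>i\<in>UNIV. v $ i * partial i f x)"
    by (simp add: sum scale partial_def)
  finally show ?thesis .
qed

lemma has_derivative_partials:
  assumes "f differentiable (at x)"
  shows "(f has_derivative (\<lambda>v. \<Sum>i\<in>UNIV. v $ i * partial i f x)) (at x)"
  using assms frechet_derivative_partials[OF assms] frechet_derivative_works[of f "at x"]
  by (metis (no_types, lifting) ext)

lemma C2_on_Ck: assumes "Ck_on 2 S f" shows "C2_on S f"
  using assms unfolding C2_on_def C1_on_def by (auto simp: partial_def[abs_def] numeral_2_eq_2)

lemma C1_onD: "C1_on S f \<Longrightarrow> x \<in> S \<Longrightarrow> f differentiable (at x)"
  "C1_on S f \<Longrightarrow> continuous_on S (partial i f)"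
  by (auto simp: C1_on_def)

lemma C2_onD: "C2_on S f \<Longrightarrow> x \<in> S \<Longrightarrow> f differentiable (at x)"
  "C2_on S f \<Longrightarrow> C1_on S (partial i f)"
  by (auto simp: C2_on_def)

lemma C1_on_continuous: "C1_on S f \<Longrightarrow> continuous_on S f"
  by (meson C1_on_def continuous_at_imp_continuous_on differentiable_imp_continuous_within)

lemma C2_on_C1: "C2_on S f \<Longrightarrow> C1_on S f"
  by (auto simp: C2_on_def C1_on_def[of S f] intro: C1_on_continuous)

lemma C2_on_continuous: "C2_on S f \<Longrightarrow> continuous_on S f"
  using C2_on_C1 C1_on_continuous by blast

lemma C1_on_subset: "C1_on S f \<Longrightarrow> T \<subseteq> S \<Longrightarrow> C1_on T f"
  unfolding C1_on_def using continuous_on_subset by blast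

lemma C2_on_subset: "C2_on S f \<Longrightarrow> T \<subseteq> S \<Longrightarrow> C2_on T f"
  unfolding C2_on_def using C1_on_subset by blast

lemma C1_on_Un: "open S \<Longrightarrow> open T \<Longrightarrow> C1_on S f \<Longrightarrow> C1_on T f \<Longrightarrow> C1_on (S \<union> T) f"
  by (auto simp: C1_on_def intro: continuous_on_open_Un)

lemma C2_on_Un: "open S \<Longrightarrow> open T \<Longrightarrow> C2_on S f \<Longrightarrow> C2_on T f \<Longrightarrow> C2_on (S \<union> T) f"
  by (auto simp: C2_on_def intro: C1_on_Un)

text \<open>Valid also at points without a derivative: both functions satisfy
  \<open>has_derivative\<close> for the same maps, so the choice operator inside
  \<open>frechet_derivative\<close> picks the same value for both.\<close>

lemma partial_cong:
  assumes "open S" "x \<in> S" "\<And>y. y \<in> S \<Longrightarrow> f y = g y"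
  shows "partial i f x = partial i g x"
proof -
  have "(f has_derivative D) (at x) \<longleftrightarrow> (g has_derivative D) (at x)" for D
    using has_derivative_transform_within_open[OF _ assms(1,2), of f D UNIV g]
      has_derivative_transform_within_open[OF _ assms(1,2), of g D UNIV f] assms(3) by auto
  then show ?thesis by (simp add: partial_def frechet_derivative_def)
qed

lemma C1_on_cong:
  assumes "open S" "\<And>y. y \<in> S \<Longrightarrow> f y = g y" "C1_on S f"
  shows "C1_on S g"
proof -
  have "g differentiable at x" if "x \<in> S" for x
  proof -
    have "(f has_derivative frechet_derivative f (at x)) (at x)"
      using assms(3) that by (auto simp: C1_on_def frechet_derivative_works)
    from has_derivative_transform_within_open[OF this assms(1) that]
    show ?thesis using assms(2) by (auto simp: differentiable_def)
  qed
  moreover have "continuous_on S (partial i g)" for i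
  proof -
    have "partial i f x = partial i g x" if "x \<in> S" for x
      using partial_cong[OF assms(1) that, of f g] assms(2) by auto
    moreover have "continuous_on S (partial i f)" using assms(3) by (auto simp: C1_on_def)
    ultimately show ?thesis by (metis continuous_on_eq)
  qed
  ultimately show ?thesis by (auto simp: C1_on_def)
qed

lemma C2_on_cong:
  assumes "open S" "\<And>y. y \<in> S \<Longrightarrow> f y = g y" "C2_on S f"
  shows "C2_on S g"
proof -
  have "C1_on S g" using C1_on_cong assms C2_on_C1 by blast
  moreover have "C1_on S (partial i g)" for i
  proof -
    have "partial i f x = partial i g x" if "x \<in> S" for x
      using partial_cong[OF assms(1) that, of f g] assms(2) by auto
    from C1_on_cong[OF assms(1) this] show ?thesis using assms(3) by (auto simp: C2_on_def)
  qed
  ultimately show ?thesis by (auto simp: C2_on_def C1_on_def)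
qed

lemma partial_const [simp]: "partial i (\<lambda>x. c) = (\<lambda>x. 0)"
  by (rule ext, subst partial_eqI[OF has_derivative_const]) simp

lemma partial_zero:
  "open U \<Longrightarrow> (\<And>y. y \<in> U \<Longrightarrow> f y = 0) \<Longrightarrow> x \<in> U \<Longrightarrow> partial i f x = 0"
  using partial_cong[of U x f "\<lambda>x. 0" i] by simp

lemma partial_outside_support:
  assumes "x \<notin> closure {x. f x \<noteq> 0}" shows "partial i f x = 0"
  by (rule partial_zero[of "- closure {x. f x \<noteq> 0}"])
     (use assms closure_subset[of "{x. f x \<noteq> 0}"] in auto)

lemma partial_add:
  "f differentiable (at x) \<Longrightarrow> g differentiable (at x) \<Longrightarrow>
   partial i (\<lambda>y. f y + g y) x = partial i f x + partial i g x"
  by (subst partial_eqI[OF has_derivative_add[OF has_derivative_partials has_derivative_partials]])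
     (auto simp: axis_def if_distrib if_distribR sum.If_cases cong: if_cong)

lemma partial_mult:
  "f differentiable (at x) \<Longrightarrow> g differentiable (at x) \<Longrightarrow>
   partial i (\<lambda>y. f y * g y) x = f x * partial i g x + partial i f x * g x"
  by (subst partial_eqI[OF has_derivative_mult[OF has_derivative_partials has_derivative_partials]])
     (auto simp: axis_def if_distrib if_distribR sum.If_cases cong: if_cong)

lemma partial_cmult:
  "f differentiable (at x) \<Longrightarrow> partial i (\<lambda>y. c * f y) x = c * partial i f x"
  using partial_mult[of "\<lambda>y. c" x f i] by simp

lemma partial_diff:
  "f differentiable (at x) \<Longrightarrow> g differentiable (at x) \<Longrightarrow>
   partial i (\<lambda>y. f y - g y) x = partial i f x - partial i g x"
  by (subst partial_eqI[OF has_derivative_diff[OF has_derivative_partials has_derivative_partials]])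
     (auto simp: axis_def if_distrib if_distribR sum.If_cases cong: if_cong)

lemma partial_sum:
  assumes "\<And>j. j \<in> J \<Longrightarrow> f j differentiable (at x)"
  shows "partial i (\<lambda>y. \<Sum>j\<in>J. f j y) x = (\<Sum>j\<in>J. partial i (f j) x)"
  by (subst partial_eqI[OF has_derivative_sum[OF has_derivative_partials]])
     (use assms in \<open>auto simp: axis_def if_distrib if_distribR sum.If_cases cong: if_cong\<close>)

lemma partial_compose:
  assumes "f differentiable (at x)" "(F has_real_derivative d) (at (f x))"
  shows "partial i (\<lambda>y. F (f y)) x = d * partial i f x"
  by (subst partial_eqI[OF has_derivative_compose[OF has_derivative_partials[OF assms(1)]
        assms(2)[unfolded has_field_derivative_def]]])
     (auto simp: axis_def if_distrib if_distribR sum.If_cases cong: if_cong)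

lemma differentiable_compose_real:
  fixes f :: "real^'n::finite \<Rightarrow> real"
  assumes "f differentiable (at x)" "(F has_real_derivative d) (at (f x))"
  shows "(\<lambda>y. F (f y)) differentiable (at x)"
  using has_derivative_compose[OF has_derivative_partials[OF assms(1)]
        assms(2)[unfolded has_field_derivative_def]] differentiable_def by blast

lemma C1_on_const [simp]: "C1_on S (\<lambda>x. c)"
  by (simp add: C1_on_def)

lemma C2_on_const [simp]: "C2_on S (\<lambda>x. c)"
  by (simp add: C2_on_def)

lemma C1_on_add:
  assumes "C1_on S f" "C1_on S g" shows "C1_on S (\<lambda>x. f x + g x)"
proof -
  have "continuous_on S (\<lambda>x. partial i f x + partial i g x)" for i
    using assms by (intro continuous_intros) (auto simp: C1_on_def)
  then have "continuous_on S (partial i (\<lambda>x. f x + g x))" for i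
    using assms by (subst continuous_on_cong[OF refl partial_add]) (auto simp: C1_on_def)
  then show ?thesis using assms by (auto simp: C1_on_def)
qed

lemma C1_on_mult:
  assumes "C1_on S f" "C1_on S g" shows "C1_on S (\<lambda>x. f x * g x)"
proof -
  have "continuous_on S (\<lambda>x. f x * partial i g x + partial i f x * g x)" for i
    using assms C1_on_continuous by (intro continuous_intros) (auto simp: C1_on_def)
  then have "continuous_on S (partial i (\<lambda>x. f x * g x))" for i
    using assms by (subst continuous_on_cong[OF refl partial_mult]) (auto simp: C1_on_def)
  then show ?thesis using assms by (auto simp: C1_on_def)
qed

lemma C1_on_sum:
  assumes "\<And>j. j \<in> J \<Longrightarrow> C1_on S (f j)" shows "C1_on S (\<lambda>x. \<Sum>j\<in>J. f j x)"
  using assms by (induction J rule: infinite_finite_induct) (auto intro: C1_on_add)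

lemma C1_on_compose:
  assumes "C1_on S f" "\<And>x. x \<in> S \<Longrightarrow> (F has_real_derivative F' (f x)) (at (f x))"
    "continuous_on S (\<lambda>x. F' (f x))"
  shows "C1_on S (\<lambda>x. F (f x))"
proof -
  have "continuous_on S (\<lambda>x. F' (f x) * partial i f x)" for i
    using assms by (intro continuous_intros) (auto simp: C1_on_def)
  then have "continuous_on S (partial i (\<lambda>x. F (f x)))" for i
    using assms by (subst continuous_on_cong[OF refl partial_compose]) (auto simp: C1_on_def)
  then show ?thesis
    using assms(1) differentiable_compose_real[OF C1_onD(1)[OF assms(1)] assms(2)] by (auto simp: C1_on_def)
qed

lemma C2_on_add:
  assumes "open S" "C2_on S f" "C2_on S g" shows "C2_on S (\<lambda>x. f x + g x)"
proof -
  have "C1_on S (partial i (\<lambda>x. f x + g x))" for i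
    by (rule C1_on_cong[OF assms(1), of "\<lambda>x. partial i f x + partial i g x"])
       (use assms in \<open>auto simp: C2_on_def partial_add intro: C1_on_add\<close>)
  then show ?thesis using assms by (auto simp: C2_on_def)
qed

lemma C2_on_mult:
  assumes "open S" "C2_on S f" "C2_on S g" shows "C2_on S (\<lambda>x. f x * g x)"
proof -
  have "C1_on S (partial i (\<lambda>x. f x * g x))" for i
    by (rule C1_on_cong[OF assms(1), of "\<lambda>x. f x * partial i g x + partial i f x * g x"])
       (use assms C2_on_C1 in \<open>auto simp: C2_on_def partial_mult intro!: C1_on_add C1_on_mult\<close>)
  then show ?thesis using assms by (auto simp: C2_on_def)
qed

lemma C2_on_diff:
  assumes "open S" "C2_on S f" "C2_on S g" shows "C2_on S (\<lambda>x. f x - g x)"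
  using C2_on_add[OF assms(1,2) C2_on_mult[OF assms(1) C2_on_const[of S "-1"] assms(3)]] by simp

lemma C2_on_sum:
  assumes "open S" "\<And>j. j \<in> J \<Longrightarrow> C2_on S (f j)" shows "C2_on S (\<lambda>x. \<Sum>j\<in>J. f j x)"
  using assms(2) by (induction J rule: infinite_finite_induct) (auto intro: C2_on_add[OF assms(1)])

lemma C2_on_compose:
  assumes "open S" "C2_on S f"
    "\<And>x. x \<in> S \<Longrightarrow> (F has_real_derivative F' (f x)) (at (f x))"
    "\<And>x. x \<in> S \<Longrightarrow> (F' has_real_derivative F'' (f x)) (at (f x))"
    "continuous_on S (\<lambda>x. F'' (f x))"
  shows "C2_on S (\<lambda>x. F (f x))"
proof -
  have 1: "C1_on S (\<lambda>x. F' (f x))"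
    using C1_on_compose[OF C2_on_C1[OF assms(2)] assms(4,5)] by simp
  have "C1_on S (partial i (\<lambda>x. F (f x)))" for i
    by (rule C1_on_cong[OF assms(1), of "\<lambda>x. F' (f x) * partial i f x"])
       (use 1 assms C2_on_C1 in \<open>auto simp: C2_on_def intro!: C1_on_mult partial_compose[symmetric]\<close>)
  then show ?thesis
    using differentiable_compose_real[OF C2_onD(1)[OF assms(2)] assms(3)] by (auto simp: C2_on_def)
qed

lemma partial_coord: "partial i (\<lambda>x. x $ j) = (\<lambda>x. if i = j then 1 else 0)"
  by (rule ext, subst partial_eqI[OF bounded_linear_imp_has_derivative[OF bounded_linear_vec_nth]])
     (simp add: axis_def)

lemma C2_on_coord: "C2_on S (\<lambda>x. x $ j)"
  unfolding C2_on_def partial_coord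
  using bounded_linear_imp_differentiable[OF bounded_linear_vec_nth] by auto

lemma C2_on_norm_sq:
  assumes "open S" shows "C2_on S (\<lambda>x. (norm (x - a))\<^sup>2)"
proof -
  have "(norm (x - a))\<^sup>2 = (\<Sum>i\<in>UNIV. (x $ i - a $ i) * (x $ i - a $ i))" for x
    by (simp add: power2_norm_eq_inner inner_vec_def)
  then show ?thesis
    using assms by (auto intro!: C2_on_sum C2_on_mult C2_on_diff C2_on_coord)
qed

section \<open>Convolution and smooth bump functions\<close>

lemma Ck_on_continuous: "Ck_on k S f \<Longrightarrow> continuous_on S f"
  by (cases k) (auto intro!: continuous_at_imp_continuous_on differentiable_imp_continuous_within)

lemma Ck_on_SucD: "Ck_on (Suc k) S f \<Longrightarrow> Ck_on k S f"
proof (induction k arbitrary: f)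
  case 0
  then show ?case using Ck_on_continuous[of "Suc 0" S f] by simp
next
  case (Suc k)
  then show ?case by (metis Ck_on.simps(2))
qed

lemma frechet_derivative_eqI:
  "(\<And>x. (f has_derivative D x) (at x)) \<Longrightarrow> (\<lambda>x. frechet_derivative f (at x) v) = (\<lambda>x. D x v)"
  using frechet_derivative_at by (metis (full_types, lifting) ext)

lemma Ck_on_const: "Ck_on k UNIV (\<lambda>x. c)"
proof (induction k arbitrary: c)
  case (Suc k)
  have "(\<lambda>x. frechet_derivative (\<lambda>x. c) (at x) v) = (\<lambda>x. 0)" for v
    by (rule frechet_derivative_eqI[where D="\<lambda>x v. 0"]) simp
  then show ?case using Suc by simp
qed simp

lemma Ck_on_linear:
  assumes "bounded_linear f" shows "Ck_on k UNIV f"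
proof (cases k)
  case 0
  then show ?thesis using assms by (simp add: linear_continuous_on)
next
  case (Suc j)
  have "(\<lambda>x. frechet_derivative f (at x) v) = (\<lambda>x. f v)" for v
    by (rule frechet_derivative_eqI[where D="\<lambda>x. f"])
       (rule bounded_linear_imp_has_derivative[OF assms])
  then show ?thesis using Suc assms by (simp add: Ck_on_const bounded_linear_imp_differentiable)
qed

lemma Ck_on_add:
  assumes "Ck_on k UNIV f" "Ck_on k UNIV g" shows "Ck_on k UNIV (\<lambda>x. f x + g x)"
  using assms
proof (induction k arbitrary: f g)
  case 0
  then show ?case by (auto intro: continuous_intros)
next
  case (Suc k)
  have "(\<lambda>x. frechet_derivative (\<lambda>x. f x + g x) (at x) v) =
     (\<lambda>x. frechet_derivative f (at x) v + frechet_derivative g (at x) v)" for v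
    by (rule frechet_derivative_eqI)
       (use Suc.prems in \<open>auto intro!: has_derivative_add simp: frechet_derivative_works[symmetric]\<close>)
  then show ?case using Suc by simp
qed

lemma Ck_on_mult:
  fixes f g :: "'a::real_normed_vector \<Rightarrow> real"
  assumes "Ck_on k UNIV f" "Ck_on k UNIV g" shows "Ck_on k UNIV (\<lambda>x. f x * g x)"
  using assms
proof (induction k arbitrary: f g)
  case 0
  then show ?case by (auto intro: continuous_intros)
next
  case (Suc k)
  have "(\<lambda>x. frechet_derivative (\<lambda>x. f x * g x) (at x) v) =
     (\<lambda>x. f x * frechet_derivative g (at x) v + frechet_derivative f (at x) v * g x)" for v
    by (rule frechet_derivative_eqI)
       (use Suc.prems in \<open>auto intro!: has_derivative_mult simp: frechet_derivative_works[symmetric]\<close>)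
  moreover have "Ck_on k UNIV f" "Ck_on k UNIV g"
    using Suc.prems Ck_on_SucD by blast+
  ultimately show ?case using Suc by (auto intro!: Ck_on_add)
qed

section \<open>A bump function built from exp(-1/s)\<close>

lemma DERIV_zero_quadratic:
  fixes F :: "real \<Rightarrow> real"
  assumes "\<And>h. \<bar>F h\<bar> \<le> C * h\<^sup>2"
  shows "(F has_real_derivative 0) (at 0)"
proof -
  have F0: "F 0 = 0" using assms[of 0] by simp
  have "\<bar>F h / h\<bar> \<le> C * \<bar>h\<bar>" if "h \<noteq> 0" for h
  proof -
    have "\<bar>F h / h\<bar> \<le> C * h\<^sup>2 / \<bar>h\<bar>"
      unfolding abs_divide using assms by (simp add: divide_right_mono)
    also have "\<dots> = C * \<bar>h\<bar>"
      using that by (simp add: power2_eq_square abs_if field_simps)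
    finally show ?thesis .
  qed
  then have "eventually (\<lambda>h. norm (F h / h) \<le> C * \<bar>h\<bar>) (at 0)"
    by (auto simp: eventually_at_filter)
  moreover have "((\<lambda>h::real. C * \<bar>h\<bar>) \<longlongrightarrow> 0) (at 0)"
    by (auto intro!: tendsto_eq_intros)
  ultimately have "((\<lambda>h. F h / h) \<longlongrightarrow> 0) (at 0)"
    by (rule Lim_null_comparison)
  then show ?thesis by (simp add: DERIV_def F0)
qed

text \<open>The family over all \<open>m\<close> is closed under differentiation up to linear
  combinations, which turns the smoothness of the classical bump exp(-1/s) into an induction on the
  order.\<close>

definition exp_bump :: "nat \<Rightarrow> real \<Rightarrow> real" where
  "exp_bump m s = (if s > 0 then exp (- 1 / s) / s ^ m else 0)"

text \<open>The term of index \<open>m + 2\<close> in the exponential series alone gives exp(1/h) >=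
  h^-(m+2) / (m+2)!. Two powers beyond \<open>m\<close> are kept so that
  \<open>DERIV_zero_quadratic\<close> applies at the junction point 0.\<close>

lemma exp_bump_quadratic: "\<bar>exp_bump m h\<bar> \<le> fact (m + 2) * h\<^sup>2"
proof (cases "h > 0")
  case True
  define K :: real where "K = fact (m + 2)"
  have K: "K > 0" by (simp add: K_def)
  have "(1 / h) ^ (m + 2) / K \<le> exp (1 / h)"
    using sum_le_suminf[OF summable_exp_generic[of "1 / h"], of "{m + 2}"] True
    by (simp add: exp_def divide_inverse mult.commute K_def)
  then have "K * h ^ (m + 2) * ((1 / h) ^ (m + 2) / K) \<le> K * h ^ (m + 2) * exp (1 / h)"
    using True K by (intro mult_left_mono) auto
  then have "1 \<le> K * h ^ (m + 2) * exp (1 / h)"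
    using True K by (simp add: power_one_over)
  then have "exp (- 1 / h) \<le> K * h\<^sup>2 * h ^ m"
    by (simp add: exp_minus divide_le_eq inverse_eq_divide power_add power2_eq_square mult_ac)
  then show ?thesis
    unfolding K_def[symmetric] using True by (simp add: exp_bump_def divide_le_eq)
qed (simp add: exp_bump_def)

lemma DERIV_exp_bump:
  "(exp_bump m has_real_derivative exp_bump (m + 2) s - m * exp_bump (m + 1) s) (at s)"
proof -
  consider "s > 0" | "s = 0" | "s < 0" by linarith
  then show ?thesis
  proof cases
    case 1
    have "real m * inverse s ^ (m - Suc 0) * (inverse s * inverse s) = m * inverse s ^ (m + 1)"
      by (cases m) auto
    then have "((\<lambda>s. inverse s ^ m * exp (- inverse s)) has_real_derivative
        exp_bump (m + 2) s - m * exp_bump (m + 1) s) (at s)"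
      using 1 by (auto intro!: derivative_eq_intros simp: exp_bump_def divide_inverse algebra_simps)
        (simp add: power_inverse)
    then show ?thesis
      by (rule has_field_derivative_transform_within_open[of _ _ _ "{0<..}"])
         (use 1 in \<open>auto simp: exp_bump_def divide_inverse power_inverse\<close>)
  next
    case 2
    moreover have "exp_bump (m + 2) 0 - m * exp_bump (m + 1) 0 = 0"
      by (simp add: exp_bump_def)
    ultimately show ?thesis
      using DERIV_zero_quadratic[OF exp_bump_quadratic, of m] by metis
  next
    case 3
    have "((\<lambda>s. 0) has_real_derivative exp_bump (m + 2) s - m * exp_bump (m + 1) s) (at s)"
      using 3 by (auto simp: exp_bump_def)
    then show ?thesis
      by (rule has_field_derivative_transform_within_open[of _ _ _ "{..<0}"])
         (use 3 in \<open>auto simp: exp_bump_def\<close>)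
  qed
qed

definition bump :: "real \<Rightarrow> 'a::euclidean_space \<Rightarrow> real" where
  "bump e x = exp_bump 0 (e\<^sup>2 - (norm x)\<^sup>2)"

text \<open>The induction runs over all \<open>m\<close> at once, since a derivative raises the
  index by 1 and by 2. The squared norm is used because it is smooth at the origin.\<close>

lemma Ck_on_exp_bump: "Ck_on k UNIV (\<lambda>x::'a::euclidean_space. exp_bump m (c - (norm x)\<^sup>2))"
proof -
  have D: "((\<lambda>x. exp_bump m (c - (norm x)\<^sup>2)) has_derivative
      (\<lambda>v. (exp_bump (m + 2) (c - (norm x)\<^sup>2) - m * exp_bump (m + 1) (c - (norm x)\<^sup>2)) * (-2 * (x \<bullet> v)))) (at x)"
    for x :: 'a and m
  proof -
    have "((\<lambda>x. c - (norm x)\<^sup>2) has_derivative (\<lambda>v. -2 * (x \<bullet> v))) (at x)"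
      unfolding power2_norm_eq_inner
      by (auto intro!: derivative_eq_intros simp: inner_commute)
    from has_derivative_compose[OF this DERIV_exp_bump[of m "c - (norm x)\<^sup>2", unfolded has_field_derivative_def]]
    show ?thesis .
  qed
  show ?thesis
  proof (induction k arbitrary: m)
    case 0
    have "continuous_on UNIV (\<lambda>x::'a. exp_bump m (c - (norm x)\<^sup>2))"
      using D has_derivative_continuous by (blast intro: continuous_at_imp_continuous_on)
    then show ?case by simp
  next
    case (Suc k)
    have "Ck_on k UNIV (\<lambda>x::'a. (exp_bump (m + 2) (c - (norm x)\<^sup>2) + - real m * exp_bump (m + 1) (c - (norm x)\<^sup>2)) * (-2 * (x \<bullet> v)))" for v
      by (intro Ck_on_mult Ck_on_add Ck_on_const Suc Ck_on_linear bounded_linear_inner_left)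
    then show ?case
      using D by (auto simp: frechet_derivative_eqI[OF D] differentiable_def)
  qed
qed

lemma smooth_on_bump: "smooth_on UNIV (bump e)"
  unfolding smooth_on_def bump_def using Ck_on_exp_bump by blast

lemma bump_nonneg: "bump e x \<ge> 0"
  by (simp add: bump_def exp_bump_def)

lemma bump_pos_iff: "e > 0 \<Longrightarrow> bump e x > 0 \<longleftrightarrow> norm x < e"
  using power_strict_mono[of "norm x" e 2] power_mono[of e "norm x" 2]
  by (cases "norm x < e") (auto simp: bump_def exp_bump_def simp del: power_mono_iff)

lemma bump_eq_0: "e > 0 \<Longrightarrow> e \<le> norm x \<Longrightarrow> bump e x = 0"
  using bump_pos_iff[of e x] bump_nonneg[of e x] by linarith

section \<open>Continuous functions of bounded support and convolution\<close>

definition Cc :: "('a::euclidean_space \<Rightarrow> real) \<Rightarrow> bool" where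
  "Cc f \<longleftrightarrow> continuous_on UNIV f \<and> bounded {x. f x \<noteq> 0}"

lemma Cc_cbox:
  assumes "Cc f" obtains a where "{x. f x \<noteq> 0} \<subseteq> cbox (- a) a"
  using assms bounded_subset_cbox_symmetric unfolding Cc_def by blast

lemma Cc_integrable: assumes "Cc f" shows "integrable lborel f"
proof -
  obtain a where a: "{x. f x \<noteq> 0} \<subseteq> cbox (- a) a" using Cc_cbox[OF assms] .
  have "integrable lborel (\<lambda>x. indicator (cbox (- a) a) x *\<^sub>R f x)"
    by (rule borel_integrable_compact[OF compact_cbox continuous_on_subset])
      (use assms in \<open>auto simp: Cc_def\<close>)
  moreover have "(\<lambda>x. indicator (cbox (- a) a) x *\<^sub>R f x) = f"
    using a by (intro ext) (auto simp: indicator_def)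
  ultimately show ?thesis by simp
qed

lemma Cc_integral:
  assumes "Cc f" "{x. f x \<noteq> 0} \<subseteq> cbox a b"
  shows "(LINT x|lborel. f x) = integral (cbox a b) f"
proof -
  have "(\<lambda>x. if x \<in> cbox a b then f x else 0) = f" using assms(2) by (intro ext) auto
  then show ?thesis
    using integral_lborel[OF Cc_integrable[OF assms(1)]] integral_restrict_UNIV[of "cbox a b" f] by simp
qed

lemma continuous_on_compact_bounded:
  fixes f :: "'a::topological_space \<Rightarrow> real"
  assumes "continuous_on K f" "compact K" shows "\<exists>B. \<forall>x\<in>K. \<bar>f x\<bar> \<le> B"
  using compact_imp_bounded[OF compact_continuous_image[OF assms]] unfolding bounded_iff real_norm_def by blast

lemma Cc_measurable: "Cc f \<Longrightarrow> f \<in> borel_measurable borel"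
  by (auto simp: Cc_def intro: borel_measurable_continuous_onI)

lemma Cc_support:
  assumes "Cc f" obtains R where "\<And>x. norm x > R \<Longrightarrow> f x = 0"
proof -
  obtain R where "\<And>x. f x \<noteq> 0 \<Longrightarrow> norm x \<le> R" using assms unfolding Cc_def bounded_iff by blast
  then show ?thesis using that by (metis not_less)
qed

lemma Cc_bounded:
  assumes "Cc f" obtains B where "\<And>x. \<bar>f x\<bar> \<le> B"
proof -
  obtain a where a: "{x. f x \<noteq> 0} \<subseteq> cbox (- a) a" using Cc_cbox[OF assms] .
  have "continuous_on (cbox (- a) a) f"
    by (rule continuous_on_subset[of UNIV]) (use assms in \<open>auto simp: Cc_def\<close>)
  then obtain B where B: "\<forall>x\<in>cbox (- a) a. \<bar>f x\<bar> \<le> B"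
    using continuous_on_compact_bounded compact_cbox by blast
  have "\<bar>f x\<bar> \<le> max 0 B" for x
  proof (cases "f x = 0")
    case False
    then have "x \<in> cbox (- a) a" using a by blast
    then have "\<bar>f x\<bar> \<le> B" using B by blast
    then show ?thesis by simp
  qed simp
  then show ?thesis using that by blast
qed

lemma Cc_subset:
  assumes "continuous_on UNIV f" "bounded K" "\<And>x. x \<notin> K \<Longrightarrow> f x = 0"
  shows "Cc f"
  unfolding Cc_def using assms bounded_subset[of K "{x. f x \<noteq> 0}"] by auto

lemma Cc_mult: "Cc f \<Longrightarrow> continuous_on UNIV g \<Longrightarrow> Cc (\<lambda>x. f x * g x)"
  by (rule Cc_subset[of _ "{x. f x \<noteq> 0}"]) (auto simp: Cc_def intro!: continuous_on_mult)

lemma integral_reflect_translate: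
  fixes f :: "'a::euclidean_space \<Rightarrow> real"
  assumes [measurable]: "f \<in> borel_measurable borel"
  shows "(LINT y|lborel. f (x - y)) = (LINT y|lborel. f y)"
proof -
  have "lborel = density (distr lborel borel (\<lambda>y. x + (-1::real) *\<^sub>R y))
      (\<lambda>_. ennreal (\<bar>-1::real\<bar> ^ DIM('a)))"
    by (rule lborel_affine) simp
  also have "\<dots> = distr lborel borel (\<lambda>y. x - y)"
    by (simp add: density_1)
  finally have "(LINT y|lborel. f y) = (LINT y|distr lborel borel (\<lambda>y. x - y). f y)" by simp
  also have "\<dots> = (LINT y|lborel. f (x - y))"
    by (subst integral_distr) auto
  finally show ?thesis by simp
qed

definition conv :: "(real^'n::finite \<Rightarrow> real) \<Rightarrow> (real^'n \<Rightarrow> real) \<Rightarrow> real^'n \<Rightarrow> real" where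
  "conv f g x = (LINT t|lborel. f t * g (x - t))"

lemma conv_commute:
  assumes "continuous_on UNIV f" "continuous_on UNIV g"
  shows "conv f g = conv g f"
proof
  fix x
  have [measurable]: "f \<in> borel_measurable borel" "g \<in> borel_measurable borel"
    using assms by (auto intro: borel_measurable_continuous_onI)
  show "conv f g x = conv g f x"
    unfolding conv_def using integral_reflect_translate[of "\<lambda>t. g t * f (x - t)" x]
    by (simp add: mult.commute)
qed

lemma Cc_conv_integrand:
  "Cc f \<Longrightarrow> continuous_on UNIV g \<Longrightarrow> Cc (\<lambda>t. f t * g (x - t))"
  by (rule Cc_mult) (auto intro!: continuous_on_compose2[of UNIV g] continuous_intros)

lemma conv_eq_integral:
  assumes "Cc f" "continuous_on UNIV g" "{x. f x \<noteq> 0} \<subseteq> cbox a b"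
  shows "conv f g x = integral (cbox a b) (\<lambda>t. f t * g (x - t))"
  unfolding conv_def by (rule Cc_integral[OF Cc_conv_integrand]) (use assms in auto)

lemma leibniz_convolution:
  fixes \<rho> \<eta> :: "real^'n::finite \<Rightarrow> real"
  assumes \<rho>: "continuous_on UNIV \<rho>" and \<eta>: "C1_on UNIV \<eta>"
  shows "((\<lambda>x. integral (cbox a b) (\<lambda>t. \<rho> t * \<eta> (x - t))) has_derivative
     (\<lambda>v. integral (cbox a b) (\<lambda>t. \<rho> t * frechet_derivative \<eta> (at (x - t)) v))) (at x)"
proof -
  \<comment> \<open>The derivative of \<eta> as a bounded linear functional:
    \<open>leibniz_rule\<close> asks for joint continuity in the operator norm, which is inherited
    from continuity of the gradient vector.\<close>
  define G where "G z = blinfun_inner_left (\<chi> i. partial i \<eta> z)" for z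
  have G: "blinfun_apply (G z) = frechet_derivative \<eta> (at z)" for z
    using \<eta> by (auto simp: G_def inner_vec_def frechet_derivative_partials C1_on_def)
  have contG: "continuous_on UNIV G"
    unfolding G_def using \<eta>
    by (intro bounded_linear.continuous_on[OF bounded_linear_blinfun_inner_left] continuous_on_vec_lambda)
       (auto simp: C1_on_def)
  have cont\<eta>: "continuous_on UNIV \<eta>" using \<eta> C1_on_continuous by blast
  have c2: "continuous_on (UNIV \<times> cbox a b) (\<lambda>(x, t). \<rho> t *\<^sub>R G (x - t))"
    unfolding split_beta
    by (intro continuous_intros continuous_on_compose2[OF \<rho>] continuous_on_compose2[OF contG]) auto
  have "((\<lambda>x. integral (cbox a b) (\<lambda>t. \<rho> t * \<eta> (x - t))) has_derivative
     integral (cbox a b) (\<lambda>t. \<rho> t *\<^sub>R G (x - t))) (at x within UNIV)"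
  proof (rule leibniz_rule[OF _ _ c2])
    fix x t
    have "(\<eta> has_derivative blinfun_apply (G (x - t))) (at (x - t))"
      using \<eta> by (simp add: G frechet_derivative_works[symmetric] C1_on_def)
    then have "((\<lambda>x. \<eta> (x - t)) has_derivative (\<lambda>v. blinfun_apply (G (x - t)) v)) (at x)"
      by (rule has_derivative_compose[of "\<lambda>x. x - t" "\<lambda>v. v", rotated]) (auto intro!: derivative_eq_intros)
    then have "((\<lambda>x. \<rho> t * \<eta> (x - t)) has_derivative (\<lambda>v. \<rho> t * blinfun_apply (G (x - t)) v)) (at x)"
      by (rule has_derivative_mult_right)
    moreover have "blinfun_apply (\<rho> t *\<^sub>R G (x - t)) = (\<lambda>v. \<rho> t * blinfun_apply (G (x - t)) v)"
      by (simp add: fun_eq_iff blinfun.scaleR_left)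
    ultimately show "((\<lambda>x. \<rho> t * \<eta> (x - t)) has_derivative blinfun_apply (\<rho> t *\<^sub>R G (x - t))) (at x within UNIV)"
      by simp
  next
    fix x show "(\<lambda>t. \<rho> t * \<eta> (x - t)) integrable_on cbox a b"
      by (intro integrable_continuous continuous_intros continuous_on_compose2[OF \<rho>] continuous_on_compose2[OF cont\<eta>]) auto
  qed auto
  then show ?thesis
  proof (rule has_derivative_eq_rhs, intro ext)
    fix v
    have "(\<lambda>t. \<rho> t *\<^sub>R G (x - t)) integrable_on cbox a b"
      by (intro integrable_continuous continuous_intros continuous_on_compose2[OF \<rho>] continuous_on_compose2[OF contG]) auto
    from blinfun_apply_integral[OF this]
    show "blinfun_apply (integral (cbox a b) (\<lambda>t. \<rho> t *\<^sub>R G (x - t))) v =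
      integral (cbox a b) (\<lambda>t. \<rho> t * frechet_derivative \<eta> (at (x - t)) v)"
      by (simp add: blinfun.scaleR_left G)
  qed
qed

lemma conv_has_derivative:
  assumes f: "Cc f" and g: "C1_on UNIV g"
  shows "(conv f g has_derivative (\<lambda>v. conv f (\<lambda>z. frechet_derivative g (at z) v) x)) (at x)"
proof -
  obtain a where a: "{x. f x \<noteq> 0} \<subseteq> cbox (- a) a" using Cc_cbox[OF f] .
  have "continuous_on UNIV g" using g C1_on_continuous by blast
  then have 1: "conv f g = (\<lambda>x. integral (cbox (- a) a) (\<lambda>t. f t * g (x - t)))"
    using conv_eq_integral[OF f _ a] by blast
  have "continuous_on UNIV (\<lambda>z. frechet_derivative g (at z) v)" for v
    using g by (simp add: frechet_derivative_partials C1_on_def)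
      (auto intro!: continuous_intros)
  then have 2: "conv f (\<lambda>z. frechet_derivative g (at z) v) x =
      integral (cbox (- a) a) (\<lambda>t. f t * frechet_derivative g (at (x - t)) v)" for v
    using conv_eq_integral[OF f _ a] by blast
  show ?thesis
    unfolding 1 2 using f g by (intro leibniz_convolution) (auto simp: Cc_def)
qed

lemma continuous_on_conv:
  assumes f: "Cc f" and g: "continuous_on UNIV g" shows "continuous_on UNIV (conv f g)"
proof -
  obtain a where a: "{x. f x \<noteq> 0} \<subseteq> cbox (- a) a" using Cc_cbox[OF f] .
  have 1: "conv f g = (\<lambda>x. integral (cbox (- a) a) (\<lambda>t. f t * g (x - t)))"
    using conv_eq_integral[OF f g a] by blast
  have f': "continuous_on UNIV f" using f by (simp add: Cc_def)
  show ?thesis unfolding 1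
    by (rule integral_continuous_on_param, unfold split_beta)
       (intro continuous_intros continuous_on_compose2[OF f'] continuous_on_compose2[OF g]; auto)
qed

lemma Ck_on_conv:
  assumes f: "Cc f" and "Ck_on k UNIV g" shows "Ck_on k UNIV (conv f g)"
  using assms(2)
proof (induction k arbitrary: g)
  case 0
  then show ?case using continuous_on_conv[OF f] by simp
next
  case (Suc k)
  have "C1_on UNIV g"
    using Suc.prems Ck_on_continuous[of k UNIV] by (auto simp: C1_on_def partial_def[abs_def])
  note D = conv_has_derivative[OF f this]
  show ?case
    using D Suc by (auto simp: frechet_derivative_eqI[OF D] differentiable_def)
qed

lemma partial_conv:
  assumes "Cc f" "C1_on UNIV g" shows "partial i (conv f g) = conv f (partial i g)"
  using partial_eqI[OF conv_has_derivative[OF assms]] by (auto simp: partial_def[abs_def])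

lemma C1_on_conv:
  assumes "Cc f" "C1_on UNIV g" shows "C1_on UNIV (conv f g)"
  using conv_has_derivative[OF assms] continuous_on_conv[OF assms(1)] assms(2)
  by (auto simp: C1_on_def partial_conv[OF assms] differentiable_def)

lemma C2_on_conv:
  assumes "Cc f" "C2_on UNIV g" shows "C2_on UNIV (conv f g)"
  using C1_on_conv[OF assms(1)] partial_conv[OF assms(1) C2_on_C1[OF assms(2)]] assms(2) C2_on_C1[OF assms(2)]
    C1_onD(1)[OF C1_on_conv[OF assms(1) C2_on_C1[OF assms(2)]]]
  by (auto simp: C2_on_def)

section \<open>Cutoffs, integration by parts, mollification\<close>

lemma DERIV_max_sq: "((\<lambda>t::real. (max 0 t)\<^sup>2) has_real_derivative 2 * max 0 t) (at t)"
proof -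
  consider "t > 0" | "t = 0" | "t < 0" by linarith
  then show ?thesis
  proof cases
    case 1
    have "((\<lambda>t. t\<^sup>2) has_real_derivative 2 * max 0 t) (at t)"
      using 1 by (auto intro!: derivative_eq_intros)
    then show ?thesis
      by (rule has_field_derivative_transform_within_open[of _ _ _ "{0<..}"]) (use 1 in auto)
  next
    case 2
    have "\<bar>(max 0 h)\<^sup>2\<bar> \<le> 1 * h\<^sup>2" for h :: real by (simp add: max_def)
    from DERIV_zero_quadratic[OF this] show ?thesis using 2 by simp
  next
    case 3
    have "((\<lambda>t. 0) has_real_derivative 2 * max 0 t) (at t)" using 3 by simp
    then show ?thesis
      by (rule has_field_derivative_transform_within_open[of _ _ _ "{..<0}"]) (use 3 in auto)
  qed
qed

lemma DERIV_max_cube: "((\<lambda>t::real. (max 0 t) ^ 3) has_real_derivative 3 * (max 0 t)\<^sup>2) (at t)"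
proof -
  have "((\<lambda>t. (max 0 t)\<^sup>2 * t) has_real_derivative 3 * (max 0 t)\<^sup>2) (at t)"
    by (rule derivative_eq_intros DERIV_max_sq refl)+ (simp add: max_def power2_eq_square)
  moreover have "(\<lambda>t::real. (max 0 t)\<^sup>2 * t) = (\<lambda>t. (max 0 t) ^ 3)"
    by (intro ext) (simp add: max_def power2_eq_square power3_eq_cube)
  ultimately show ?thesis by simp
qed

lemma DERIV_shift_max_cube:
  "((\<lambda>t::real. (max 0 (t - d)) ^ 3) has_real_derivative 3 * (max 0 (t - d))\<^sup>2) (at t)"
  "((\<lambda>t::real. 3 * (max 0 (t - d))\<^sup>2) has_real_derivative 6 * max 0 (t - d)) (at t)"
proof -
  have D: "((\<lambda>t. t - d) has_real_derivative 1) (at t)" by (auto intro!: derivative_eq_intros)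
  show "((\<lambda>t. (max 0 (t - d)) ^ 3) has_real_derivative 3 * (max 0 (t - d))\<^sup>2) (at t)"
    using DERIV_chain2[OF DERIV_max_cube D] by simp
  show "((\<lambda>t. 3 * (max 0 (t - d))\<^sup>2) has_real_derivative 6 * max 0 (t - d)) (at t)"
    using DERIV_cmult[OF DERIV_chain2[OF DERIV_max_sq D], of 3] by simp
qed

lemma C2_on_max_cube:
  assumes "open S" "C2_on S w" shows "C2_on S (\<lambda>x. (max 0 (w x - d)) ^ 3)"
  by (rule C2_on_compose[OF assms, where F'="\<lambda>t. 3 * (max 0 (t - d))\<^sup>2" and F''="\<lambda>t. 6 * max 0 (t - d)"])
     (use C2_on_continuous[OF assms(2)] in \<open>auto intro!: DERIV_shift_max_cube continuous_intros\<close>)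

text \<open>Third difference of the truncated cubic: a step of class \<open>C\<^sup>2\<close> from \<open>0\<close> to \<open>1\<close> on \<open>[0, 3]\<close>.\<close>

lemma cutoff_exists:
  obtains \<zeta> :: "real^'n::finite \<Rightarrow> real"
  where "C2_on UNIV \<zeta>" "\<And>x. norm x \<le> R \<Longrightarrow> \<zeta> x = 1" "bounded {x. \<zeta> x \<noteq> 0}"
proof -
  define s :: "real \<Rightarrow> real" where
    "s t = 1/6 * max 0 (t - 0) ^ 3 + (-1/2) * max 0 (t - 1) ^ 3 + 1/2 * max 0 (t - 2) ^ 3 + (-1/6) * max 0 (t - 3) ^ 3" for t
  define \<zeta> :: "real^'n \<Rightarrow> real" where "\<zeta> x = s ((R\<^sup>2 + 3) - (norm (x - 0))\<^sup>2)" for x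
  have "C2_on UNIV \<zeta>"
    unfolding \<zeta>_def s_def by (intro C2_on_add C2_on_mult C2_on_max_cube C2_on_diff C2_on_norm_sq open_UNIV C2_on_const)
  moreover have "s t = 1" if "t \<ge> 3" for t
    using that by (simp add: s_def max_def power3_eq_cube algebra_simps)
  then have "\<zeta> x = 1" if "norm x \<le> R" for x
    using that power_mono[OF that, of 2] by (simp add: \<zeta>_def)
  moreover have "s t = 0" if "t \<le> 0" for t
    using that by (simp add: s_def)
  then have "(norm x)\<^sup>2 < R\<^sup>2 + 3" if "\<zeta> x \<noteq> 0" for x
    using that unfolding \<zeta>_def by (metis diff_zero linorder_not_less diff_le_0_iff_le)
  then have "norm x \<le> sqrt (R\<^sup>2 + 3)" if "\<zeta> x \<noteq> 0" for x
    using that by (intro real_le_rsqrt) (auto intro: less_imp_le)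
  then have "bounded {x. \<zeta> x \<noteq> 0}"
    unfolding bounded_iff by blast
  ultimately show ?thesis using that by blast
qed

lemma Cc_integral_pos:
  fixes f :: "'a::euclidean_space \<Rightarrow> real"
  assumes "Cc f" "\<And>x. f x \<ge> 0" "f a > 0" shows "(LINT x|lborel. f x) > 0"
proof -
  have "isCont f a" using assms(1) by (auto simp: Cc_def continuous_on_eq_continuous_at)
  then obtain r where r: "r > 0" "\<And>x. dist x a < r \<Longrightarrow> dist (f x) (f a) < f a / 2"
    using assms(3) unfolding continuous_at_eps_delta by (metis half_gt_zero)
  have le: "f a / 2 * indicator (ball a r) x \<le> f x" for x
    using r(2)[of x] assms(2,3) by (auto simp: indicator_def dist_real_def dist_commute abs_if split: if_splits)
  have "0 < f a / 2 * measure lborel (ball a r)"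
    using content_ball_pos[OF r(1), of a] assms(3) by simp
  also have "\<dots> = (LINT x|lborel. f a / 2 * indicator (ball a r) x)"
    by simp
  also have "\<dots> \<le> (LINT x|lborel. f x)"
    by (rule integral_mono[OF integrable_mult_right[OF integrable_real_indicator] Cc_integrable[OF assms(1)] le])
       (use emeasure_bounded_finite[OF bounded_ball, of a r] in auto)
  finally show ?thesis .
qed

lemma continuous_on_mult_support:
  fixes f g :: "'a::euclidean_space \<Rightarrow> real"
  assumes "open S" "continuous_on S f" "continuous_on UNIV g" "closed K" "K \<subseteq> S" "\<And>x. x \<notin> K \<Longrightarrow> g x = 0"
  shows "continuous_on UNIV (\<lambda>x. f x * g x)"
proof -
  have "continuous_on S (\<lambda>x. f x * g x)"
    using assms by (auto intro!: continuous_on_mult continuous_on_subset[OF assms(3)])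
  moreover have "continuous_on (- K) (\<lambda>x. f x * g x)"
    by (rule continuous_on_eq[of _ "\<lambda>x. 0"]) (use assms(6) in auto)
  ultimately have "continuous_on (S \<union> - K) (\<lambda>x. f x * g x)"
    using assms by (intro continuous_on_open_Un) auto
  moreover have "S \<union> - K = UNIV" using assms(5) by auto
  ultimately show ?thesis by simp
qed

text \<open>If \<open>f\<close> were negative at \<open>a\<close>, the truncated paraboloid (r^2 -
  |x - a|^2)_+ cubed, supported in a small ball where \<open>f < 0\<close>, would be a C^2 test
  function with negative pairing.\<close>

lemma fundamental_lemma_nonneg:
  fixes f :: "real^'n::finite \<Rightarrow> real"
  assumes S: "open S" and f: "continuous_on S f"
    and *: "\<And>\<phi> K. C2_on UNIV \<phi> \<Longrightarrow> (\<And>x. \<phi> x \<ge> 0) \<Longrightarrow> compact K \<Longrightarrow> K \<subseteq> S \<Longrightarrow>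
      (\<And>x. x \<notin> K \<Longrightarrow> \<phi> x = 0) \<Longrightarrow> (LINT x|lborel. f x * \<phi> x) \<ge> 0"
    and a: "a \<in> S"
  shows "f a \<ge> 0"
proof (rule ccontr)
  assume neg: "\<not> f a \<ge> 0"
  have "open {x\<in>S. f x < 0}"
    using continuous_open_preimage[OF f S, of "{..<0}"] by (auto simp: vimage_def Collect_conj_eq Int_commute)
  then obtain r where r: "r > 0" "cball a r \<subseteq> {x\<in>S. f x < 0}"
    using neg a open_contains_cball by (metis (no_types, lifting) mem_Collect_eq not_le)
  define \<phi> where "\<phi> x = (max 0 ((r\<^sup>2 - (norm (x - a))\<^sup>2) - 0)) ^ 3" for x
  have C2: "C2_on UNIV \<phi>"
    unfolding \<phi>_def by (intro C2_on_max_cube C2_on_diff C2_on_norm_sq open_UNIV C2_on_const)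
  have \<phi>0: "\<phi> x = 0" if "x \<notin> cball a r" for x
  proof -
    have "r\<^sup>2 \<le> (norm (x - a))\<^sup>2"
      using that r(1) by (intro power_mono) (auto simp: dist_norm norm_minus_commute)
    then show ?thesis by (simp add: \<phi>_def)
  qed
  have \<phi>_nonneg: "\<phi> x \<ge> 0" for x by (simp add: \<phi>_def)
  have sub: "cball a r \<subseteq> S" using r by auto
  have cont: "continuous_on UNIV (\<lambda>x. f x * \<phi> x)"
    by (rule continuous_on_mult_support[OF S f C2_on_continuous[OF C2] closed_cball sub \<phi>0])
  have "0 < (LINT x|lborel. - (f x * \<phi> x))"
  proof (rule Cc_integral_pos)
    show "Cc (\<lambda>x. - (f x * \<phi> x))"
      by (rule Cc_subset[OF _ bounded_cball[of a r]]) (use cont \<phi>0 in \<open>auto intro: continuous_on_minus\<close>)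
    show "0 \<le> - (f x * \<phi> x)" for x
    proof (cases "x \<in> cball a r")
      case True
      then have "f x \<le> 0" using r(2) by (auto intro: less_imp_le)
      then show ?thesis using \<phi>_nonneg[of x] by (simp add: mult_nonpos_nonneg)
    qed (simp add: \<phi>0)
    show "0 < - (f a * \<phi> a)"
      using neg r(1) by (simp add: \<phi>_def mult_neg_pos)
  qed
  moreover have "(LINT x|lborel. f x * \<phi> x) \<ge> 0"
    by (rule *[OF C2 \<phi>_nonneg compact_cball sub \<phi>0])
  ultimately show False by simp
qed

lemma fundamental_lemma_zero:
  fixes f :: "real^'n::finite \<Rightarrow> real"
  assumes S: "open S" and f: "continuous_on S f"
    and *: "\<And>\<phi> K. C2_on UNIV \<phi> \<Longrightarrow> compact K \<Longrightarrow> K \<subseteq> S \<Longrightarrow>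
      (\<And>x. x \<notin> K \<Longrightarrow> \<phi> x = 0) \<Longrightarrow> (LINT x|lborel. f x * \<phi> x) = 0"
    and a: "a \<in> S"
  shows "f a = 0"
proof -
  have "f a \<ge> 0"
    by (rule fundamental_lemma_nonneg[OF S f _ a]) (simp add: *)
  moreover have "- f a \<ge> 0"
    by (rule fundamental_lemma_nonneg[OF S _ _ a, of "\<lambda>x. - f x"]) (use * f in \<open>auto intro: continuous_on_minus\<close>)
  ultimately show ?thesis by simp
qed

text \<open>By translation invariance the integral of \<open>f (x - t)\<close> over \<open>t\<close>
  does not depend on \<open>x\<close>; differentiating under the integral sign at
  \<open>x = 0\<close> produces the integral of the partial derivative.\<close>

lemma integral_partial_zero:
  fixes f :: "real^'n::finite \<Rightarrow> real"
  assumes f: "C1_on UNIV f" and b: "bounded {x. f x \<noteq> 0}"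
  shows "(LINT x|lborel. partial i f x) = 0"
proof -
  obtain R where R: "R > 0" "\<And>x. f x \<noteq> 0 \<Longrightarrow> norm x \<le> R"
    using b unfolding bounded_pos by blast
  \<comment> \<open>The margin 1 makes a single box contain the supports of all translates by
    vectors of norm at most 1.\<close>
  obtain a where a: "cball (0::real^'n) (R + 1) \<subseteq> cbox (- a) a"
    using bounded_subset_cbox_symmetric[OF bounded_cball] .
  have cont: "continuous_on UNIV f" "continuous_on UNIV (partial i f)"
    using f C1_on_continuous by (auto simp: C1_on_def)
  have sub: "x - t \<in> cball 0 R \<Longrightarrow> norm x \<le> 1 \<Longrightarrow> t \<in> cbox (- a) a" for x t :: "real^'n"
    using norm_triangle_ineq4[of x "x - t"] a by (auto simp: subset_iff)
  have p0: "partial i f x = 0" if "x \<notin> cball 0 R" for x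
  proof -
    have "partial i f x = partial i (\<lambda>x. 0) x"
      by (rule partial_cong[of "- cball 0 R"]) (use that R(2) in \<open>auto simp: not_le[symmetric]\<close>)
    then show ?thesis by simp
  qed
  have Cc: "Cc (\<lambda>t. f (x - t))" "Cc (\<lambda>t. partial i f (x - t))" if "norm x \<le> 1" for x
    by (rule Cc_subset[OF _ bounded_cbox[of "-a" a]],
        use that sub R(2) p0 in \<open>auto intro!: continuous_on_compose2[OF cont(1)]  continuous_on_compose2[OF cont(2)] continuous_intros\<close>)+
  have [measurable]: "f \<in> borel_measurable borel" "partial i f \<in> borel_measurable borel"
    using cont by (auto intro: borel_measurable_continuous_onI)
  let ?I = "\<lambda>x. integral (cbox (- a) a) (\<lambda>t. 1 * f (x - t))"
  have I: "?I x = (LINT t|lborel. f t)" if "norm x \<le> 1" for x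
    using Cc_integral[OF Cc(1)[OF that], of "-a" a] sub[OF _ that] R(2)
      integral_reflect_translate[of f x] by (auto simp: subset_iff)
  have "(?I has_derivative
     (\<lambda>v. integral (cbox (- a) a) (\<lambda>t. 1 * frechet_derivative f (at (0 - t)) v))) (at 0)" (is "(_ has_derivative ?D) _")
    by (rule leibniz_convolution[OF _ f]) simp
  then have "((\<lambda>x. LINT t|lborel. f t) has_derivative ?D) (at 0)"
    by (rule has_derivative_transform_within_open[of _ _ _ _ "ball 0 1"]) (use I in \<open>auto simp: less_imp_le\<close>)
  then have D0: "?D = (\<lambda>v. 0)"
    using has_derivative_unique has_derivative_const by blast
  have "0 = integral (cbox (- a) a) (\<lambda>t. partial i f (0 - t))"
    using fun_cong[OF D0, of "axis i 1"] by (simp add: partial_def)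
  also have "\<dots> = (LINT t|lborel. partial i f (0 - t))"
  proof (rule Cc_integral[symmetric, OF Cc(2)], safe)
    fix t assume "partial i f (0 - t) \<noteq> 0"
    then have "0 - t \<in> cball 0 R" using p0 by blast
    then show "t \<in> cbox (- a) a" using sub[of 0 t] by simp
  qed simp
  also have "\<dots> = (LINT t|lborel. partial i f t)"
    by (rule integral_reflect_translate) simp
  finally show ?thesis by simp
qed

lemma Cc_partial:
  assumes "C1_on UNIV f" "bounded {x. f x \<noteq> 0}" shows "Cc (partial i f)"
  by (rule Cc_subset[OF _ bounded_closure[OF assms(2)] partial_outside_support])
     (use assms(1) in \<open>auto simp: C1_on_def\<close>)

lemma integral_by_parts_partial:
  fixes f g :: "real^'n::finite \<Rightarrow> real"
  assumes f: "C1_on UNIV f" and g: "C1_on UNIV g" and b: "bounded {x. f x \<noteq> 0}"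
  shows "(LINT x|lborel. f x * partial i g x) = - (LINT x|lborel. partial i f x * g x)"
proof -
  have 1: "Cc (\<lambda>x. f x * partial i g x)"
    by (rule Cc_mult) (use f g b C1_on_continuous in \<open>auto simp: Cc_def C1_on_def\<close>)
  have "Cc (partial i f)" by (rule Cc_partial[OF f b])
  then have 2: "Cc (\<lambda>x. partial i f x * g x)"
    using g C1_on_continuous by (blast intro: Cc_mult)
  have "0 = (LINT x|lborel. partial i (\<lambda>x. f x * g x) x)"
    by (rule integral_partial_zero[symmetric, OF C1_on_mult[OF f g]]) (rule bounded_subset[OF b], auto)
  also have "\<dots> = (LINT x|lborel. f x * partial i g x + partial i f x * g x)"
    using f g by (simp add: partial_mult C1_on_def)
  also have "\<dots> = (LINT x|lborel. f x * partial i g x) + (LINT x|lborel. partial i f x * g x)"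
    by (rule Bochner_Integration.integral_add[OF Cc_integrable[OF 1] Cc_integrable[OF 2]])
  finally show ?thesis by simp
qed

section \<open>Mollification\<close>

definition moll :: "real \<Rightarrow> (real^'n::finite \<Rightarrow> real) \<Rightarrow> real^'n \<Rightarrow> real" where
  "moll e f x = 1 / (LINT t|lborel. bump e (t::real^'n)) * conv (bump e) f x"

lemma continuous_on_bump: "continuous_on UNIV (bump e)"
  using smooth_on_bump[of e] unfolding smooth_on_def by (metis Ck_on.simps(1))

lemma Cc_bump:
  assumes "e > 0" shows "Cc (bump e :: real^'n::finite \<Rightarrow> real)"
  by (rule Cc_subset[OF continuous_on_bump bounded_ball[of 0 e]]) (simp add: bump_eq_0[OF assms] not_less)

lemma integral_bump_pos: "e > 0 \<Longrightarrow> (LINT t|lborel. bump e (t::real^'n::finite)) > 0"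
  by (rule Cc_integral_pos[OF Cc_bump bump_nonneg, of _ 0]) (auto simp: bump_pos_iff)

text \<open>One estimate with three uses: \<open>c = f x\<close> gives pointwise convergence,
  \<open>c = 0\<close> the sup bound, and \<open>c = 0\<close> with \<open>B = 0\<close> the control
  of the support.\<close>

lemma moll_diff_le:
  fixes f :: "real^'n::finite \<Rightarrow> real"
  assumes e: "e > 0" and f: "continuous_on UNIV f"
    and le: "\<And>t. norm t < e \<Longrightarrow> \<bar>f (x - t) - c\<bar> \<le> B"
  shows "\<bar>moll e f x - c\<bar> \<le> B"
proof -
  let ?I = "LINT t|lborel. bump e (t::real^'n)"
  note [continuous_intros] = continuous_on_compose2[OF f]
  have Cc1: "Cc (\<lambda>t. bump e t * (f (x - t) - c))" "Cc (\<lambda>t. bump e t * f (x - t))"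
    "Cc (\<lambda>t::real^'n. bump e t * c)" "Cc (\<lambda>t::real^'n. bump e t * B)"
    by (rule Cc_mult[OF Cc_bump[OF e]]; auto intro!: continuous_intros)+
  have "conv (bump e) f x - ?I * c = (LINT t|lborel. bump e t * f (x - t)) - (LINT t|lborel. bump e (t::real^'n) * c)"
    by (simp add: conv_def)
  also have "\<dots> = (LINT t|lborel. bump e t * (f (x - t) - c))"
    by (simp add: right_diff_distrib Bochner_Integration.integral_diff[OF Cc_integrable Cc_integrable, OF Cc1(2,3)])
  finally have "\<bar>conv (bump e) f x - ?I * c\<bar> \<le> (LINT t|lborel. \<bar>bump e t * (f (x - t) - c)\<bar>)"
    by (simp add: integral_abs_bound)
  also have "\<dots> \<le> (LINT t|lborel. bump e (t::real^'n) * B)"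
  proof (rule integral_mono)
    show "\<bar>bump e t * (f (x - t) - c)\<bar> \<le> bump e t * B" for t
      using le[of t] bump_nonneg[of e t] bump_eq_0[OF e, of t]
      by (cases "norm t < e") (auto simp: abs_mult intro!: mult_left_mono)
  qed (use Cc_integrable[OF Cc1(1)] Cc_integrable[OF Cc1(4)] in auto)
  also have "\<dots> = ?I * B" by simp
  finally have "\<bar>conv (bump e) f x - ?I * c\<bar> \<le> ?I * B" .
  moreover have "?I > 0" by (rule integral_bump_pos[OF e])
  moreover have "moll e f x - c = (conv (bump e) f x - ?I * c) / ?I"
    using \<open>?I > 0\<close> by (simp add: moll_def field_simps)
  ultimately show ?thesis by (simp add: abs_divide divide_le_eq mult.commute)
qed

lemma moll_tendsto:
  fixes f :: "real^'n::finite \<Rightarrow> real"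
  assumes f: "continuous_on UNIV f"
  shows "(\<lambda>n. moll (1 / Suc n) f x) \<longlonglongrightarrow> f x"
proof (rule LIMSEQ_I)
  fix r :: real assume r: "r > 0"
  have "isCont f x" using f by (simp add: continuous_on_eq_continuous_at)
  then obtain d where d: "d > 0" "\<And>y. dist y x < d \<Longrightarrow> dist (f y) (f x) < r / 2"
    using r unfolding continuous_at_eps_delta by (metis half_gt_zero)
  obtain N where N: "1 / Suc N < d" using d(1) by (metis nat_approx_posE)
  show "\<exists>N. \<forall>n\<ge>N. norm (moll (1 / Suc n) f x - f x) < r"
  proof (intro exI allI impI)
    fix n assume "n \<ge> N"
    then have "1 / Suc n \<le> 1 / Suc N" by (intro divide_left_mono) auto
    then have n: "1 / Suc n < d" using N by linarith
    have "\<bar>moll (1 / Suc n) f x - f x\<bar> \<le> r / 2"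
    proof (rule moll_diff_le[OF _ f])
      fix t :: "real^'n" assume "norm t < 1 / Suc n"
      then have "dist (x - t) x < d" using n by (simp add: dist_norm)
      then show "\<bar>f (x - t) - f x\<bar> \<le> r / 2" using d(2) by (fastforce simp: dist_real_def)
    qed simp
    then show "norm (moll (1 / Suc n) f x - f x) < r" using r by simp
  qed
qed

lemma moll_bound:
  assumes "e > 0" "continuous_on UNIV f" "\<And>x. \<bar>f x\<bar> \<le> B"
  shows "\<bar>moll e f x\<bar> \<le> B"
  using moll_diff_le[OF assms(1,2), of x 0 B] assms(3) by simp

lemma moll_support:
  fixes f :: "real^'n::finite \<Rightarrow> real"
  assumes "e > 0" "continuous_on UNIV f" "\<And>x. norm x > R \<Longrightarrow> f x = 0" "norm x > R + e"
  shows "moll e f x = 0"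
proof -
  have "\<bar>moll e f x - 0\<bar> \<le> 0"
  proof (rule moll_diff_le[OF assms(1,2)])
    fix t :: "real^'n" assume "norm t < e"
    then have "norm (x - t) > R" using assms(4) norm_triangle_ineq2[of x t] by linarith
    then show "\<bar>f (x - t) - 0\<bar> \<le> 0" using assms(3) by simp
  qed
  then show ?thesis by simp
qed

lemma partial_moll:
  assumes "e > 0" "C1_on UNIV f" shows "partial i (moll e f) = moll e (partial i f)"
proof
  fix x
  show "partial i (moll e f) x = moll e (partial i f) x"
    unfolding moll_def[abs_def] partial_conv[OF Cc_bump[OF assms(1)] assms(2), symmetric]
    by (rule partial_cmult[OF C1_onD(1)[OF C1_on_conv[OF Cc_bump[OF assms(1)] assms(2)]]]) simp
qed

lemma C2_on_moll:
  assumes "e > 0" "C2_on UNIV f" shows "C2_on UNIV (moll e f)"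
  unfolding moll_def[abs_def]
  by (intro C2_on_mult C2_on_conv Cc_bump assms open_UNIV C2_on_const)

text \<open>Here the derivatives fall on the bump, by commutativity of the convolution, so that
  continuity of \<open>f\<close> is enough for smoothness; in \<open>partial_moll\<close> they fall
  on \<open>f\<close>.\<close>

lemma test_fun_moll:
  fixes f :: "real^'n::finite \<Rightarrow> real"
  assumes e: "e > 0" and f: "continuous_on UNIV f" and R: "\<And>x. norm x > R \<Longrightarrow> f x = 0"
  shows "test_fun UNIV (moll e f)"
proof -
  have "Cc f" by (rule Cc_subset[OF f bounded_cball[of 0 R]]) (use R in auto)
  then have "Ck_on k UNIV (conv f (bump e))" for k
    using Ck_on_conv smooth_on_bump unfolding smooth_on_def by blast
  then have "smooth_on UNIV (moll e f)"
    unfolding smooth_on_def moll_def[abs_def] conv_commute[OF continuous_on_bump f]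
    by (intro allI Ck_on_mult Ck_on_const)
  moreover have "{x. moll e f x \<noteq> 0} \<subseteq> cball 0 (R + e)"
  proof safe
    fix x assume "moll e f x \<noteq> 0"
    then have "\<not> norm x > R + e"
      using moll_support[OF e f, of R x] R by blast
    then show "x \<in> cball 0 (R + e)" by simp
  qed
  then have "compact (closure {x. moll e f x \<noteq> 0})"
    using bounded_cball bounded_subset compact_closure by blast
  ultimately show ?thesis by (simp add: test_fun_def)
qed

section \<open>The operator and its fundamental solution\<close>

lemma Ck_on_cong:
  assumes "open S" "\<And>x. x \<in> S \<Longrightarrow> f x = g x" "Ck_on k S f"
  shows "Ck_on k S g"
  using assms(2,3)
proof (induction k arbitrary: f g)
  case 0
  then show ?case using continuous_on_eq by (metis Ck_on.simps(1))
next
  case (Suc k)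
  have D: "(g has_derivative frechet_derivative f (at x)) (at x)" if "x \<in> S" for x
  proof -
    have "(f has_derivative frechet_derivative f (at x)) (at x)"
      using Suc.prems that by (simp add: frechet_derivative_works[symmetric])
    from has_derivative_transform_within_open[OF this assms(1) that] show ?thesis
      using Suc.prems(1) by auto
  qed
  have "Ck_on k S (\<lambda>x. frechet_derivative g (at x) v)" for v
  proof (rule Suc.IH)
    show "Ck_on k S (\<lambda>x. frechet_derivative f (at x) v)" using Suc.prems by simp
    show "frechet_derivative f (at x) v = frechet_derivative g (at x) v" if "x \<in> S" for x
      using frechet_derivative_at[OF D[OF that]] by simp
  qed
  then show ?case using D by (auto simp: differentiable_def)
qed

text \<open>\<Gamma> is smooth jointly in both variables off the diagonal, whereas the operator acts
  on one variable with the other one frozen.\<close>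

lemma Ck_on_slice:
  assumes "open S" "Ck_on k S f"
  shows "Ck_on k {y. (x, y) \<in> S} (\<lambda>y. f (x, y))"
  using assms(2)
proof (induction k arbitrary: f)
  case 0
  then show ?case
    by (auto intro!: continuous_on_compose2[of S f] continuous_intros)
next
  case (Suc k)
  have op: "open {y. (x, y) \<in> S}"
    using open_vimage[OF assms(1), of "Pair x"] by (simp add: vimage_def continuous_on_Pair)
  have D: "((\<lambda>y. f (x, y)) has_derivative (\<lambda>v. frechet_derivative f (at (x, y)) (0, v))) (at y)"
    if "(x, y) \<in> S" for y
  proof -
    have "(f has_derivative frechet_derivative f (at (x, y))) (at (x, y))"
      using Suc.prems that by (simp add: frechet_derivative_works[symmetric])
    then show ?thesis
      by (rule has_derivative_compose[of "Pair x" "\<lambda>v. (0, v)", rotated]) (auto intro!: derivative_eq_intros)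
  qed
  have "Ck_on k {y. (x, y) \<in> S} (\<lambda>y. frechet_derivative (\<lambda>y. f (x, y)) (at y) v)" for v
  proof (rule Ck_on_cong[OF op])
    show "Ck_on k {y. (x, y) \<in> S} (\<lambda>y. frechet_derivative f (at (x, y)) (0, v))"
      using Suc.IH[of "\<lambda>z. frechet_derivative f (at z) (0, v)"] Suc.prems by simp
    show "frechet_derivative f (at (x, y)) (0, v) = frechet_derivative (\<lambda>y. f (x, y)) (at y) v"
      if "y \<in> {y. (x, y) \<in> S}" for y
      using frechet_derivative_at[OF D] that by (metis mem_Collect_eq)
  qed
  then show ?case using D by (auto simp: differentiable_def)
qed

section \<open>The operator in divergence form\<close>

locale degenerate_operator =
  fixes V :: "real^'n::finite \<Rightarrow> real" and A :: "real^'n \<Rightarrow> real^'n^'n"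
  assumes coeffs: "smooth_coefficients V A" and ell: "degenerate_elliptic A"
begin

definition c :: "'n \<Rightarrow> 'n \<Rightarrow> real^'n \<Rightarrow> real" where
  "c i j x = V x * A x $ i $ j"

definition flux :: "'n \<Rightarrow> (real^'n \<Rightarrow> real) \<Rightarrow> real^'n \<Rightarrow> real" where
  "flux i u x = (\<Sum>j\<in>UNIV. c i j x * partial j u x)"

text \<open>This is V times the operator. In this form it is symmetric for Lebesgue measure
  (\<open>green\<close>), without a weight in the integrals.\<close>

definition M :: "(real^'n \<Rightarrow> real) \<Rightarrow> real^'n \<Rightarrow> real" where
  "M u x = (\<Sum>i\<in>UNIV. partial i (flux i u) x)"

text \<open>V times the quadratic form of A on the gradient: the carre du champ, which is the second
  order term of the chain rule \<open>M_compose\<close>.\<close>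

definition Q :: "(real^'n \<Rightarrow> real) \<Rightarrow> real^'n \<Rightarrow> real" where
  "Q u x = (\<Sum>i\<in>UNIV. \<Sum>j\<in>UNIV. c i j x * (partial i u x * partial j u x))"

lemma V_pos: "V x > 0"
  using coeffs by (simp add: smooth_coefficients_def)

lemma C2_V: "C2_on UNIV V"
  using coeffs by (auto simp: smooth_coefficients_def smooth_on_def intro: C2_on_Ck)

lemma C2_on_inverse_V: "C2_on UNIV (\<lambda>x. 1 / V x)"
proof -
  have "C2_on UNIV (\<lambda>x. inverse (V x))"
  proof (rule C2_on_compose[OF open_UNIV C2_V, where F'="\<lambda>t. - (inverse t ^ 2)" and F''="\<lambda>t. 2 * inverse t ^ 3"])
    fix x
    have V: "V x \<noteq> 0" using V_pos[of x] by simp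
    show "(inverse has_real_derivative - (inverse (V x) ^ 2)) (at (V x))"
      using V by (auto intro!: derivative_eq_intros simp: power2_eq_square)
    show "((\<lambda>t. - (inverse t ^ 2)) has_real_derivative 2 * inverse (V x) ^ 3) (at (V x))"
      using V by (auto intro!: derivative_eq_intros simp: power2_eq_square power3_eq_cube)
  next
    have "V x \<noteq> 0" for x using V_pos[of x] by simp
    then show "continuous_on UNIV (\<lambda>x. 2 * inverse (V x) ^ 3)"
      using C2_on_continuous[OF C2_V] by (intro continuous_intros) auto
  qed
  then show ?thesis by (simp add: inverse_eq_divide)
qed

lemma C1_c: "C1_on UNIV (c i j)"
proof -
  have "C2_on UNIV (\<lambda>x. V x * A x $ i $ j)"
    using coeffs by (intro C2_on_mult) (auto simp: smooth_coefficients_def smooth_on_def intro: C2_on_Ck)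
  then show ?thesis using C2_on_C1 by (simp add: c_def[abs_def])
qed

lemma continuous_c: "continuous_on S (c i j)" "continuous_on S (partial k (c i j))"
  using C1_c[of i j] C1_on_continuous[OF C1_c[of i j]] continuous_on_subset[OF _ subset_UNIV]
  by (auto simp: C1_on_def)

lemma c_sym: "c i j x = c j i x"
proof -
  have "transpose (A x) = A x" using ell by (simp add: degenerate_elliptic_def)
  then have "A x $ i $ j = A x $ j $ i" by (metis transpose_def vec_lambda_beta)
  then show ?thesis by (simp add: c_def)
qed

lemma Q_nonneg: "Q u x \<ge> 0"
proof -
  define g where "g = (\<chi> i. partial i u x)"
  have "Q u x = V x * (g \<bullet> (A x *v g))"
    by (simp add: Q_def c_def g_def inner_vec_def matrix_vector_mult_def sum_distrib_left mult_ac)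
  moreover have "g \<bullet> (A x *v g) \<ge> 0" using ell by (simp add: degenerate_elliptic_def)
  ultimately show ?thesis using V_pos[of x] by simp
qed

lemma Lop_M: "V x * Lop V A u x = M u x"
  using V_pos[of x] by (simp add: Lop_def M_def flux_def[abs_def] c_def)

lemma Lop_eq_M: "Lop V A u x = M u x / V x"
  using V_pos[of x] Lop_M[of x u] by (simp add: field_simps)

lemma C1_flux: "C2_on S u \<Longrightarrow> C1_on S (flux i u)"
  unfolding flux_def[abs_def]
  by (intro C1_on_sum C1_on_mult C1_on_subset[OF C1_c]) (auto simp: C2_on_def)

lemma M_expand:
  assumes "C2_on S u" "x \<in> S"
  shows "M u x = (\<Sum>i\<in>UNIV. \<Sum>j\<in>UNIV. c i j x * partial i (partial j u) x + partial i (c i j) x * partial j u x)"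
proof -
  have d: "c i j differentiable at x" "partial j u differentiable at x" for i j
    using assms C1_c by (auto simp: C2_on_def C1_on_def)
  show ?thesis
    unfolding M_def flux_def[abs_def]
    by (simp add: partial_sum partial_mult d differentiable_mult)
qed

lemma continuous_on_M:
  assumes "C2_on S u" shows "continuous_on S (M u)"
  unfolding M_def[abs_def] using C1_flux[OF assms] by (intro continuous_on_sum) (auto simp: C1_on_def)

lemma M_cong:
  assumes "open S" "x \<in> S" "\<And>y. y \<in> S \<Longrightarrow> f y = g y"
  shows "M f x = M g x"
proof -
  have "flux i f y = flux i g y" if "y \<in> S" for i y
    using partial_cong[OF assms(1) that assms(3)] by (simp add: flux_def)
  from partial_cong[OF assms(1,2) this] show ?thesis by (simp add: M_def)
qed

lemma M_const: "M (\<lambda>x. k) x = 0"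
  by (simp add: M_def flux_def[abs_def])

lemma M_zero: "open S \<Longrightarrow> x \<in> S \<Longrightarrow> (\<And>y. y \<in> S \<Longrightarrow> f y = k) \<Longrightarrow> M f x = 0"
  using M_cong[of S x f "\<lambda>_. k"] M_const by simp

lemma M_diff:
  assumes "open S" "C2_on S f" "C2_on S g" "x \<in> S"
  shows "M (\<lambda>y. f y - g y) x = M f x - M g x"
proof -
  have d: "f differentiable at y" "g differentiable at y" if "y \<in> S" for y
    using assms that by (auto simp: C2_on_def)
  have "flux i (\<lambda>y. f y - g y) y = flux i f y - flux i g y" if "y \<in> S" for i y
    by (simp add: flux_def partial_diff d[OF that] right_diff_distrib sum_subtractf)
  note partial_cong[OF assms(1,4) this]
  moreover have "partial i (\<lambda>y. flux i f y - flux i g y) x = partial i (flux i f) x - partial i (flux i g) x" for i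
    using C1_flux assms by (intro partial_diff) (auto simp: C1_on_def)
  ultimately show ?thesis by (simp add: M_def sum_subtractf)
qed

lemma M_compose:
  assumes S: "open S" and u: "C2_on S u" and x: "x \<in> S"
    and F: "\<And>t. (F has_real_derivative F' t) (at t)" "\<And>t. (F' has_real_derivative F'' t) (at t)"
    and cF: "continuous_on UNIV F''"
  shows "M (\<lambda>y. F (u y)) x = F' (u x) * M u x + F'' (u x) * Q u x"
proof -
  have du: "u differentiable at y" "partial j u differentiable at y" if "y \<in> S" for y j
    using u that by (auto simp: C2_on_def C1_on_def)
  have C2: "C2_on S (\<lambda>y. F (u y))"
    by (rule C2_on_compose[OF S u F]) (rule continuous_on_compose2[OF cF C2_on_continuous[OF u]], simp)
  have p: "partial j (\<lambda>y. F (u y)) y = F' (u y) * partial j u y" if "y \<in> S" for j y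
    by (rule partial_compose[OF du(1)[OF that] F(1)])
  have "partial i (partial j (\<lambda>y. F (u y))) x =
      F' (u x) * partial i (partial j u) x + F'' (u x) * partial i u x * partial j u x" for i j
  proof -
    have "partial i (partial j (\<lambda>y. F (u y))) x = partial i (\<lambda>y. F' (u y) * partial j u y) x"
      by (rule partial_cong[OF S x p])
    also have "\<dots> = F' (u x) * partial i (partial j u) x + partial i (\<lambda>y. F' (u y)) x * partial j u x"
      by (rule partial_mult[OF differentiable_compose_real[OF du(1)[OF x] F(2)] du(2)[OF x]])
    also have "partial i (\<lambda>y. F' (u y)) x = F'' (u x) * partial i u x"
      by (rule partial_compose[OF du(1)[OF x] F(2)])
    finally show ?thesis .
  qed
  then show ?thesis
    unfolding M_expand[OF C2 x] M_expand[OF u x] p[OF x] Q_def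
    by (simp add: sum_distrib_left sum.distrib[symmetric] algebra_simps)
qed

text \<open>Where \<open>u\<close> does not exceed \<open>d\<close>, the factor (u - d)_+^2 removes
  \<open>M u\<close> from the chain rule, so its sign matters only on the set \<open>u > d\<close>.
  The other term is nonnegative by convexity of the cube and by \<open>Q_nonneg\<close>.\<close>

lemma M_compose_nonneg:
  assumes "open S" "C2_on S u" "x \<in> S" "u x > d \<Longrightarrow> M u x \<ge> 0"
  shows "M (\<lambda>y. (max 0 (u y - d)) ^ 3) x \<ge> 0"
proof -
  have "M (\<lambda>y. (max 0 (u y - d)) ^ 3) x = 3 * (max 0 (u x - d))\<^sup>2 * M u x + 6 * max 0 (u x - d) * Q u x"
    by (rule M_compose[OF assms(1-3) DERIV_shift_max_cube]) (auto intro!: continuous_intros)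
  moreover have "3 * (max 0 (u x - d))\<^sup>2 * M u x \<ge> 0"
    using assms(4) by (cases "u x > d") auto
  ultimately show ?thesis using Q_nonneg[of u x] by simp
qed

lemma Cc_flux:
  assumes "C2_on UNIV f" "bounded {x. f x \<noteq> 0}" shows "Cc (flux i f)"
proof (rule Cc_subset[OF _ bounded_closure[OF assms(2)]])
  show "continuous_on UNIV (flux i f)" using C1_flux[OF assms(1)] C1_on_continuous by blast
  show "flux i f x = 0" if "x \<notin> closure {x. f x \<noteq> 0}" for x
    using partial_outside_support[OF that] by (simp add: flux_def)
qed

lemma Cc_M:
  assumes "C2_on UNIV f" "bounded {x. f x \<noteq> 0}" shows "Cc (M f)"
proof (rule Cc_subset[OF continuous_on_M[OF assms(1)] bounded_closure[OF assms(2)]])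
  show "M f x = 0" if "x \<notin> closure {x. f x \<noteq> 0}" for x
    by (rule M_zero[of "- closure {x. f x \<noteq> 0}"]) (use that closure_subset[of "{x. f x \<noteq> 0}"] in auto)
qed

text \<open>Two integrations by parts with the symmetry of \<open>c\<close> in between. Each product
  contains \<open>f\<close> or one of its derivatives, so bounded support of \<open>f\<close> makes
  all integrals finite.\<close>

lemma green:
  assumes f: "C2_on UNIV f" and g: "C2_on UNIV g" and b: "bounded {x. f x \<noteq> 0}"
  shows "(LINT x|lborel. f x * M g x) = (LINT x|lborel. M f x * g x)"
proof -
  have fl: "C1_on UNIV (flux i f)" "C1_on UNIV (flux i g)" for i
    using C1_flux f g by auto
  have Cf: "Cc f" using C2_on_continuous[OF f] b by (simp add: Cc_def)
  have Cfl: "Cc (flux i f)" for i by (rule Cc_flux[OF f b])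
  have Cp: "Cc (partial i f)" for i by (rule Cc_partial[OF C2_on_C1[OF f] b])
  have Cpfl: "Cc (partial i (flux i f))" for i
    using Cc_partial[OF fl(1)] Cfl by (simp add: Cc_def)
  have cont: "continuous_on UNIV g" "continuous_on UNIV (partial i g)"
      "continuous_on UNIV (flux i g)" "continuous_on UNIV (partial i (flux i g))" for i
    using C2_on_continuous[OF g] C2_on_C1[OF g] fl(2)[of i] C1_on_continuous[OF fl(2)] by (auto simp: C1_on_def)
  have "(LINT x|lborel. f x * M g x) = (\<Sum>i\<in>UNIV. LINT x|lborel. f x * partial i (flux i g) x)"
    unfolding M_def sum_distrib_left
    by (rule Bochner_Integration.integral_sum) (intro Cc_integrable Cc_mult Cf cont)
  also have "\<dots> = (\<Sum>i\<in>UNIV. - (LINT x|lborel. partial i f x * flux i g x))"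
    by (intro sum.cong refl integral_by_parts_partial C2_on_C1[OF f] fl b)
  also have "\<dots> = - (LINT x|lborel. (\<Sum>i\<in>UNIV. partial i f x * flux i g x))"
    by (subst Bochner_Integration.integral_sum)
       (auto simp: sum_negf intro!: Cc_integrable Cc_mult Cp cont)
  also have "(\<lambda>x. \<Sum>i\<in>UNIV. partial i f x * flux i g x) = (\<lambda>x. \<Sum>i\<in>UNIV. flux i f x * partial i g x)"
  proof
    fix x
    have "(\<Sum>i\<in>UNIV. partial i f x * flux i g x) = (\<Sum>i\<in>UNIV. \<Sum>j\<in>UNIV. c i j x * partial i f x * partial j g x)"
      by (simp add: flux_def sum_distrib_left mult_ac)
    also have "\<dots> = (\<Sum>j\<in>UNIV. \<Sum>i\<in>UNIV. c j i x * partial i f x * partial j g x)"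
      by (subst sum.swap) (simp add: c_sym)
    also have "\<dots> = (\<Sum>i\<in>UNIV. flux i f x * partial i g x)"
      by (simp add: flux_def sum_distrib_right)
    finally show "(\<Sum>i\<in>UNIV. partial i f x * flux i g x) = (\<Sum>i\<in>UNIV. flux i f x * partial i g x)" .
  qed
  also have "- (LINT x|lborel. (\<Sum>i\<in>UNIV. flux i f x * partial i g x)) =
      (\<Sum>i\<in>UNIV. - (LINT x|lborel. flux i f x * partial i g x))"
    by (subst Bochner_Integration.integral_sum)
       (auto simp: sum_negf intro!: Cc_integrable Cc_mult Cfl cont)
  also have "\<dots> = (\<Sum>i\<in>UNIV. LINT x|lborel. partial i (flux i f) x * g x)"
    using Cfl by (simp add: integral_by_parts_partial[OF fl(1) C2_on_C1[OF g]] Cc_def)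
  also have "\<dots> = (LINT x|lborel. M f x * g x)"
    unfolding M_def sum_distrib_right
    by (rule Bochner_Integration.integral_sum[symmetric]) (intro Cc_integrable Cc_mult Cpfl cont)
  finally show ?thesis .
qed

lemma M_moll:
  assumes "e > 0" "C2_on UNIV f"
  shows "M (moll e f) x = (\<Sum>i\<in>UNIV. \<Sum>j\<in>UNIV. c i j x * moll e (partial i (partial j f)) x
      + partial i (c i j) x * moll e (partial j f) x)"
  unfolding M_expand[OF C2_on_moll[OF assms] UNIV_I]
  by (simp add: partial_moll[OF assms(1)] assms C2_on_C1 C2_onD(2))

end

section \<open>The fundamental solution as an integral kernel\<close>

locale degenerate_operator_fs = degenerate_operator V A
  for V :: "real^'n::finite \<Rightarrow> real" and A :: "real^'n \<Rightarrow> real^'n^'n" +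
  fixes \<Gamma> :: "real^'n \<Rightarrow> real^'n \<Rightarrow> real"
  assumes fs: "fundamental_solution V A \<Gamma>"
begin

text \<open>With the value 0 on the diagonal the kernel is symmetric, nonnegative and the reciprocal
  of \<open>gam\<close> everywhere, because \<open>1 / 0 = 0\<close>. The changed point is a null
  set for the integrals, and it recurs as an exception in pointwise bounds.\<close>

definition G :: "real^'n \<Rightarrow> real^'n \<Rightarrow> real" where
  "G x y = (if x = y then 0 else \<Gamma> x y)"

lemma G_self [simp]: "G x x = 0" by (simp add: G_def)

lemma G_sym: "G x y = G y x"
  using fs by (auto simp: G_def fundamental_solution_def)

lemma G_pos: "x \<noteq> y \<Longrightarrow> G x y > 0"
  using fs by (simp add: G_def fundamental_solution_def)

lemma G_nonneg: "G x y \<ge> 0"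
  using G_pos[of x y] by (cases "x = y") auto

lemma gam_G: "gam \<Gamma> x y = 1 / G x y"
  by (simp add: gam_def G_def)

lemma C2_G: "C2_on (- {x}) (G x)"
proof -
  have op: "open {z :: (real^'n) \<times> (real^'n). fst z \<noteq> snd z}"
    by (intro open_Collect_neq continuous_intros)
  then have "Ck_on 2 {y. (x, y) \<in> {(x, y). x \<noteq> y}} (\<lambda>y. (\<lambda>(x, y). \<Gamma> x y) (x, y))"
    using fs by (intro Ck_on_slice) (auto simp: fundamental_solution_def smooth_on_def case_prod_beta')
  moreover have "{y. (x, y) \<in> {(x, y). x \<noteq> y}} = - {x}" by auto
  ultimately have "C2_on (- {x}) (\<Gamma> x)" by (simp add: C2_on_Ck)
  then show ?thesis by (rule C2_on_cong[rotated 2]) (auto simp: G_def)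
qed

lemma continuous_on_G: "continuous_on (- {x}) (G x)"
  using C2_G C2_on_continuous by blast

text \<open>Joint measurability is what the exchange of integrals in \<open>potential_Fubini\<close>
  requires.\<close>

lemma measurable_G2: "(\<lambda>(x, y). G x y) \<in> borel_measurable (lborel \<Otimes>\<^sub>M lborel)"
proof -
  let ?D = "{z :: (real^'n) \<times> (real^'n). fst z \<noteq> snd z}"
  have op: "open ?D" by (intro open_Collect_neq continuous_intros)
  have "continuous_on ?D (\<lambda>(x, y). \<Gamma> x y)"
    using fs Ck_on.simps(1) by (auto simp: fundamental_solution_def smooth_on_def case_prod_beta' dest!: spec[of _ 0])
  then have "(\<lambda>z. indicator ?D z *\<^sub>R (\<lambda>(x, y). \<Gamma> x y) z) \<in> borel_measurable borel"
    using op by (intro borel_measurable_continuous_on_indicator) auto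
  also have "(\<lambda>z. indicator ?D z *\<^sub>R (\<lambda>(x, y). \<Gamma> x y) z) = (\<lambda>(x, y). G x y)"
    by (auto simp: G_def indicator_def)
  finally show ?thesis by (simp add: lborel_prod)
qed

lemma measurable_G [measurable]: "G x \<in> borel_measurable borel"
  using measurable_compose[OF measurable_Pair1' measurable_G2, of x] by simp

lemma measurable_\<Gamma>: "\<Gamma> x \<in> borel_measurable borel"
proof -
  have "(\<lambda>y. if y = x then \<Gamma> x x else G x y) \<in> borel_measurable borel" by measurable
  also have "(\<lambda>y. if y = x then \<Gamma> x x else G x y) = \<Gamma> x" by (auto simp: G_def)
  finally show ?thesis .
qed

lemma G_tendsto_0: "(G x \<longlongrightarrow> 0) at_infinity"
proof -
  have "eventually (\<lambda>y. \<Gamma> x y = G x y) at_infinity"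
    unfolding eventually_at_infinity by (rule exI[of _ "norm x + 1"]) (auto simp: G_def)
  then show ?thesis
    using fs tendsto_cong[of "\<Gamma> x" "G x" at_infinity 0] by (auto simp: fundamental_solution_def)
qed

lemma G_at_top: "filterlim (G x) at_top (at x)"
proof -
  have "eventually (\<lambda>y. \<Gamma> x y = G x y) (at x)"
    by (auto simp: G_def eventually_at_filter)
  then show ?thesis
    using fs filterlim_cong[OF refl refl, of "\<Gamma> x" "G x" "at x" at_top] unfolding fundamental_solution_def by blast
qed

lemma AE_G: "AE y in lborel. \<Gamma> x y = G x y"
  using AE_lborel_singleton[of x] by eventually_elim (auto simp: G_def)

lemma integrable_G_compact:
  assumes "compact K" shows "integrable lborel (\<lambda>y. indicator K y * G x y)"
proof -
  have "integrable lebesgue (\<lambda>y. indicator K y *\<^sub>R \<Gamma> x y)"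
    using fs assms by (auto simp: fundamental_solution_def set_integrable_def)
  moreover have K: "K \<in> sets borel" using assms by (simp add: borel_compact)
  have m: "(\<lambda>y. indicator K y *\<^sub>R \<Gamma> x y) \<in> borel_measurable lborel"
    using K measurable_\<Gamma>[of x] by measurable
  ultimately have "integrable lborel (\<lambda>y. indicator K y *\<^sub>R \<Gamma> x y)"
    using integrable_completion[OF m] by simp
  then show ?thesis
    by (rule integrable_cong_AE_imp) (use K AE_G[of x] in auto)
qed

lemma integrable_G_Cc:
  assumes "Cc f" shows "integrable lborel (\<lambda>y. G x y * f y)"
proof -
  obtain a where a: "{x. f x \<noteq> 0} \<subseteq> cbox (- a) a" using Cc_cbox[OF assms] .
  obtain B where B: "\<And>x. \<bar>f x\<bar> \<le> B" using Cc_bounded[OF assms] by blast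
  note Cc_measurable[OF assms, measurable]
  have "integrable lborel (\<lambda>y. B * (indicator (cbox (- a) a) y * G x y))"
    by (intro integrable_mult_right integrable_G_compact compact_cbox)
  then show ?thesis
  proof (rule Bochner_Integration.integrable_bound)
    show "AE y in lborel. norm (G x y * f y) \<le> norm (B * (indicator (cbox (- a) a) y * G x y))"
    proof (rule AE_I2)
      fix y
      show "norm (G x y * f y) \<le> norm (B * (indicator (cbox (- a) a) y * G x y))"
        using a B[of y] G_nonneg[of x y]
        by (cases "f y = 0") (auto simp: abs_mult mult.commute indicator_def intro!: mult_mono)
    qed
  qed measurable
qed

lemma fs_test:
  assumes "test_fun UNIV \<phi>"
  shows "(LINT y|lborel. G x y * M \<phi> y) = - \<phi> x"
proof -
  have C2: "C2_on UNIV \<phi>"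
    using assms by (auto simp: test_fun_def smooth_on_def intro: C2_on_Ck)
  have [measurable]: "M \<phi> \<in> borel_measurable borel"
    using continuous_on_M[OF C2] by (rule borel_measurable_continuous_onI)
  note measurable_\<Gamma>[of x, measurable]
  have "- \<phi> x = (LINT y|lebesgue. \<Gamma> x y * Lop V A \<phi> y * V y)"
    using fs assms by (simp add: fundamental_solution_def)
  also have "\<dots> = (LINT y|lebesgue. \<Gamma> x y * M \<phi> y)"
    by (simp add: Lop_M[symmetric] mult_ac)
  also have "\<dots> = (LINT y|lborel. \<Gamma> x y * M \<phi> y)"
    by (rule integral_completion) measurable
  also have "\<dots> = (LINT y|lborel. G x y * M \<phi> y)"
    by (rule integral_cong_AE) (measurable, use AE_G[of x] in auto)
  finally show ?thesis by simp
qed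

text \<open>Mollify \<phi>, use the identity for the resulting test functions and pass to the limit.
  Second derivatives of the mollified functions are mollified second derivatives of \<phi>, hence
  uniformly bounded and supported in one ball, where the kernel is integrable.\<close>

lemma fs_C2:
  assumes \<phi>: "C2_on UNIV \<phi>" and b: "bounded {x. \<phi> x \<noteq> 0}"
  shows "(LINT y|lborel. G x y * M \<phi> y) = - \<phi> x"
proof -
  obtain R where R: "R > 0" "\<And>x. \<phi> x \<noteq> 0 \<Longrightarrow> norm x \<le> R"
    using b unfolding bounded_pos by blast
  have \<phi>0: "\<phi> x = 0" if "norm x > R" for x using R(2)[of x] that by linarith
  have op: "open {x::real^'n. norm x > R}" by (intro open_Collect_less continuous_intros)
  have p0: "partial j \<phi> x = 0" if "norm x > R" for x j
    by (rule partial_zero[OF op]) (use \<phi>0 that in auto)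
  have pp0: "partial i (partial j \<phi>) x = 0" if "norm x > R" for x i j
    by (rule partial_zero[OF op]) (use p0 that in auto)
  have cont: "continuous_on UNIV \<phi>" "continuous_on UNIV (partial j \<phi>)" "continuous_on UNIV (partial i (partial j \<phi>))" for i j
    using C2_on_continuous[OF \<phi>] C1_on_continuous[OF C2_onD(2)[OF \<phi>]] C2_onD(2)[OF \<phi>] by (auto simp: C1_on_def)
  have CcI: "Cc f" if "continuous_on UNIV f" "\<And>x. norm x > R \<Longrightarrow> f x = 0" for f :: "real^'n \<Rightarrow> real"
    by (rule Cc_subset[OF that(1) bounded_cball[of 0 R]]) (use that in auto)
  have "\<exists>B. \<forall>x. \<bar>partial i (partial j \<phi>) x\<bar> \<le> B" "\<exists>B. \<forall>x. \<bar>partial j \<phi> x\<bar> \<le> B" for i j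
    using Cc_bounded[OF CcI[OF cont(3) pp0]] Cc_bounded[OF CcI[OF cont(2) p0]] by metis+
  then obtain B2 B1 where B: "\<And>i j x. \<bar>partial i (partial j \<phi>) x\<bar> \<le> B2 i j" "\<And>j x. \<bar>partial j \<phi> x\<bar> \<le> B1 j"
    by metis
  let ?K = "cball (0::real^'n) (R + 1)"
  define e where "e n = 1 / real (Suc n)" for n
  have e: "e n > 0" "e n \<le> 1" for n by (auto simp: e_def)
  \<comment> \<open>A bound for \<open>M\<close> of all mollified functions at once:
    \<open>B2\<close> and \<open>B1\<close> bound the partials of \<phi>, and mollification does not
    increase sup norms.\<close>
  define w where "w y = (\<Sum>i\<in>UNIV. \<Sum>j\<in>UNIV. \<bar>c i j y\<bar> * B2 i j + \<bar>partial i (c i j) y\<bar> * B1 j)" for y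
  have bound: "\<bar>M (moll (e n) \<phi>) y\<bar> \<le> indicator ?K y * w y" for n y
  proof (cases "norm y \<le> R + 1")
    case True
    have "\<bar>moll (e n) (partial i (partial j \<phi>)) y\<bar> \<le> B2 i j" "\<bar>moll (e n) (partial j \<phi>) y\<bar> \<le> B1 j" for i j
      by (rule moll_bound[OF e(1) cont(3) B(1)], rule moll_bound[OF e(1) cont(2) B(2)])
    then have "\<bar>M (moll (e n) \<phi>) y\<bar> \<le> w y"
      unfolding M_moll[OF e(1) \<phi>] w_def
      by (intro order_trans[OF sum_abs] sum_mono order_trans[OF abs_triangle_ineq] add_mono)
         (auto simp: abs_mult intro!: mult_left_mono)
    then show ?thesis using True by simp
  next
    case False
    then have f: "norm y > R + e n" using e(2)[of n] by linarith
    have "moll (e n) (partial i (partial j \<phi>)) y = 0" "moll (e n) (partial j \<phi>) y = 0" for i j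
      using moll_support[OF e(1) cont(3) _ f] moll_support[OF e(1) cont(2) _ f] p0 pp0 by blast+
    then show ?thesis using False by (simp add: M_moll[OF e(1) \<phi>])
  qed
  have w_cont: "continuous_on UNIV w"
    unfolding w_def by (intro continuous_intros continuous_c)
  obtain W where W: "\<And>y. y \<in> ?K \<Longrightarrow> \<bar>w y\<bar> \<le> W"
    using continuous_on_compact_bounded[OF continuous_on_subset[OF w_cont subset_UNIV] compact_cball] by blast
  have lim: "(\<lambda>n. M (moll (e n) \<phi>) y) \<longlonglongrightarrow> M \<phi> y" for y
    unfolding M_moll[OF e(1) \<phi>] M_expand[OF \<phi> UNIV_I] unfolding e_def
    by (intro tendsto_sum tendsto_add tendsto_mult tendsto_const moll_tendsto cont)
  have meas: "M \<phi> \<in> borel_measurable borel" "M (moll (e n) \<phi>) \<in> borel_measurable borel" for n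
    using continuous_on_M[OF \<phi>] continuous_on_M[OF C2_on_moll[OF e(1) \<phi>]]
    by (auto intro: borel_measurable_continuous_onI)
  note meas[measurable]
  have "(\<lambda>n. LINT y|lborel. G x y * M (moll (e n) \<phi>) y) \<longlonglongrightarrow> (LINT y|lborel. G x y * M \<phi> y)"
  proof (rule integral_dominated_convergence[where w="\<lambda>y. W * (indicator ?K y * G x y)"])
    show "integrable lborel (\<lambda>y. W * (indicator ?K y * G x y))"
      by (intro integrable_mult_right integrable_G_compact compact_cball)
    show "AE y in lborel. (\<lambda>n. G x y * M (moll (e n) \<phi>) y) \<longlonglongrightarrow> G x y * M \<phi> y"
      by (intro AE_I2 tendsto_mult tendsto_const lim)
    show "AE y in lborel. norm (G x y * M (moll (e n) \<phi>) y) \<le> W * (indicator ?K y * G x y)" for n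
    proof (rule AE_I2)
      fix y
      have "\<bar>M (moll (e n) \<phi>) y\<bar> \<le> W * indicator ?K y"
        using bound[of n y] W[of y] by (auto simp: indicator_def split: if_splits)
      from mult_left_mono[OF this G_nonneg[of x y]]
      show "norm (G x y * M (moll (e n) \<phi>) y) \<le> W * (indicator ?K y * G x y)"
        using G_nonneg[of x y] by (simp add: abs_mult mult_ac)
    qed
  qed measurable
  moreover have "(LINT y|lborel. G x y * M (moll (e n) \<phi>) y) = - moll (e n) \<phi> x" for n
    by (rule fs_test[OF test_fun_moll[OF e(1) cont(1) \<phi>0]])
  moreover have "(\<lambda>n. - moll (e n) \<phi> x) \<longlonglongrightarrow> - \<phi> x"
    unfolding e_def by (intro tendsto_minus moll_tendsto cont)
  ultimately show ?thesis by (simp add: LIMSEQ_unique)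
qed

end

section \<open>Maximum principle and mean value formulas\<close>

text \<open>The truncation level lies above \<open>w\<close> near the boundary, so the extension
  vanishes on an open set \<open>N\<close> containing the complement of \<open>W\<close>; regularity
  is then checked on the open cover by \<open>W\<close> and \<open>N\<close>. The boundary condition
  is stated by neighbourhoods to fit limsup conditions as well as continuity.\<close>

lemma truncated_extension:
  assumes W: "open W" and w: "C2_on W w"
    and bd: "\<And>y. y \<in> frontier W \<Longrightarrow> \<exists>U. open U \<and> y \<in> U \<and> (\<forall>x\<in>U \<inter> W. w x < d)"
    and g: "g = (\<lambda>x. if x \<in> W then (max 0 (w x - d)) ^ 3 else 0)"
  obtains N where "C2_on UNIV g" "open N" "- W \<subseteq> N" "\<And>x. x \<in> N \<Longrightarrow> g x = 0"
proof -
  \<comment> \<open>The union is over every open set on which the truncation is inactive, including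
    those disjoint from \<open>W\<close>.\<close>
  define N where "N = \<Union>{U. open U \<and> (\<forall>x\<in>U \<inter> W. w x < d)}"
  have N: "open N" unfolding N_def by auto
  have "x \<in> N" if "x \<notin> W" for x
  proof (cases "x \<in> closure W")
    case True
    then have "x \<in> frontier W" using that W by (simp add: frontier_def interior_open)
    then show ?thesis using bd unfolding N_def by blast
  next
    case False
    moreover have "open (- closure W)" "\<forall>x\<in>- closure W \<inter> W. w x < d"
      using closure_subset[of W] by auto
    ultimately show ?thesis unfolding N_def by blast
  qed
  then have sub: "- W \<subseteq> N" by auto
  have g0: "g x = 0" if "x \<in> N" for x
    using that by (auto simp: g N_def)
  have "C2_on W g"
    by (rule C2_on_cong[OF W _ C2_on_max_cube[OF W w, of d]]) (simp add: g)
  moreover have "C2_on N g"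
    by (rule C2_on_cong[OF N _ C2_on_const[of N 0]]) (simp add: g0)
  ultimately have "C2_on (W \<union> N) g" by (rule C2_on_Un[OF W N])
  moreover have "W \<union> N = UNIV" using sub by auto
  ultimately show ?thesis using that N sub g0 by metis
qed

context degenerate_operator
begin

lemma M_truncated_nonneg:
  assumes W: "open W" and w: "C2_on W w"
    and M: "\<And>x. x \<in> W \<Longrightarrow> w x > d \<Longrightarrow> M w x \<ge> 0"
    and g: "g = (\<lambda>x. if x \<in> W then (max 0 (w x - d)) ^ 3 else 0)"
    and N: "open N" "- W \<subseteq> N" "\<And>x. x \<in> N \<Longrightarrow> g x = 0"
  shows "M g x \<ge> 0"
proof (cases "x \<in> W")
  case True
  have "M g x = M (\<lambda>x. (max 0 (w x - d)) ^ 3) x"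
    by (rule M_cong[OF W True]) (simp add: g)
  then show ?thesis using M_compose_nonneg[OF W w True, of d] M[OF True] by simp
next
  case False
  then have "x \<in> N" using N by auto
  then show ?thesis using M_zero[OF N(1) _ N(3)] by simp
qed

end

context degenerate_operator_fs
begin

text \<open>If \<open>w\<close> were positive somewhere, the extension by zero of \<open>(w - d)\<^sub>+\<^sup>3\<close> would be an
  admissible function in the defining identity of \<open>\<Gamma>\<close>, which forces it to be \<open>\<le> 0\<close>.\<close>

lemma weak_maximum_principle:
  assumes W: "open W" "bounded W" and w: "C2_on W w"
    and M: "\<And>x. x \<in> W \<Longrightarrow> w x > 0 \<Longrightarrow> M w x \<ge> 0"
    and bd: "\<And>y d. y \<in> frontier W \<Longrightarrow> d > 0 \<Longrightarrow> \<exists>U. open U \<and> y \<in> U \<and> (\<forall>x\<in>U \<inter> W. w x < d)"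
    and x: "x \<in> W"
  shows "w x \<le> 0"
proof (rule ccontr)
  assume neg: "\<not> w x \<le> 0"
  define d where "d = w x / 2"
  have d: "d > 0" using neg by (simp add: d_def)
  define g where "g = (\<lambda>x. if x \<in> W then (max 0 (w x - d)) ^ 3 else 0)"
  obtain N where N: "C2_on UNIV g" "open N" "- W \<subseteq> N" "\<And>x. x \<in> N \<Longrightarrow> g x = 0"
    using truncated_extension[OF W(1) w bd[OF _ d] g_def] by blast
  have Mg: "M g y \<ge> 0" for y
    by (rule M_truncated_nonneg[OF W(1) w _ g_def N(2-4)]) (use M d in auto)
  have "bounded {x. g x \<noteq> 0}"
    by (rule bounded_subset[OF W(2)]) (auto simp: g_def)
  then have "(LINT y|lborel. G x y * M g y) = - g x"
    by (rule fs_C2[OF N(1)])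
  moreover have "(LINT y|lborel. G x y * M g y) \<ge> 0"
    by (rule Bochner_Integration.integral_nonneg) (simp add: G_nonneg Mg)
  moreover have "g x > 0" using x neg by (simp add: g_def d_def)
  ultimately show False by simp
qed

text \<open>The comparison with a harmonic \<open>h\<close> is the weak maximum principle for
  \<open>g - h\<close>, whose image under \<open>M\<close> is that of \<open>g\<close>.\<close>

lemma subharmonicI:
  assumes g: "C2_on UNIV g" and Mg: "\<And>x. M g x \<ge> 0"
  shows "L_subharmonic_on V A UNIV (\<lambda>x. ereal (g x))"
  unfolding L_subharmonic_on_def
proof (intro conjI allI impI ballI)
  show "usc_on UNIV (\<lambda>x. ereal (g x))"
    unfolding usc_on_def
  proof
    fix k :: ereal
    have "open {x. ereal (g x) < k}"
      using C2_on_continuous[OF g] by (intro open_Collect_less continuous_on_ereal continuous_on_const)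
    then show "openin (top_of_set UNIV) {x \<in> UNIV. ereal (g x) < k}" by simp
  qed
next
  fix W h x
  assume *: "open W \<and> bounded W \<and> closure W \<subseteq> UNIV \<and> L_harmonic_on V A W h \<and>
      continuous_on (closure W) h \<and> (\<forall>x\<in>frontier W. ereal (g x) \<le> ereal (h x))" and x: "x \<in> W"
  have W: "open W" "bounded W" and h: "C2_on W h"
    and hc: "continuous_on (closure W) h" and gh: "\<And>x. x \<in> frontier W \<Longrightarrow> g x \<le> h x"
    using * by (auto simp: L_harmonic_on_def smooth_on_def intro: C2_on_Ck)
  have Mh: "M h x = 0" if "x \<in> W" for x
    using * that Lop_M[of x h] unfolding L_harmonic_on_def by (metis mult_zero_right)
  have gW: "C2_on W g" using C2_on_subset[OF g] by simp
  have "g x - h x \<le> 0"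
  proof (rule weak_maximum_principle[OF W C2_on_diff[OF W(1) gW h] _ _ x])
    show "M (\<lambda>x. g x - h x) y \<ge> 0" if "y \<in> W" for y
      using M_diff[OF W(1) gW h that] Mg[of y] Mh[OF that] by simp
    fix y and d :: real assume y: "y \<in> frontier W" and d: "d > 0"
    have "continuous_on (closure W) (\<lambda>x. g x - h x)"
      by (intro continuous_on_diff continuous_on_subset[OF C2_on_continuous[OF g]] hc) simp
    \<comment> \<open>Continuity up to the boundary is converted into the neighbourhood form of the
      boundary condition.\<close>
    from continuous_openin_preimage_gen[OF this, of "{..<d}"]
    obtain U where U: "open U" "closure W \<inter> (\<lambda>x. g x - h x) -` {..<d} = closure W \<inter> U"
      by (auto simp: openin_open)
    have "y \<in> closure W" using y by (simp add: frontier_def)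
    then have "y \<in> U" using U(2) gh[OF y] d by auto
    moreover have "\<forall>x\<in>U \<inter> W. g x - h x < d" using U(2) closure_subset[of W] by blast
    ultimately show "\<exists>U. open U \<and> y \<in> U \<and> (\<forall>x\<in>U \<inter> W. g x - h x < d)" using U(1) by blast
  qed
  then show "ereal (g x) \<le> ereal (h x)" by simp
qed auto

end

text \<open>A convex function of class \<open>C\<^sup>2\<close> that vanishes on \<open>t \<le> 1\<close> and equals \<open>t - 3/2\<close> on \<open>t \<ge> 2\<close>;
  its second derivative is a hat function of integral \<open>1\<close>.\<close>

definition hinge :: "real \<Rightarrow> real" where
  "hinge t = 2/3 * ((max 0 (t - 1)) ^ 3 - 2 * (max 0 (t - 3/2)) ^ 3 + (max 0 (t - 2)) ^ 3)"

definition hinge' :: "real \<Rightarrow> real" where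
  "hinge' t = 2/3 * (3 * (max 0 (t - 1))\<^sup>2 - 2 * (3 * (max 0 (t - 3/2))\<^sup>2) + 3 * (max 0 (t - 2))\<^sup>2)"

definition hinge'' :: "real \<Rightarrow> real" where
  "hinge'' t = 2/3 * (6 * max 0 (t - 1) - 2 * (6 * max 0 (t - 3/2)) + 6 * max 0 (t - 2))"

lemma DERIV_hinge: "(hinge has_real_derivative hinge' t) (at t)"
  unfolding hinge_def[abs_def] hinge'_def
  by (intro DERIV_cmult DERIV_add DERIV_diff DERIV_shift_max_cube)

lemma DERIV_hinge': "(hinge' has_real_derivative hinge'' t) (at t)"
  unfolding hinge'_def[abs_def] hinge''_def
  by (intro DERIV_cmult[of _ _ _ _ "2/3"] DERIV_add DERIV_diff DERIV_cmult[of _ _ _ _ 2] DERIV_shift_max_cube)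

lemma continuous_hinge'': "continuous_on S hinge''"
  unfolding hinge''_def by (intro continuous_intros)

lemma hinge''_nonneg: "hinge'' t \<ge> 0"
  by (auto simp: hinge''_def max_def)

lemma hinge''_eq_0: "t \<le> 1 \<or> t \<ge> 2 \<Longrightarrow> hinge'' t = 0"
  by (auto simp: hinge''_def max_def)

lemma hinge_eq_0: "t \<le> 1 \<Longrightarrow> hinge t = 0"
  by (simp add: hinge_def max_def)

lemma hinge_eq: "t \<ge> 2 \<Longrightarrow> hinge t = t - 3/2"
  by (simp add: hinge_def max_def power3_eq_cube algebra_simps) (simp add: field_simps)

text \<open>The function \<open>t - hinge t\<close> is a smooth version of the minimum of
  \<open>t\<close> and a constant: it follows \<open>t\<close> up to 1 and has the value 3/2 from 2
  on.\<close>

lemma hinge_bounds: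
  shows "hinge t \<ge> 0" and "t - hinge t \<le> 3/2" and "min t 1 \<le> t - hinge t"
proof -
  have cube: "0 \<le> s ^ 3 \<and> s ^ 3 \<le> s / 4" if "0 \<le> s" "s \<le> 1/2" for s :: real
  proof -
    have "s * s \<le> 1/2 * (1/2)" using that by (intro mult_mono) auto
    then have "s * (s * s) \<le> s * (1/4)" using that by (intro mult_left_mono) auto
    then show ?thesis using that by (simp add: power3_eq_cube mult.assoc)
  qed
  consider "t \<le> 1" | "1 \<le> t" "t \<le> 3/2" | "3/2 \<le> t" "t \<le> 2" | "2 \<le> t" by linarith
  then have "hinge t \<ge> 0 \<and> t - hinge t \<le> 3/2 \<and> min t 1 \<le> t - hinge t"
  proof cases
    case 1 then show ?thesis by (simp add: hinge_eq_0)
  next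
    case 2
    then have "hinge t = 2/3 * (t - 1) ^ 3" by (simp add: hinge_def max_def)
    then obtain z where "hinge t = 2/3 * z" "0 \<le> z" "z \<le> (t - 1) / 4"
      using cube[of "t - 1"] 2 by auto
    then show ?thesis using 2 by (auto simp: min_def)
  next
    case 3
    define s where "s = t - 3/2"
    have t: "t = s + 3/2" by (simp add: s_def)
    have "max 0 (t - 1) = s + 1/2" "max 0 (t - 3/2) = s" "max 0 (t - 2) = 0"
      using 3 by (auto simp: s_def max_def)
    then have "hinge t = 2/3 * ((s + 1/2) ^ 3 - 2 * s ^ 3)" by (simp add: hinge_def)
    \<comment> \<open>In terms of \<open>t\<close>, the excess over the final line
      \<open>t - 3/2\<close> is 2/3 times the cube of \<open>2 - t\<close>.\<close>
    also have "\<dots> = s + 2/3 * (1/2 - s) ^ 3" by (simp add: power3_eq_cube algebra_simps)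
    finally show ?thesis using cube[of "1/2 - s"] 3 by (simp add: t min_def)
  next
    case 4 then show ?thesis by (simp add: hinge_eq min_def)
  qed
  then show "hinge t \<ge> 0" "t - hinge t \<le> 3/2" "min t 1 \<le> t - hinge t" by auto
qed

lemma measurable_hinge [measurable]: "hinge \<in> borel_measurable borel"
  using DERIV_continuous_on[of UNIV hinge hinge'] DERIV_hinge
  by (auto intro: borel_measurable_continuous_onI)

text \<open>For \<open>t = G x y\<close> this is the part of the kernel above the cap; it
  approximates the whole kernel from below as \<open>e\<close> tends to 0, with an error of at most
  3/2 \<open>e\<close>.\<close>

lemma scaled_hinge_bounds:
  assumes "e > 0" "t \<ge> 0"
  shows "0 \<le> e * hinge (t / e)" "e * hinge (t / e) \<le> t" "t - 3/2 * e \<le> e * hinge (t / e)"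
proof -
  show "0 \<le> e * hinge (t / e)" using assms hinge_bounds(1) by simp
  have "0 \<le> min (t / e) 1" using assms by simp
  also note hinge_bounds(3)
  finally have "0 \<le> t / e - hinge (t / e)" .
  then have "e * hinge (t / e) \<le> e * (t / e)" using assms by (intro mult_left_mono) auto
  then show "e * hinge (t / e) \<le> t" using assms by simp
  have "e * (t / e - hinge (t / e)) \<le> e * (3/2)" by (rule mult_left_mono[OF hinge_bounds(2)]) (use assms in simp)
  then show "t - 3/2 * e \<le> e * hinge (t / e)" using assms by (simp add: right_diff_distrib)
qed

lemma scaled_hinge_tendsto:
  assumes "t \<ge> 0" shows "(\<lambda>n. 1 / Suc n * hinge (t / (1 / Suc n))) \<longlonglongrightarrow> t"
proof (rule tendsto_sandwich[of "\<lambda>n. t - 3/2 * (1 / Suc n)" _ _ "\<lambda>_. t"])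
  have "(\<lambda>n. t - 3/2 * (1 / Suc n)) \<longlonglongrightarrow> t - 3/2 * 0"
    by (intro tendsto_intros LIMSEQ_Suc lim_1_over_n)
  then show "(\<lambda>n. t - 3/2 * (1 / Suc n)) \<longlonglongrightarrow> t" by simp
  show "eventually (\<lambda>n. t - 3/2 * (1 / Suc n) \<le> 1 / Suc n * hinge (t / (1 / Suc n))) sequentially"
    by (intro always_eventually allI scaled_hinge_bounds(3)) (use assms in auto)
  show "eventually (\<lambda>n. 1 / Suc n * hinge (t / (1 / Suc n)) \<le> t) sequentially"
    by (intro always_eventually allI scaled_hinge_bounds(2)) (use assms in auto)
qed auto

context degenerate_operator_fs
begin

text \<open>\<open>capped e x\<close> is a smoothed \<open>min (\<Gamma> x) e\<close>; the measure with density \<open>spread e x\<close> is the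
  probability measure, concentrated on the shell \<open>e \<le> \<Gamma> x \<le> 2 e\<close>, whose potential it is.\<close>

definition capped :: "real \<Rightarrow> real^'n \<Rightarrow> real^'n \<Rightarrow> real" where
  "capped e x y = (if y = x then 3/2 * e else G x y - e * hinge (G x y / e))"

definition spread :: "real \<Rightarrow> real^'n \<Rightarrow> real^'n \<Rightarrow> real" where
  "spread e x y = - M (capped e x) y"

lemma G_large_near:
  obtains U where "open U" "x \<in> U" "\<And>y. y \<in> U \<Longrightarrow> y \<noteq> x \<Longrightarrow> G x y \<ge> B"
proof -
  have "eventually (\<lambda>y. G x y \<ge> B) (at x)"
    using G_at_top filterlim_at_top by blast
  then show ?thesis using that unfolding eventually_at_topological by blast
qed

lemma G_small_far:
  assumes "e > 0" obtains R where "\<And>y. norm y \<ge> R \<Longrightarrow> G x y < e"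
proof -
  have "eventually (\<lambda>y. dist (G x y) 0 < e) at_infinity"
    using G_tendsto_0 assms tendstoD by blast
  then show ?thesis using that unfolding eventually_at_infinity by (auto simp: abs_less_iff)
qed

lemma capped_eq_G: "e > 0 \<Longrightarrow> y \<noteq> x \<Longrightarrow> G x y \<le> e \<Longrightarrow> capped e x y = G x y"
  by (simp add: capped_def hinge_eq_0)

lemma capped_eq_const: "e > 0 \<Longrightarrow> y = x \<or> G x y \<ge> 2 * e \<Longrightarrow> capped e x y = 3/2 * e"
  by (auto simp: capped_def hinge_eq pos_le_divide_eq field_simps)

lemma capped_bounds:
  assumes "e > 0"
  shows "capped e x y \<le> 3/2 * e" and "capped e x y > 0" and "y \<noteq> x \<Longrightarrow> capped e x y \<le> G x y"
proof -
  have *: "capped e x y = e * (G x y / e - hinge (G x y / e))" if "y \<noteq> x"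
    using that assms by (simp add: capped_def field_simps)
  show "capped e x y \<le> 3/2 * e"
  proof (cases "y = x")
    case False
    then show ?thesis
      using * mult_left_mono[OF hinge_bounds(2)[of "G x y / e"], of e] assms by simp
  qed (simp add: capped_def)
  show "capped e x y > 0"
  proof (cases "y = x")
    case False
    have "0 < min (G x y / e) 1" using G_pos[of x y] False assms by simp
    also note hinge_bounds(3)
    finally show ?thesis using * False assms by simp
  qed (use assms in \<open>simp add: capped_def\<close>)
  show "capped e x y \<le> G x y" if "y \<noteq> x"
    using that assms hinge_bounds(1)[of "G x y / e"] by (simp add: capped_def)
qed

lemma capped_tendsto_0:
  assumes "\<And>n. e n > 0" "e \<longlonglongrightarrow> 0" shows "(\<lambda>n. capped (e n) (x n) y) \<longlonglongrightarrow> 0"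
proof (rule tendsto_sandwich[of "\<lambda>_. 0" _ _ "\<lambda>n. 3/2 * e n"])
  show "(\<lambda>n. 3/2 * e n) \<longlonglongrightarrow> 0" using tendsto_mult_left[OF assms(2), of "3/2"] by simp
qed (use capped_bounds(1,2)[OF assms(1)] in \<open>auto intro!: always_eventually less_imp_le simp del: times_divide_eq_left\<close>)

lemma C2_capped_off:
  assumes e: "e > 0" shows "C2_on (- {x}) (capped e x)"
proof -
  have o: "open (- {x})" by (intro open_Compl closed_singleton)
  have "C2_on (- {x}) (\<lambda>y. e * hinge (1 / e * G x y))"
    by (intro C2_on_mult[OF o C2_on_const] C2_on_compose[OF o C2_on_mult[OF o C2_on_const C2_G] DERIV_hinge DERIV_hinge'])
       (rule continuous_on_compose2[OF continuous_hinge''[of UNIV] C2_on_continuous[OF C2_on_mult[OF o C2_on_const C2_G]]], simp)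
  then have "C2_on (- {x}) (\<lambda>y. G x y - e * hinge (1 / e * G x y))"
    by (rule C2_on_diff[OF o C2_G])
  then show ?thesis
    by (rule C2_on_cong[OF o, rotated]) (simp add: capped_def)
qed

text \<open>Since the kernel tends to infinity at its pole, the truncation is the constant 3/2
  \<open>e\<close> in a neighbourhood of \<open>x\<close>, which removes the singularity.\<close>

lemma C2_capped:
  assumes e: "e > 0" shows "C2_on UNIV (capped e x)"
proof -
  obtain U where U: "open U" "x \<in> U" "\<And>y. y \<in> U \<Longrightarrow> y \<noteq> x \<Longrightarrow> G x y \<ge> 2 * e"
    by (rule G_large_near[of x "2 * e"]) blast
  have "C2_on U (capped e x)"
    by (rule C2_on_cong[OF U(1) _ C2_on_const[of U "3/2 * e"]]) (metis U(3) capped_eq_const e)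
  then have "C2_on (- {x} \<union> U) (capped e x)"
    using C2_capped_off[OF e] U(1) by (intro C2_on_Un) auto
  moreover have "- {x} \<union> U = UNIV" using U(2) by auto
  ultimately show ?thesis by simp
qed

lemma continuous_on_capped: "e > 0 \<Longrightarrow> continuous_on S (capped e x)"
  using C2_capped C2_on_continuous continuous_on_subset[OF _ subset_UNIV] by blast

lemma measurable_capped [measurable]: "e > 0 \<Longrightarrow> capped e x \<in> borel_measurable borel"
  using continuous_on_capped by (rule borel_measurable_continuous_onI)

section \<open>Harmonicity off the pole and averages over shells\<close>

text \<open>Green's formula does not apply to \<open>G x\<close> itself because of the pole. On the
  support of a test function that avoids \<open>x\<close>, the kernel coincides with a truncation of
  class C^2 on the whole space; the identity for \<Gamma> then returns the value of the test
  function at \<open>x\<close>, which is 0.\<close>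

lemma M_G_eq_0:
  assumes "y \<noteq> x" shows "M (G x) y = 0"
proof (rule fundamental_lemma_zero[of "- {x}"])
  show "continuous_on (- {x}) (M (G x))" by (rule continuous_on_M[OF C2_G])
  fix \<phi> K assume \<phi>: "C2_on UNIV \<phi>" and K: "compact K" "K \<subseteq> - {x}" and \<phi>0: "\<And>y. y \<notin> K \<Longrightarrow> \<phi> y = 0"
  have b: "bounded {y. \<phi> y \<noteq> 0}"
    using \<phi>0 by (intro bounded_subset[OF compact_imp_bounded[OF K(1)]]) auto
  obtain B where B: "\<forall>z\<in>K. \<bar>G x z\<bar> \<le> B"
    using continuous_on_compact_bounded[OF continuous_on_subset[OF continuous_on_G K(2)] K(1)] by blast
  \<comment> \<open>Any positive level above the kernel on \<open>K\<close> makes the truncation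
    inactive near \<open>K\<close>.\<close>
  define e where "e = max 0 B + 1"
  have e: "e > 0" by (simp add: e_def)
  define U where "U = - {x} \<inter> G x -` {..<e}"
  have U: "open U"
    unfolding U_def by (intro continuous_open_preimage continuous_on_G open_Compl closed_singleton open_lessThan)
  have KU: "K \<subseteq> U" using K(2) B by (force simp: U_def e_def)
  have eq: "capped e x y = G x y" if "y \<in> U" for y
    using that by (intro capped_eq_G e) (auto simp: U_def)
  have M\<phi>0: "M \<phi> y = 0" if "y \<notin> K" for y
    by (rule M_zero[of "- K"]) (use that \<phi>0 K(1) compact_imp_closed in auto)
  have "(LINT y|lborel. M (G x) y * \<phi> y) = (LINT y|lborel. \<phi> y * M (capped e x) y)"
  proof (rule Bochner_Integration.integral_cong[OF refl])
    fix y show "M (G x) y * \<phi> y = \<phi> y * M (capped e x) y"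
    proof (cases "y \<in> K")
      case True
      then have "y \<in> U" using KU by auto
      from M_cong[OF U this eq] show ?thesis by simp
    qed (simp add: \<phi>0)
  qed
  also have "\<dots> = (LINT y|lborel. M \<phi> y * capped e x y)"
    by (rule green[OF \<phi> C2_capped[OF e] b])
  also have "\<dots> = (LINT y|lborel. G x y * M \<phi> y)"
  proof (rule Bochner_Integration.integral_cong[OF refl])
    fix y show "M \<phi> y * capped e x y = G x y * M \<phi> y"
      using eq[of y] KU M\<phi>0[of y] by (cases "y \<in> K") auto
  qed
  also have "\<dots> = - \<phi> x" by (rule fs_C2[OF \<phi> b])
  also have "\<dots> = 0" using \<phi>0 K(2) by auto
  finally show "(LINT y|lborel. M (G x) y * \<phi> y) = 0" .
qed (use assms in auto)

text \<open>The truncation is a concave function of the kernel and the kernel is harmonic here, so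
  only the second order term of the chain rule survives, with a sign.\<close>

lemma spread_off:
  assumes e: "e > 0" and y: "y \<noteq> x"
  shows "spread e x y = hinge'' (G x y / e) / e * Q (G x) y"
proof -
  have o: "open (- {x})" "y \<in> - {x}" using y by auto
  have D: "((\<lambda>t. t - e * hinge (t / e)) has_real_derivative 1 - hinge' (t / e)) (at t)"
    "((\<lambda>t. 1 - hinge' (t / e)) has_real_derivative - hinge'' (t / e) / e) (at t)" for t
  proof -
    have d: "((\<lambda>t. t / e) has_real_derivative 1 / e) (at t)"
      using e by (auto intro!: derivative_eq_intros)
    show "((\<lambda>t. t - e * hinge (t / e)) has_real_derivative 1 - hinge' (t / e)) (at t)"
      using DERIV_diff[OF DERIV_ident DERIV_cmult[OF DERIV_chain2[OF DERIV_hinge d], of e]] e by simp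
    show "((\<lambda>t. 1 - hinge' (t / e)) has_real_derivative - hinge'' (t / e) / e) (at t)"
      using DERIV_diff[OF DERIV_const DERIV_chain2[OF DERIV_hinge' d]] by simp
  qed
  have cont: "continuous_on UNIV (\<lambda>t. - hinge'' (t / e) / e)"
    using e by (intro continuous_intros continuous_on_compose2[OF continuous_hinge'']) auto
  have "M (capped e x) y = M (\<lambda>y. G x y - e * hinge (G x y / e)) y"
    by (rule M_cong[OF o]) (auto simp: capped_def)
  also have "\<dots> = (1 - hinge' (G x y / e)) * M (G x) y + (- hinge'' (G x y / e) / e) * Q (G x) y"
    by (rule M_compose[OF o(1) C2_G o(2) D cont])
  finally show ?thesis using M_G_eq_0[OF y] by (simp add: spread_def)
qed

lemma spread_self: assumes e: "e > 0" shows "spread e x x = 0"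
proof -
  obtain U where U: "open U" "x \<in> U" "\<And>y. y \<in> U \<Longrightarrow> y \<noteq> x \<Longrightarrow> G x y \<ge> 2 * e"
    by (rule G_large_near[of x "2 * e"]) blast
  have "M (capped e x) x = 0"
    by (rule M_zero[OF U(1,2), of _ "3/2 * e"]) (metis U(3) capped_eq_const e)
  then show ?thesis by (simp add: spread_def)
qed

lemma spread_nonneg: "e > 0 \<Longrightarrow> spread e x y \<ge> 0"
  by (cases "y = x") (simp_all add: spread_self spread_off hinge''_nonneg Q_nonneg)

lemma spread_shell:
  assumes "e > 0" "spread e x y \<noteq> 0"
  shows "y \<noteq> x" "e < G x y" "G x y < 2 * e"
proof -
  show y: "y \<noteq> x" using assms spread_self by auto
  have "\<not> (G x y / e \<le> 1 \<or> G x y / e \<ge> 2)"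
    using assms hinge''_eq_0[of "G x y / e"] by (auto simp: spread_off[OF assms(1) y])
  then show "e < G x y" "G x y < 2 * e" using assms(1) by (auto simp: field_simps)
qed

lemma Cc_spread: assumes e: "e > 0" shows "Cc (spread e x)"
proof -
  obtain R where R: "\<And>y. norm y \<ge> R \<Longrightarrow> G x y < e" by (rule G_small_far[OF e, of x]) blast
  show ?thesis
  proof (rule Cc_subset[OF _ bounded_cball[of 0 R]])
    show "continuous_on UNIV (spread e x)"
      unfolding spread_def[abs_def] by (intro continuous_on_minus continuous_on_M C2_capped e)
    show "spread e x y = 0" if "y \<notin> cball 0 R" for y
      using R[of y] that spread_shell(2)[OF e, of x y] by auto
  qed
qed

text \<open>Subtract Green's formula for the capped kernel from the identity for the full kernel.
  The difference of the kernels vanishes where \<open>G x y <= e\<close>, so a cutoff of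
  \<open>g\<close> that is 1 on a large ball leaves no trace.\<close>

lemma mean_value:
  assumes e: "e > 0" and g: "C2_on UNIV g"
  shows "integrable lborel (\<lambda>y. e * hinge (G x y / e) * M g y)"
    and "(LINT y|lborel. e * hinge (G x y / e) * M g y) = (LINT y|lborel. g y * spread e x y) - g x"
proof -
  obtain R0 where R0: "\<And>y. norm y \<ge> R0 \<Longrightarrow> G x y < e" by (rule G_small_far[OF e, of x]) blast
  \<comment> \<open>Beyond radius \<open>R0\<close> the kernel is below \<open>e\<close>; including
    the norm of \<open>x\<close> guarantees that the cutoff is 1 at the pole too.\<close>
  define R where "R = max R0 (norm x) + 1"
  obtain \<zeta> :: "real^'n \<Rightarrow> real" where \<zeta>: "C2_on UNIV \<zeta>" "\<And>x. norm x \<le> R \<Longrightarrow> \<zeta> x = 1" "bounded {x. \<zeta> x \<noteq> 0}"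
    by (rule cutoff_exists[of R]) blast
  let ?f = "\<lambda>y. \<zeta> y * g y"
  have f: "C2_on UNIV ?f" by (intro C2_on_mult \<zeta> g open_UNIV)
  have bf: "bounded {y. ?f y \<noteq> 0}" by (rule bounded_subset[OF \<zeta>(3)]) auto
  have CM: "Cc (M ?f)" by (rule Cc_M[OF f bf])
  have far: "G x y < e" if "norm y \<ge> R" for y using R0 that by (simp add: R_def)
  have opb: "open (ball (0::real^'n) R)" by simp
  have M_eq: "M ?f y = M g y" if "norm y < R" for y
    by (rule M_cong[OF opb]) (use \<zeta>(2) that in auto)
  have i1: "integrable lborel (\<lambda>y. G x y * M ?f y)" by (rule integrable_G_Cc[OF CM])
  have i2: "integrable lborel (\<lambda>y. M ?f y * capped e x y)"
    by (rule Cc_integrable[OF Cc_mult[OF CM continuous_on_capped[OF e]]])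
  have eq: "e * hinge (G x y / e) * M g y = G x y * M ?f y - M ?f y * capped e x y" if "y \<noteq> x" for y
  proof (cases "norm y < R")
    case True
    then show ?thesis using that by (simp add: M_eq capped_def algebra_simps)
  next
    case False
    then have "G x y \<le> e" using far[of y] by simp
    then show ?thesis using that e by (simp add: capped_eq_G hinge_eq_0)
  qed
  have AE: "AE y in lborel. G x y * M ?f y - M ?f y * capped e x y = e * hinge (G x y / e) * M g y"
    using AE_lborel_singleton[of x] by eventually_elim (simp add: eq)
  have [measurable]: "M g \<in> borel_measurable borel"
    using continuous_on_M[OF g] by (rule borel_measurable_continuous_onI)
  have meas: "(\<lambda>y. e * hinge (G x y / e) * M g y) \<in> borel_measurable lborel" by measurable
  show "integrable lborel (\<lambda>y. e * hinge (G x y / e) * M g y)"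
    by (rule integrable_cong_AE_imp[OF Bochner_Integration.integrable_diff[OF i1 i2] meas AE])
  have "(LINT y|lborel. e * hinge (G x y / e) * M g y) =
      (LINT y|lborel. G x y * M ?f y - M ?f y * capped e x y)"
    by (rule integral_cong_AE[symmetric]) (use meas AE i1 i2 in auto)
  also have "\<dots> = (LINT y|lborel. G x y * M ?f y) - (LINT y|lborel. M ?f y * capped e x y)"
    by (rule Bochner_Integration.integral_diff[OF i1 i2])
  also have "(LINT y|lborel. G x y * M ?f y) = - g x"
    using fs_C2[OF f bf] \<zeta>(2)[of x] by (simp add: R_def)
  also have "(LINT y|lborel. M ?f y * capped e x y) = (LINT y|lborel. ?f y * M (capped e x) y)"
    by (rule green[OF f C2_capped[OF e] bf, symmetric])
  also have "\<dots> = (LINT y|lborel. - (g y * spread e x y))"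
  proof (rule Bochner_Integration.integral_cong[OF refl])
    fix y
    have "norm y \<le> R" if "spread e x y \<noteq> 0"
      using far[of y] spread_shell(2)[OF e that] by linarith
    then show "?f y * M (capped e x) y = - (g y * spread e x y)"
      using \<zeta>(2)[of y] by (cases "spread e x y = 0") (auto simp: spread_def)
  qed
  finally show "(LINT y|lborel. e * hinge (G x y / e) * M g y) = (LINT y|lborel. g y * spread e x y) - g x"
    by simp
qed

lemma integral_spread: "e > 0 \<Longrightarrow> (LINT y|lborel. spread e x y) = 1"
  using mean_value(2)[of e "\<lambda>_. 1" x] by (simp add: M_const)

text \<open>The shells have total mass 1 and move out of every bounded set as their level decreases,
  and far away the kernel with pole \<open>y\<close> is small.\<close>

lemma potential_spread_tendsto_0:
  assumes e: "e > 0"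
  shows "(\<lambda>n. LINT z|lborel. G y z * spread (e / Suc n) x z) \<longlonglongrightarrow> 0"
proof (rule LIMSEQ_I)
  fix r :: real assume r: "r > 0"
  have en: "e / Suc n > 0" for n using e by simp
  obtain R where R: "\<And>z. norm z \<ge> R \<Longrightarrow> G y z < r / 2" by (rule G_small_far[of "r / 2" y]) (use r in auto)
  \<comment> \<open>The truncation \<open>capped 1 x\<close> is a continuous positive lower bound
    for the kernel off its pole, so compactness of the ball yields a level that the shells with
    lower levels cannot reach inside it.\<close>
  have "\<exists>b>0. \<forall>z\<in>cball 0 R. b \<le> capped 1 x z"
  proof (cases "cball (0::real^'n) R = {}")
    case False
    then obtain z0 where "\<forall>z\<in>cball 0 R. capped 1 x z0 \<le> capped 1 x z"
      using continuous_attains_inf[OF compact_cball False continuous_on_capped[of 1]] by auto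
    then show ?thesis using capped_bounds(2)[of 1 x z0] by auto
  qed (auto intro: exI[of _ 1])
  then obtain b where b: "b > 0" "\<And>z. norm z \<le> R \<Longrightarrow> b \<le> capped 1 x z" by auto
  obtain N where N: "1 / Suc N < b / (2 * e)" using nat_approx_posE[of "b / (2 * e)"] b(1) e by auto
  show "\<exists>N. \<forall>n\<ge>N. norm ((LINT z|lborel. G y z * spread (e / Suc n) x z) - 0) < r"
  proof (intro exI allI impI)
    fix n assume n: "n \<ge> N"
    let ?d = "spread (e / Suc n) x"
    have "1 / Suc n \<le> 1 / Suc N" using n by (intro divide_left_mono) auto
    then have "1 / Suc n < b / (2 * e)" using N by linarith
    then have en2: "2 * (e / Suc n) < b" using e by (simp add: field_simps)
    have le: "G y z * ?d z \<le> r / 2 * ?d z" for z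
    proof (cases "?d z = 0")
      case False
      note sh = spread_shell[OF en False]
      have "norm z > R"
      proof (rule ccontr)
        assume "\<not> norm z > R"
        then have "b \<le> G x z" using b(2)[of z] capped_bounds(3)[of 1 z x] sh(1) by simp
        then show False using sh(3) en2 by linarith
      qed
      then show ?thesis using R[of z] spread_nonneg[OF en, of n x z] by (intro mult_right_mono) auto
    qed simp
    have "(LINT z|lborel. G y z * ?d z) \<le> (LINT z|lborel. r / 2 * ?d z)"
      by (rule integral_mono[OF integrable_G_Cc[OF Cc_spread[OF en]] integrable_mult_right[OF Cc_integrable[OF Cc_spread[OF en]]] le])
    also have "\<dots> = r / 2" using integral_spread[OF en] by simp
    finally have "(LINT z|lborel. G y z * ?d z) \<le> r / 2" .
    moreover have "(LINT z|lborel. G y z * ?d z) \<ge> 0"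
      by (rule Bochner_Integration.integral_nonneg) (intro mult_nonneg_nonneg G_nonneg spread_nonneg[OF en])
    ultimately show "norm ((LINT z|lborel. G y z * ?d z) - 0) < r" using r by simp
  qed
qed

text \<open>A capped kernel does not have bounded support, so the identity for \<Gamma> is applied
  to the difference of two caps, which agree where the kernel is below the smaller level. That level
  is then sent to 0.\<close>

lemma potential_spread:
  assumes e: "e > 0"
  shows "(LINT z|lborel. G y z * spread e x z) = capped e x y"
proof -
  define e' where "e' n = e / Suc n" for n
  have e': "e' n > 0" "e' n \<le> e" for n using e by (auto simp: e'_def field_simps)
  have eq: "(LINT z|lborel. G y z * spread e x z) =
      capped e x y - capped (e' n) x y + (LINT z|lborel. G y z * spread (e' n) x z)" for n
  proof -
    let ?\<phi> = "\<lambda>z. capped e x z - capped (e' n) x z"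
    have C2: "C2_on UNIV ?\<phi>" by (intro C2_on_diff C2_capped e e' open_UNIV)
    obtain R where R: "\<And>z. norm z \<ge> R \<Longrightarrow> G x z < e' n" by (rule G_small_far[OF e'(1)[of n], of x]) blast
    have "?\<phi> z = 0" if "norm z > max R (norm x)" for z
    proof -
      have "G x z < e' n" "z \<noteq> x" using R[of z] that by auto
      then show ?thesis using e'[of n] e by (simp add: capped_eq_G)
    qed
    then have b: "bounded {z. ?\<phi> z \<noteq> 0}"
      by (intro bounded_subset[OF bounded_cball[of 0 "max R (norm x)"]]) (auto simp: not_less[symmetric] simp del: max_less_iff_conj)
    have "- ?\<phi> y = (LINT z|lborel. G y z * M ?\<phi> z)" by (rule fs_C2[OF C2 b, symmetric])
    also have "\<dots> = (LINT z|lborel. G y z * spread (e' n) x z - G y z * spread e x z)"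
      by (simp add: M_diff[OF open_UNIV C2_capped[OF e] C2_capped[OF e'(1)]] spread_def algebra_simps)
    also have "\<dots> = (LINT z|lborel. G y z * spread (e' n) x z) - (LINT z|lborel. G y z * spread e x z)"
      by (intro Bochner_Integration.integral_diff integrable_G_Cc Cc_spread e e')
    finally show ?thesis by simp
  qed
  have "e' \<longlonglongrightarrow> 0"
    unfolding e'_def using LIMSEQ_Suc[OF lim_const_over_n[of e]] by simp
  then have "(\<lambda>n. capped (e' n) x y) \<longlonglongrightarrow> 0" by (rule capped_tendsto_0[OF e'(1)])
  moreover have "(\<lambda>n. LINT z|lborel. G y z * spread (e' n) x z) \<longlonglongrightarrow> 0"
    unfolding e'_def by (rule potential_spread_tendsto_0[OF e])
  ultimately have "(\<lambda>n. capped e x y - capped (e' n) x y + (LINT z|lborel. G y z * spread (e' n) x z))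
      \<longlonglongrightarrow> capped e x y - 0 + 0"
    by (intro tendsto_intros)
  then show ?thesis unfolding eq[symmetric] by (simp add: LIMSEQ_const_iff)
qed

end

section \<open>The potential of a bounded subsolution\<close>

lemma test_fun_Cc: "test_fun U \<phi> \<Longrightarrow> Cc \<phi>"
  unfolding Cc_def test_fun_def smooth_on_def
  by (metis Ck_on.simps(1) bounded_subset closure_subset compact_imp_bounded)

text \<open>The factor \<open>f\<close> is only measurable and locally bounded, because the
  potential is not known to be continuous.\<close>

lemma integral_moll_tendsto:
  fixes f \<psi> :: "real^'n::finite \<Rightarrow> real"
  assumes [measurable]: "f \<in> borel_measurable borel" and f: "\<And>K. compact K \<Longrightarrow> \<exists>B. \<forall>x\<in>K. \<bar>f x\<bar> \<le> B"
    and \<psi>: "Cc \<psi>"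
  shows "(\<lambda>n. LINT x|lborel. f x * moll (1 / Suc n) \<psi> x) \<longlonglongrightarrow> (LINT x|lborel. f x * \<psi> x)"
proof -
  have c: "continuous_on UNIV \<psi>" using \<psi> by (simp add: Cc_def)
  obtain R where R0: "\<And>x. norm x > R \<Longrightarrow> \<psi> x = 0" by (rule Cc_support[OF \<psi>]) blast
  let ?K = "cball (0::real^'n) (R + 1)"
  obtain B where B: "\<And>x. x \<in> ?K \<Longrightarrow> \<bar>f x\<bar> \<le> B" using f[OF compact_cball] by blast
  obtain B' where B': "\<And>x. \<bar>\<psi> x\<bar> \<le> B'" using Cc_bounded[OF \<psi>] by blast
  note Cc_measurable[OF \<psi>, measurable]
  have [measurable]: "moll (1 / real (Suc n)) \<psi> \<in> borel_measurable borel" for n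
    by (rule Cc_measurable[OF test_fun_Cc[OF test_fun_moll[OF _ c R0]]]) simp_all
  show ?thesis
  proof (rule integral_dominated_convergence[where w="\<lambda>x. indicator ?K x *\<^sub>R (B * B')"])
    show "integrable lborel (\<lambda>x. indicator ?K x *\<^sub>R (B * B'))"
      by (intro borel_integrable_compact compact_cball continuous_on_const)
    show "AE x in lborel. (\<lambda>n. f x * moll (1 / Suc n) \<psi> x) \<longlonglongrightarrow> f x * \<psi> x"
      by (intro AE_I2 tendsto_mult tendsto_const moll_tendsto c)
    show "AE x in lborel. norm (f x * moll (1 / Suc n) \<psi> x) \<le> indicator ?K x *\<^sub>R (B * B')" for n
    proof (rule AE_I2)
      fix x
      show "norm (f x * moll (1 / Suc n) \<psi> x) \<le> indicator ?K x *\<^sub>R (B * B')"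
      proof (cases "norm x \<le> R + 1")
        case True
        have "\<bar>moll (1 / Suc n) \<psi> x\<bar> \<le> B'" by (rule moll_bound[OF _ c B']) simp
        moreover have "\<bar>f x\<bar> \<le> B" using B True by simp
        ultimately have "\<bar>f x\<bar> * \<bar>moll (1 / Suc n) \<psi> x\<bar> \<le> B * B'"
          by (intro mult_mono) auto
        then show ?thesis using True by (simp add: abs_mult)
      next
        case False
        moreover have "1 / real (Suc n) \<le> 1" by simp
        ultimately have "norm x > R + 1 / Suc n" by linarith
        then have "moll (1 / Suc n) \<psi> x = 0" by (intro moll_support[where R=R] c R0) auto
        then show ?thesis using False by simp
      qed
    qed
  qed measurable
qed

locale bounded_subsolution = degenerate_operator_fs V A \<Gamma>
  for V :: "real^'n::finite \<Rightarrow> real" and A :: "real^'n \<Rightarrow> real^'n^'n" and \<Gamma> :: "real^'n \<Rightarrow> real^'n \<Rightarrow> real" +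
  fixes g :: "real^'n \<Rightarrow> real" and S :: real
  assumes g_C2: "C2_on UNIV g" and g_nonneg: "\<And>x. g x \<ge> 0" and g_le: "\<And>x. g x \<le> S"
    and Mg_nonneg: "\<And>x. M g x \<ge> 0"
begin

definition p :: "real^'n \<Rightarrow> real" where
  "p x = (LINT y|lborel. G x y * M g y)"

lemma measurable_Mg [measurable]: "M g \<in> borel_measurable borel"
  using continuous_on_M[OF g_C2] by (rule borel_measurable_continuous_onI)

lemma measurable_g [measurable]: "g \<in> borel_measurable borel"
  using C2_on_continuous[OF g_C2] by (rule borel_measurable_continuous_onI)

lemma mean_value_le:
  assumes e: "e > 0"
  shows "(LINT y|lborel. e * hinge (G x y / e) * M g y) \<le> S - g x"
proof -
  have i: "integrable lborel (\<lambda>y. g y * spread e x y)"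
    using Cc_integrable[OF Cc_mult[OF Cc_spread[OF e] C2_on_continuous[OF g_C2]]] by (simp add: mult.commute)
  have "(LINT y|lborel. g y * spread e x y) \<le> (LINT y|lborel. S * spread e x y)"
    by (rule integral_mono[OF i integrable_mult_right[OF Cc_integrable[OF Cc_spread[OF e]]]])
       (intro mult_right_mono g_le spread_nonneg e)
  also have "\<dots> = S" using integral_spread[OF e] by simp
  finally show ?thesis using mean_value(2)[OF e g_C2, of x] by simp
qed

text \<open>The mean value formula bounds the integrals against the truncated kernels by
  \<open>S - g x\<close>, uniformly in the level, and Fatou's lemma passes the bound to the full
  kernel.\<close>

lemma p_integrable: "integrable lborel (\<lambda>y. G x y * M g y)"
  and p_le: "p x \<le> S - g x"
proof -
  define q where "q n y = 1 / Suc n * hinge (G x y / (1 / Suc n)) * M g y" for n y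
  have q_nonneg: "q n y \<ge> 0" for n y
    unfolding q_def by (intro mult_nonneg_nonneg[OF scaled_hinge_bounds(1)] Mg_nonneg) (auto simp: G_nonneg)
  have [measurable]: "q n \<in> borel_measurable borel" for n
    unfolding q_def[abs_def] by measurable
  have lim: "(\<lambda>n. q n y) \<longlonglongrightarrow> G x y * M g y" for y
    unfolding q_def by (intro tendsto_mult scaled_hinge_tendsto tendsto_const G_nonneg)
  have Sg: "S - g x \<ge> 0" using g_le[of x] by simp
  have le: "(\<integral>\<^sup>+y. ennreal (q n y) \<partial>lborel) \<le> ennreal (S - g x)" for n
  proof -
    have "integrable lborel (q n)" unfolding q_def[abs_def] by (rule mean_value(1)[OF _ g_C2]) simp
    then have "(\<integral>\<^sup>+y. ennreal (q n y) \<partial>lborel) = ennreal (LINT y|lborel. q n y)"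
      by (rule nn_integral_eq_integral) (simp add: q_nonneg)
    also have "\<dots> \<le> ennreal (S - g x)"
      unfolding q_def by (intro ennreal_leI mean_value_le) simp
    finally show ?thesis .
  qed
  have "(\<integral>\<^sup>+y. ennreal (G x y * M g y) \<partial>lborel) = (\<integral>\<^sup>+y. liminf (\<lambda>n. ennreal (q n y)) \<partial>lborel)"
    by (intro nn_integral_cong lim_imp_Liminf[symmetric] tendsto_ennrealI lim) simp
  also have "\<dots> \<le> liminf (\<lambda>n. \<integral>\<^sup>+y. ennreal (q n y) \<partial>lborel)"
    by (rule nn_integral_liminf) measurable
  also have "\<dots> \<le> liminf (\<lambda>n. ennreal (S - g x))"
    by (rule Liminf_mono) (simp add: le)
  also have "\<dots> = ennreal (S - g x)" by (simp add: Liminf_const)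
  finally have *: "(\<integral>\<^sup>+y. ennreal (G x y * M g y) \<partial>lborel) \<le> ennreal (S - g x)" .
  then show int: "integrable lborel (\<lambda>y. G x y * M g y)"
    by (intro integrableI_nonneg) (auto simp: G_nonneg Mg_nonneg intro: le_less_trans)
  have "ennreal (p x) \<le> ennreal (S - g x)"
    unfolding p_def using * nn_integral_eq_integral[OF int] by (simp add: G_nonneg Mg_nonneg)
  then show "p x \<le> S - g x" using Sg by simp
qed

lemma p_nonneg: "p x \<ge> 0"
  unfolding p_def by (rule Bochner_Integration.integral_nonneg) (simp add: G_nonneg Mg_nonneg)

lemma p_le_S: "p x \<le> S"
  using p_le[of x] g_nonneg[of x] by simp

text \<open>As the shells escape to infinity, the deficit in the mean value formula grows to the
  full potential: the averages of \<open>g\<close> see \<open>g x\<close> plus everything that the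
  density adds.\<close>

lemma integral_spread_tendsto: "(\<lambda>n. LINT y|lborel. g y * spread (1 / Suc n) x y) \<longlonglongrightarrow> g x + p x"
proof -
  have "(\<lambda>n. LINT y|lborel. 1 / Suc n * hinge (G x y / (1 / Suc n)) * M g y) \<longlonglongrightarrow> p x"
    unfolding p_def
  proof (rule integral_dominated_convergence[OF _ _ p_integrable])
    show "AE y in lborel. (\<lambda>n. 1 / Suc n * hinge (G x y / (1 / Suc n)) * M g y) \<longlonglongrightarrow> G x y * M g y"
      by (intro AE_I2 tendsto_mult[OF scaled_hinge_tendsto] tendsto_const G_nonneg)
    show "AE y in lborel. norm (1 / Suc n * hinge (G x y / (1 / Suc n)) * M g y) \<le> G x y * M g y" for n
    proof (rule AE_I2)
      fix y
      have "0 \<le> 1 / Suc n * hinge (G x y / (1 / Suc n))" "1 / Suc n * hinge (G x y / (1 / Suc n)) \<le> G x y"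
        by (rule scaled_hinge_bounds; simp add: G_nonneg)+
      then show "norm (1 / Suc n * hinge (G x y / (1 / Suc n)) * M g y) \<le> G x y * M g y"
        using Mg_nonneg[of y] by (simp add: abs_mult mult_right_mono del: times_divide_eq_left)
    qed
  qed measurable
  then have "(\<lambda>n. (LINT y|lborel. g y * spread (1 / Suc n) x y) - g x) \<longlonglongrightarrow> p x"
    by (subst (asm) mean_value(2)[OF _ g_C2]) simp
  from tendsto_add[OF this tendsto_const[of "g x"]] show ?thesis by (simp add: add.commute)
qed

lemma measurable_p [measurable]: "p \<in> borel_measurable borel"
proof -
  have m: "(\<lambda>z. (\<lambda>(x, y). G x y) z * M g (snd z)) \<in> borel_measurable (lborel \<Otimes>\<^sub>M lborel)"
    using measurable_G2 by measurable
  have "(\<lambda>x. LINT y|lborel. G x y * M g y) \<in> borel_measurable lborel"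
    by (rule lborel.borel_measurable_lebesgue_integral) (use m in \<open>simp add: case_prod_beta'\<close>)
  then show ?thesis unfolding p_def[abs_def] by simp
qed

lemma integrable_p_Cc: assumes "Cc \<psi>" shows "integrable lborel (\<lambda>x. p x * \<psi> x)"
proof (rule Bochner_Integration.integrable_bound[OF integrable_mult_right[OF Cc_integrable[OF assms], of S]])
  note Cc_measurable[OF assms, measurable]
  show "(\<lambda>x. p x * \<psi> x) \<in> borel_measurable lborel" by measurable
  show "AE x in lborel. norm (p x * \<psi> x) \<le> norm (S * \<psi> x)"
    using p_nonneg order_trans[OF p_le_S abs_ge_self] by (intro AE_I2) (auto simp: abs_mult intro!: mult_right_mono)
qed

text \<open>Symmetry of the kernel turns the pairing of the potential with \<psi> into a pairing of
  the density with the potential of \<psi>.\<close>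

lemma potential_Fubini:
  assumes \<psi>: "Cc \<psi>"
  shows "(LINT x|lborel. p x * \<psi> x) = (LINT y|lborel. M g y * (LINT x|lborel. G y x * \<psi> x))"
proof -
  let ?F = "\<lambda>x y. G x y * M g y * \<psi> x"
  note Cc_measurable[OF \<psi>, measurable]
  have m: "(\<lambda>z. (\<lambda>(x, y). G x y) z * M g (snd z) * \<psi> (fst z)) \<in> borel_measurable (lborel \<Otimes>\<^sub>M lborel)"
    using measurable_G2 by measurable
  have abs\<psi>: "Cc (\<lambda>x. \<bar>\<psi> x\<bar>)" using \<psi> by (auto simp: Cc_def intro: continuous_intros)
  have "integrable (lborel \<Otimes>\<^sub>M lborel) (\<lambda>(x, y). ?F x y)"
  proof (rule lborel_pair.Fubini_integrable)
    show "(\<lambda>(x, y). ?F x y) \<in> borel_measurable (lborel \<Otimes>\<^sub>M lborel)"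
      using m by (simp add: case_prod_beta')
    have "(LINT y|lborel. norm (?F x y)) = p x * \<bar>\<psi> x\<bar>" for x
      by (simp add: abs_mult G_nonneg Mg_nonneg p_def)
    then show "integrable lborel (\<lambda>x. LINT y|lborel. norm (case (x, y) of (x, y) \<Rightarrow> ?F x y))"
      using integrable_p_Cc[OF abs\<psi>] by simp
    show "AE x in lborel. integrable lborel (\<lambda>y. case (x, y) of (x, y) \<Rightarrow> ?F x y)"
      using p_integrable by (intro AE_I2) simp
  qed
  from lborel_pair.Fubini_integral[OF this]
  have "(LINT y|lborel. LINT x|lborel. ?F x y) = (LINT x|lborel. p x * \<psi> x)"
    by (simp add: p_def)
  moreover have "(LINT x|lborel. ?F x y) = M g y * (LINT x|lborel. G y x * \<psi> x)" for y
  proof -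
    have "(\<lambda>x. ?F x y) = (\<lambda>x. M g y * (G y x * \<psi> x))"
      by (intro ext) (simp add: G_sym[of _ y])
    then show ?thesis by simp
  qed
  ultimately show ?thesis by simp
qed

lemma integrable_g_Cc: "Cc \<psi> \<Longrightarrow> integrable lborel (\<lambda>x. g x * \<psi> x)"
  using Cc_integrable[OF Cc_mult[OF _ C2_on_continuous[OF g_C2]]] by (simp add: mult.commute)

lemma integral_gp:
  assumes "Cc \<psi>"
  shows "integrable lborel (\<lambda>x. (g x + p x) * \<psi> x)"
    and "(LINT x|lborel. (g x + p x) * \<psi> x) = (LINT x|lborel. g x * \<psi> x) + (LINT x|lborel. p x * \<psi> x)"
  unfolding distrib_right
  using Bochner_Integration.integrable_add[OF integrable_g_Cc[OF assms] integrable_p_Cc[OF assms]]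
    Bochner_Integration.integral_add[OF integrable_g_Cc[OF assms] integrable_p_Cc[OF assms]] by auto

text \<open>The potential of \<open>M \<phi>\<close> is \<open>- \<phi>\<close>, so pairing
  \<open>p\<close> with \<open>M \<phi>\<close> cancels the contribution of \<open>g\<close> given
  by Green's formula.\<close>

lemma weakly_harmonic:
  assumes \<phi>: "C2_on UNIV \<phi>" and b: "bounded {x. \<phi> x \<noteq> 0}"
  shows "(LINT x|lborel. (g x + p x) * M \<phi> x) = 0"
proof -
  have "(LINT x|lborel. g x * M \<phi> x) = (LINT x|lborel. M g x * \<phi> x)"
    using green[OF \<phi> g_C2 b] by (simp add: mult.commute)
  moreover have "(LINT x|lborel. p x * M \<phi> x) = - (LINT x|lborel. M g x * \<phi> x)"
    by (simp add: potential_Fubini[OF Cc_M[OF \<phi> b]] fs_C2[OF \<phi> b])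
  ultimately show ?thesis by (simp add: integral_gp(2)[OF Cc_M[OF \<phi> b]])
qed

section \<open>The function g + p is constant\<close>

definition T :: "(real^'n \<Rightarrow> real) \<Rightarrow> real" where
  "T \<phi> = (LINT x|lborel. (g x + p x) * \<phi> x)"

text \<open>Boundedness of g + p by \<open>S\<close> gives order zero: the sup norm, which is the
  seminorm of index 0, is enough.\<close>

lemma distribution_T: "distribution_on UNIV T"
  unfolding distribution_on_def
proof (intro conjI allI impI)
  fix \<phi> \<psi> :: "real^'n \<Rightarrow> real" and a b :: real
  assume "test_fun UNIV \<phi>" "test_fun UNIV \<psi>"
  then have i: "integrable lborel (\<lambda>x. (g x + p x) * \<phi> x)" "integrable lborel (\<lambda>x. (g x + p x) * \<psi> x)"
    using integral_gp(1) test_fun_Cc by blast+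
  have "(g x + p x) * (a * \<phi> x + b * \<psi> x) = a * ((g x + p x) * \<phi> x) + b * ((g x + p x) * \<psi> x)" for x
    by (simp add: algebra_simps)
  then show "T (\<lambda>x. a * \<phi> x + b * \<psi> x) = a * T \<phi> + b * T \<psi>"
    unfolding T_def by (simp only: Bochner_Integration.integral_add[OF integrable_mult_right[OF i(1)] integrable_mult_right[OF i(2)]] integral_mult_right_zero)
next
  fix K :: "(real^'n) set" assume K: "compact K \<and> K \<subseteq> UNIV"
  have "\<bar>T \<phi>\<bar> \<le> (S * measure lborel K) * test_seminorm 0 \<phi>" if \<phi>: "test_fun K \<phi>" for \<phi>
  proof -
    have C: "Cc \<phi>" using \<phi> by (rule test_fun_Cc)
    have supp: "\<phi> x = 0" if "x \<notin> K" for x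
      using \<phi> that closure_subset[of "{x. \<phi> x \<noteq> 0}"] by (auto simp: test_fun_def)
    obtain B where B: "\<And>x. \<bar>\<phi> x\<bar> \<le> B" using Cc_bounded[OF C] by blast
    define s where "s = (SUP x. \<bar>\<phi> x\<bar>)"
    have s: "\<bar>\<phi> x\<bar> \<le> s" for x
      unfolding s_def by (rule cSUP_upper) (use B in \<open>auto intro: bdd_aboveI[of _ B]\<close>)
    have semi: "test_seminorm 0 \<phi> = s" by (simp add: test_seminorm_def s_def)
    have Kfin: "emeasure lborel K < \<infinity>" using K emeasure_compact_finite by blast
    have Ks: "K \<in> sets lborel" using K by (simp add: borel_compact)
    have "\<bar>T \<phi>\<bar> \<le> (LINT x|lborel. \<bar>(g x + p x) * \<phi> x\<bar>)"
      unfolding T_def by (rule integral_abs_bound)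
    also have "\<dots> \<le> (LINT x|lborel. S * s * indicator K x)"
    proof (rule integral_mono)
      show "integrable lborel (\<lambda>x. \<bar>(g x + p x) * \<phi> x\<bar>)" using integral_gp(1)[OF C] by simp
      show "integrable lborel (\<lambda>x. S * s * indicator K x)"
        using Ks Kfin by (intro integrable_mult_right integrable_real_indicator) auto
      show "\<bar>(g x + p x) * \<phi> x\<bar> \<le> S * s * indicator K x" for x
        using supp[of x] s[of x] g_nonneg[of x] p_nonneg[of x] p_le[of x]
        by (cases "x \<in> K") (auto simp: abs_mult intro!: mult_mono)
    qed
    also have "\<dots> = S * measure lborel K * s" by simp
    finally show ?thesis by (simp add: semi)
  qed
  then show "\<exists>C m. \<forall>\<phi>. test_fun K \<phi> \<longrightarrow> \<bar>T \<phi>\<bar> \<le> C * test_seminorm m \<phi>" by blast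
qed

text \<open>Duality moves the whole operator onto the test function: \<open>T\<close> is evaluated
  at \<open>M\<close> of \<phi> / V, the two minus signs cancelling. As \<open>T\<close> is an
  integral, C^2 regularity of \<phi> / V is enough for \<open>weakly_harmonic\<close>.\<close>

lemma dist_Lop_T:
  assumes "test_fun UNIV \<phi>" shows "dist_Lop_minus V A 0 T \<phi> = 0"
proof -
  define \<psi> where "\<psi> x = 1 / V x * \<phi> x" for x
  have \<phi>: "C2_on UNIV \<phi>" using assms by (auto simp: test_fun_def smooth_on_def intro: C2_on_Ck)
  have \<psi>: "C2_on UNIV \<psi>" unfolding \<psi>_def by (intro C2_on_mult C2_on_inverse_V \<phi> open_UNIV)
  have b: "bounded {x. \<psi> x \<noteq> 0}"
    by (rule bounded_subset[of "{x. \<phi> x \<noteq> 0}"]) (use test_fun_Cc[OF assms] in \<open>auto simp: Cc_def \<psi>_def\<close>)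
  define W where "W i j x = c i j x * partial i \<psi> x" for i j x
  have W1: "C1_on UNIV (W i j)" for i j
    unfolding W_def[abs_def] using C1_c C2_onD(2)[OF \<psi>] by (rule C1_on_mult)
  have bp: "bounded {x. partial i \<psi> x \<noteq> 0}" for i
    using Cc_partial[OF C2_on_C1[OF \<psi>] b] by (simp add: Cc_def)
  have bW: "bounded {x. W i j x \<noteq> 0}" for i j
    by (rule bounded_subset[OF bp[of i]]) (auto simp: W_def)
  have i: "integrable lborel (\<lambda>x. (g x + p x) * partial j (W i j) x)" for i j
    by (rule integral_gp(1)[OF Cc_partial[OF W1 bW]])
  have "dist_Lop_minus V A 0 T \<phi> = (\<Sum>i\<in>UNIV. \<Sum>j\<in>UNIV. T (partial j (W i j)))"
    by (simp add: dist_Lop_minus_def dist_mult_def dist_sum_def dist_partial_def sum_negf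
        W_def[abs_def] c_def \<psi>_def[abs_def])
  also have "\<dots> = (LINT x|lborel. (\<Sum>i\<in>UNIV. \<Sum>j\<in>UNIV. (g x + p x) * partial j (W i j) x))"
    unfolding T_def
    by (simp only: Bochner_Integration.integral_sum[OF i] Bochner_Integration.integral_sum[OF Bochner_Integration.integrable_sum[OF i]])
  also have "(\<lambda>x. \<Sum>i\<in>UNIV. \<Sum>j\<in>UNIV. (g x + p x) * partial j (W i j) x) = (\<lambda>x. (g x + p x) * M \<psi> x)"
  proof
    fix x
    have "flux j \<psi> = (\<lambda>y. \<Sum>i\<in>UNIV. W i j y)" for j
      by (intro ext) (simp add: flux_def W_def c_sym[of j])
    then have "partial j (flux j \<psi>) x = (\<Sum>i\<in>UNIV. partial j (W i j) x)" for j
      using W1 by (simp add: partial_sum C1_on_def)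
    then show "(\<Sum>i\<in>UNIV. \<Sum>j\<in>UNIV. (g x + p x) * partial j (W i j) x) = (g x + p x) * M \<psi> x"
      unfolding M_def by (subst sum.swap) (simp add: sum_distrib_left)
  qed
  also have "(LINT x|lborel. (g x + p x) * M \<psi> x) = 0" by (rule weakly_harmonic[OF \<psi> b])
  finally show ?thesis .
qed

text \<open>Hypoellipticity supplies a smooth representative \<open>h\<close>. Mollification extends
  its defining identity from test functions to \<open>Cc\<close>, which yields \<open>h >= 0\<close>
  and \<open>M h = 0\<close>, so the Liouville property applies to a solution bounded below.\<close>

lemma weakly_constant:
  assumes hyp: "hypoelliptic_assumption V A" and liou: "liouville_property V A"
  obtains k where "\<And>\<psi>. Cc \<psi> \<Longrightarrow> (LINT x|lborel. (g x + p x) * \<psi> x) = k * (LINT x|lborel. \<psi> x)"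
proof -
  have "hypoelliptic_on UNIV (dist_Lop_minus V A 0)"
    using hyp by (auto simp: hypoelliptic_assumption_def)
  moreover have "smooth_on UNIV (\<lambda>x::real^'n. 0::real)" by (simp add: smooth_on_def Ck_on_const)
  moreover have "dist_eq_fun UNIV (dist_Lop_minus V A 0 T) (\<lambda>x. 0)"
    by (simp add: dist_eq_fun_def dist_Lop_T)
  ultimately obtain h where h: "smooth_on UNIV h" "dist_eq_fun UNIV T h"
    using distribution_T unfolding hypoelliptic_on_def by blast
  have hC2: "C2_on UNIV h" using h(1) by (auto simp: smooth_on_def intro: C2_on_Ck)
  have hc: "continuous_on UNIV h" by (rule C2_on_continuous[OF hC2])
  have [measurable]: "h \<in> borel_measurable borel" using hc by (rule borel_measurable_continuous_onI)
  have test: "(LINT x|lborel. (g x + p x) * \<phi> x) = (LINT x|lborel. h x * \<phi> x)" if "test_fun UNIV \<phi>" for \<phi>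
  proof -
    note Cc_measurable[OF test_fun_Cc[OF that], measurable]
    have "T \<phi> = (LINT x|lebesgue. h x * \<phi> x)" using h(2) that by (simp add: dist_eq_fun_def)
    also have "\<dots> = (LINT x|lborel. h x * \<phi> x)" by (rule integral_completion) measurable
    finally show ?thesis by (simp add: T_def)
  qed
  have eq: "(LINT x|lborel. (g x + p x) * \<psi> x) = (LINT x|lborel. h x * \<psi> x)" if \<psi>: "Cc \<psi>" for \<psi>
  proof (rule LIMSEQ_unique)
    obtain R where R0: "\<And>x. norm x > R \<Longrightarrow> \<psi> x = 0" by (rule Cc_support[OF \<psi>]) blast
    have "\<bar>g x + p x\<bar> \<le> S" for x using g_nonneg[of x] p_nonneg[of x] p_le[of x] by simp
    then show "(\<lambda>n. LINT x|lborel. (g x + p x) * moll (1 / Suc n) \<psi> x) \<longlonglongrightarrow> (LINT x|lborel. (g x + p x) * \<psi> x)"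
      by (intro integral_moll_tendsto \<psi>) auto
    have "test_fun UNIV (moll (1 / Suc n) \<psi>)" for n
      using \<psi> by (intro test_fun_moll[where R=R] R0) (auto simp: Cc_def)
    then show "(\<lambda>n. LINT x|lborel. (g x + p x) * moll (1 / Suc n) \<psi> x) \<longlonglongrightarrow> (LINT x|lborel. h x * \<psi> x)"
      using integral_moll_tendsto[OF _ continuous_on_compact_bounded[OF continuous_on_subset[OF hc subset_UNIV]] \<psi>] by (simp add: test)
  qed
  have h_nonneg: "h x \<ge> 0" for x
  proof (rule fundamental_lemma_nonneg[OF open_UNIV hc _ UNIV_I])
    fix \<phi> :: "real^'n \<Rightarrow> real" and K assume \<phi>: "C2_on UNIV \<phi>" "\<And>x. \<phi> x \<ge> 0" "compact K" "\<And>x. x \<notin> K \<Longrightarrow> \<phi> x = 0"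
    have "Cc \<phi>" by (rule Cc_subset[OF C2_on_continuous[OF \<phi>(1)] compact_imp_bounded[OF \<phi>(3)] \<phi>(4)])
    from eq[OF this] show "(LINT x|lborel. h x * \<phi> x) \<ge> 0"
      using g_nonneg p_nonneg \<phi>(2) by (metis (no_types, lifting) Bochner_Integration.integral_nonneg add_nonneg_nonneg mult_nonneg_nonneg)
  qed
  have Mh: "M h x = 0" for x
  proof (rule fundamental_lemma_zero[OF open_UNIV continuous_on_M[OF hC2] _ UNIV_I])
    fix \<phi> :: "real^'n \<Rightarrow> real" and K assume \<phi>: "C2_on UNIV \<phi>" "compact K" "\<And>x. x \<notin> K \<Longrightarrow> \<phi> x = 0"
    have b: "bounded {x. \<phi> x \<noteq> 0}"
      by (rule bounded_subset[OF compact_imp_bounded[OF \<phi>(2)]]) (use \<phi>(3) in auto)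
    have "(LINT x|lborel. M h x * \<phi> x) = (LINT x|lborel. h x * M \<phi> x)"
      using green[OF \<phi>(1) hC2 b] by (simp add: mult.commute)
    also have "\<dots> = 0" using eq[OF Cc_M[OF \<phi>(1) b]] weakly_harmonic[OF \<phi>(1) b] by simp
    finally show "(LINT x|lborel. M h x * \<phi> x) = 0" .
  qed
  have "L_harmonic_on V A UNIV h" using h(1) Mh by (simp add: L_harmonic_on_def Lop_eq_M)
  moreover have "bdd_below (range h)" using h_nonneg by (intro bdd_belowI[of _ 0]) auto
  ultimately have "h constant_on UNIV" using liou by (auto simp: liouville_property_def)
  then obtain k where k: "\<And>x. h x = k" by (auto simp: constant_on_def)
  show ?thesis by (rule that[of k]) (simp add: eq k)
qed

text \<open>The bound fails possibly at the pole, where the cap is 3/2 \<open>e\<close> but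
  \<open>G x x = 0\<close>; hence almost everywhere.\<close>

lemma capped_Mg_bounds:
  assumes "e > 0"
  shows "AE y in lborel. norm (M g y * capped e x y) \<le> G x y * M g y"
  using AE_lborel_singleton[of x]
proof eventually_elim
  case (elim y)
  then show ?case
    using capped_bounds(2)[OF assms, of x y] capped_bounds(3)[OF assms, of y x] Mg_nonneg[of y] 
    by (simp add: abs_mult mult.commute[of "M g y"] mult_right_mono)
qed

text \<open>Use the shell densities as \<psi>: the averages of g + p equal k at every level. Those
  of \<open>p\<close> are the integrals of the density against the capped kernel, by
  \<open>potential_Fubini\<close> and \<open>potential_spread\<close>, and tend to 0; those of
  \<open>g\<close> tend to \<open>g x + p x\<close>.\<close>

lemma constant_everywhere:
  assumes k: "\<And>\<psi>. Cc \<psi> \<Longrightarrow> (LINT x|lborel. (g x + p x) * \<psi> x) = k * (LINT x|lborel. \<psi> x)"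
  shows "g x + p x = k"
proof -
  have e: "1 / real (Suc n) > 0" for n by simp
  have eq: "(LINT y|lborel. g y * spread (1 / Suc n) x y) = k - (LINT y|lborel. M g y * capped (1 / Suc n) x y)" for n
  proof -
    have "k = (LINT y|lborel. g y * spread (1 / Suc n) x y) + (LINT y|lborel. p y * spread (1 / Suc n) x y)"
      using k[OF Cc_spread[OF e]] integral_gp(2)[OF Cc_spread[OF e]] integral_spread[OF e] by simp
    also have "(LINT y|lborel. p y * spread (1 / Suc n) x y) = (LINT y|lborel. M g y * capped (1 / Suc n) x y)"
      by (simp only: potential_Fubini[OF Cc_spread[OF e]] potential_spread[OF e])
    finally show ?thesis by simp
  qed
  have "(\<lambda>n. LINT y|lborel. M g y * capped (1 / Suc n) x y) \<longlonglongrightarrow> (LINT y|(lborel :: (real^'n) measure). 0 :: real)"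
  proof (rule integral_dominated_convergence[OF _ _ p_integrable])
    show "AE y in lborel. (\<lambda>n. M g y * capped (1 / Suc n) x y) \<longlonglongrightarrow> 0"
    proof (rule AE_I2)
      fix y
      have "(\<lambda>n. capped (1 / Suc n) x y) \<longlonglongrightarrow> 0"
        by (rule capped_tendsto_0[OF e LIMSEQ_Suc[OF lim_1_over_n]])
      from tendsto_mult[OF tendsto_const this] show "(\<lambda>n. M g y * capped (1 / Suc n) x y) \<longlonglongrightarrow> 0" by simp
    qed
    show "AE y in lborel. norm (M g y * capped (1 / Suc n) x y) \<le> G x y * M g y" for n
      by (rule capped_Mg_bounds[OF e])
    show "(\<lambda>y. M g y * capped (1 / Suc n) x y) \<in> borel_measurable lborel" for n
      using measurable_capped[OF e[of n]] by measurable
  qed simp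
  then have "(\<lambda>n. k - (LINT y|lborel. M g y * capped (1 / Suc n) x y)) \<longlonglongrightarrow> k - 0"
    by (intro tendsto_intros) simp
  then show ?thesis
    using integral_spread_tendsto[of x] unfolding eq by (simp add: LIMSEQ_unique)
qed

text \<open>If \<open>g\<close> vanishes at the centre and on the shell, the mean value formula
  shows that the part of the kernel above the cap contributes nothing, so the singularity disappears
  from the potential at \<open>x\<close>.\<close>

lemma p_eq_capped:
  assumes e: "e > 0" and g0: "g x = 0" "\<And>y. spread e x y \<noteq> 0 \<Longrightarrow> g y = 0"
  shows "p x = (LINT y|lborel. M g y * capped e x y)"
proof -
  have i1: "integrable lborel (\<lambda>y. M g y * capped e x y)"
    by (rule Bochner_Integration.integrable_bound[OF p_integrable[of x]])
       (use measurable_capped[OF e] capped_Mg_bounds[OF e] G_nonneg Mg_nonneg in \<open>auto simp: abs_mult\<close>)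
  have "(\<lambda>y. g y * spread e x y) = (\<lambda>y. 0)" using g0(2) by (intro ext) auto
  then have 0: "(LINT y|lborel. e * hinge (G x y / e) * M g y) = 0"
    using mean_value(2)[OF e g_C2, of x] g0(1) by simp
  have "p x = (LINT y|lborel. e * hinge (G x y / e) * M g y + M g y * capped e x y)"
    unfolding p_def
  proof (rule integral_cong_AE)
    show "AE y in lborel. G x y * M g y = e * hinge (G x y / e) * M g y + M g y * capped e x y"
      using AE_lborel_singleton[of x] by eventually_elim (simp add: capped_def algebra_simps)
    show "(\<lambda>y. e * hinge (G x y / e) * M g y + M g y * capped e x y) \<in> borel_measurable lborel"
      using measurable_capped[OF e] by measurable
  qed measurable
  also have "\<dots> = (LINT y|lborel. e * hinge (G x y / e) * M g y) + (LINT y|lborel. M g y * capped e x y)"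
    by (rule Bochner_Integration.integral_add[OF mean_value(1)[OF e g_C2] i1])
  finally show ?thesis by (simp add: 0)
qed

end

section \<open>Cones and coverings\<close>

text \<open>Each set meets a selected one of at least half its radius. This is combinatorial:
  bounded radii replace any use of measure or metric, and the enlargement is left to the
  caller.\<close>

lemma vitali_selection:
  fixes B :: "'a \<Rightarrow> 'b set" and r :: "'a \<Rightarrow> real"
  assumes r: "\<And>x. x \<in> E \<Longrightarrow> 0 < r x \<and> r x \<le> b" and ne: "\<And>x. x \<in> E \<Longrightarrow> B x \<noteq> {}"
  obtains C where "C \<subseteq> E" "\<And>x y. x \<in> C \<Longrightarrow> y \<in> C \<Longrightarrow> x \<noteq> y \<Longrightarrow> B x \<inter> B y = {}"
    "\<And>x. x \<in> E \<Longrightarrow> \<exists>c\<in>C. B x \<inter> B c \<noteq> {} \<and> r x \<le> 2 * r c"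
proof -
  \<comment> \<open>The last clause is preserved by unions of chains. A maximal member meets every
    set of the family, for otherwise a missed set of nearly largest radius could be added.\<close>
  define F where "F = {C. C \<subseteq> E \<and> (\<forall>x\<in>C. \<forall>y\<in>C. x \<noteq> y \<longrightarrow> B x \<inter> B y = {}) \<and>
    (\<forall>x\<in>E. (\<exists>c\<in>C. B x \<inter> B c \<noteq> {}) \<longrightarrow> (\<exists>c\<in>C. B x \<inter> B c \<noteq> {} \<and> r x \<le> 2 * r c))}"
  have "\<exists>C\<in>F. \<forall>X\<in>F. C \<subseteq> X \<longrightarrow> X = C"
  proof (rule subset_Zorn')
    fix \<C> assume ch: "subset.chain F \<C>"
    have CF: "C \<in> F" if "C \<in> \<C>" for C using ch that by (auto simp: subset.chain_def)
    have tot: "C \<subseteq> D \<or> D \<subseteq> C" if "C \<in> \<C>" "D \<in> \<C>" for C D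
      using ch that unfolding subset_chain_def by blast
    have "\<Union>\<C> \<subseteq> E" using CF by (fastforce simp: F_def)
    moreover have "B x \<inter> B y = {}" if xy: "x \<in> \<Union>\<C>" "y \<in> \<Union>\<C>" "x \<noteq> y" for x y
    proof -
      obtain C D where "C \<in> \<C>" "D \<in> \<C>" "x \<in> C" "y \<in> D" using xy(1,2) by blast
      then obtain X where "X \<in> \<C>" "x \<in> X" "y \<in> X" using tot by blast
      then show ?thesis using CF[of X] xy(3) unfolding F_def by blast
    qed
    moreover have "\<exists>c\<in>\<Union>\<C>. B x \<inter> B c \<noteq> {} \<and> r x \<le> 2 * r c"
      if x: "x \<in> E" "\<exists>c\<in>\<Union>\<C>. B x \<inter> B c \<noteq> {}" for x
    proof -
      obtain C c where "C \<in> \<C>" "c \<in> C" "B x \<inter> B c \<noteq> {}" using x(2) by blast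
      then show ?thesis using CF[of C] x(1) unfolding F_def by blast
    qed
    ultimately show "\<Union>\<C> \<in> F" unfolding F_def by blast
  qed
  then obtain C where C: "C \<in> F" and max: "\<And>X. X \<in> F \<Longrightarrow> C \<subseteq> X \<Longrightarrow> X = C" by blast
  have CE: "C \<subseteq> E" and dis: "\<And>x y. x \<in> C \<Longrightarrow> y \<in> C \<Longrightarrow> x \<noteq> y \<Longrightarrow> B x \<inter> B y = {}"
    and cov: "\<And>x. x \<in> E \<Longrightarrow> \<exists>c\<in>C. B x \<inter> B c \<noteq> {} \<Longrightarrow> \<exists>c\<in>C. B x \<inter> B c \<noteq> {} \<and> r x \<le> 2 * r c"
    using C unfolding F_def by auto
  define E' where "E' = {x\<in>E. \<forall>c\<in>C. B x \<inter> B c = {}}"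
  have "E' = {}"
  proof (rule ccontr)
    assume "E' \<noteq> {}"
    then obtain x1 where x1: "x1 \<in> E'" by blast
    define \<sigma> where "\<sigma> = Sup (r ` E')"
    have bd: "bdd_above (r ` E')" using r by (intro bdd_aboveI[of _ b]) (auto simp: E'_def)
    have \<sigma>: "r x \<le> \<sigma>" if "x \<in> E'" for x unfolding \<sigma>_def using bd that by (intro cSup_upper) auto
    have "\<sigma> > 0" using \<sigma>[OF x1] r[of x1] x1 by (auto simp: E'_def)
    then have "\<sigma> / 2 < \<sigma>" by simp
    then obtain x0 where x0: "x0 \<in> E'" "\<sigma> / 2 < r x0"
      using less_cSup_iff[of "r ` E'" "\<sigma> / 2"] bd x1 unfolding \<sigma>_def by auto
    have x0E: "x0 \<in> E" "\<And>c. c \<in> C \<Longrightarrow> B x0 \<inter> B c = {}" using x0(1) by (auto simp: E'_def)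
    have "insert x0 C \<in> F"
      unfolding F_def
    proof (intro CollectI conjI ballI impI)
      show "insert x0 C \<subseteq> E" using CE x0E(1) by auto
      show "B x \<inter> B y = {}" if "x \<in> insert x0 C" "y \<in> insert x0 C" "x \<noteq> y" for x y
        using that dis x0E(2) by blast
      fix x assume x: "x \<in> E" "\<exists>c\<in>insert x0 C. B x \<inter> B c \<noteq> {}"
      show "\<exists>c\<in>insert x0 C. B x \<inter> B c \<noteq> {} \<and> r x \<le> 2 * r c"
      proof (cases "x \<in> E'")
        case True
        then have "B x \<inter> B x0 \<noteq> {}" using x(2) by (auto simp: E'_def)
        moreover have "r x \<le> 2 * r x0" using \<sigma>[OF True] x0(2) by simp
        ultimately show ?thesis by blast
      next
        case False
        then have "\<exists>c\<in>C. B x \<inter> B c \<noteq> {}" using x(1) by (auto simp: E'_def)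
        from cov[OF x(1) this] show ?thesis by blast
      qed
    qed
    from max[OF this] have "x0 \<in> C" by auto
    then show False using x0E(2)[of x0] ne[OF x0E(1)] by auto
  qed
  then have "\<exists>c\<in>C. B x \<inter> B c \<noteq> {} \<and> r x \<le> 2 * r c" if "x \<in> E" for x
    using cov[OF that] that by (auto simp: E'_def)
  then show ?thesis using that[OF CE dis] by blast
qed

lemma dyadic_scale:
  fixes t R :: real assumes "0 < t" "t < R"
  obtains n where "R / 2 ^ Suc n \<le> t" "t < R / 2 ^ n"
proof -
  obtain m where "(1/2) ^ m < t / R" using real_arch_pow_inv[of "t / R" "1/2"] assms by auto
  then have "R / 2 ^ m \<le> t" using assms by (simp add: power_one_over field_simps)
  then have ex: "\<exists>m. R / 2 ^ m \<le> t" by blast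
  define m where "m = (LEAST m. R / 2 ^ m \<le> t)"
  have m: "R / 2 ^ m \<le> t" unfolding m_def by (rule LeastI_ex[OF ex])
  then have "m \<noteq> 0" using assms by (intro notI) simp
  then obtain n where n: "m = Suc n" using not0_implies_Suc by blast
  have "\<not> R / 2 ^ n \<le> t" using not_less_Least[of n "\<lambda>m. R / 2 ^ m \<le> t"] n unfolding m_def by simp
  then show ?thesis using that[of n] m n by simp
qed

section \<open>The quasi-metric given by the reciprocal of the kernel\<close>

context degenerate_operator_fs
begin

abbreviation \<gamma> :: "real^'n \<Rightarrow> real^'n \<Rightarrow> real" where "\<gamma> \<equiv> gam \<Gamma>"

lemma \<gamma>_sym: "\<gamma> x y = \<gamma> y x"
  by (simp add: gam_G G_sym)

lemma \<gamma>_self [simp]: "\<gamma> x x = 0"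
  by (simp add: gam_def)

lemma \<gamma>_pos: "x \<noteq> y \<Longrightarrow> \<gamma> x y > 0"
  using G_pos by (simp add: gam_G)

lemma \<gamma>_nonneg: "\<gamma> x y \<ge> 0"
  using G_nonneg by (simp add: gam_G)

lemma G_\<gamma>: "G x y = 1 / \<gamma> x y"
  by (simp add: gam_G)

lemma measurable_\<gamma> [measurable]: "\<gamma> x \<in> borel_measurable borel"
proof -
  have "(\<lambda>y. 1 / G x y) \<in> borel_measurable borel" by measurable
  then show ?thesis by (simp add: gam_G[abs_def])
qed

text \<open>The constant is 1/\<theta>. If the inequality failed, \<open>z\<close> would lie in both
  balls of radius \<theta> times the distance of \<open>x\<close> and \<open>y\<close>, whereas
  \<open>x\<close> is not in the ball around \<open>y\<close> whose radius is that distance.\<close>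

lemma quasi_metric:
  assumes "ball_separation \<Gamma>"
  obtains K where "K \<ge> 1" "\<And>x y z. \<gamma> x y \<le> K * max (\<gamma> x z) (\<gamma> z y)"
proof -
  obtain \<theta> where \<theta>: "0 < \<theta>" "\<theta> < 1"
    "\<And>x y r. r > 0 \<Longrightarrow> x \<notin> Gball \<Gamma> y r \<Longrightarrow> Gball \<Gamma> x (\<theta> * r) \<inter> Gball \<Gamma> y (\<theta> * r) = {}"
    using assms by (auto simp: ball_separation_def)
  have "\<gamma> x y \<le> 1 / \<theta> * max (\<gamma> x z) (\<gamma> z y)" for x y z
  proof (rule ccontr)
    assume "\<not> ?thesis"
    then have "1 / \<theta> * max (\<gamma> x z) (\<gamma> z y) < \<gamma> x y" by (simp only: not_le)
    from mult_strict_left_mono[OF this \<theta>(1)]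
    have *: "max (\<gamma> x z) (\<gamma> z y) < \<theta> * \<gamma> x y" using \<theta>(1) by simp
    have "0 \<le> max (\<gamma> x z) (\<gamma> z y)" using \<gamma>_nonneg[of x z] by simp
    then have pos: "\<gamma> x y > 0" using * \<theta>(1) by (metis le_less_trans zero_less_mult_pos)
    have "z \<in> Gball \<Gamma> x (\<theta> * \<gamma> x y) \<inter> Gball \<Gamma> y (\<theta> * \<gamma> x y)"
      using * \<gamma>_sym[of z y] by (simp add: Gball_def)
    then have "x \<in> Gball \<Gamma> y (\<gamma> x y)" using \<theta>(3)[OF pos, of x y] by blast
    then show False using \<gamma>_sym[of x y] by (simp add: Gball_def)
  qed
  then show ?thesis using that[of "1 / \<theta>"] \<theta>(1,2) by auto
qed

end

section \<open>Decay along cones and coverings of superlevel sets\<close>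

context bounded_subsolution
begin

text \<open>The potential at the centre of a cone ball only involves the capped kernel, and all
  these capped kernels are dominated by a multiple of \<open>G 0\<close>, whose integral against the
  density is finite.\<close>

lemma cone_potential_tendsto_0:
  assumes K: "K \<ge> 1" "\<And>x y z. \<gamma> x y \<le> K * max (\<gamma> x z) (\<gamma> z y)"
    and a: "a > 0" and R: "\<And>j. R j > 0" "\<And>j. a * \<gamma> 0 (z j) \<le> R j"
    and z: "filterlim (\<lambda>j. norm (z j)) at_top sequentially"
    and g0: "\<And>j y. \<gamma> (z j) y < R j \<Longrightarrow> g y = 0"
  shows "(\<lambda>j. p (z j)) \<longlonglongrightarrow> 0"
proof -
  \<comment> \<open>At this level the shell, where \<open>G (z j) y\<close> exceeds
    \<open>e j\<close>, lies in the cone ball of radius \<open>R j\<close>, on which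
    \<open>g\<close> vanishes.\<close>
  define e where "e j = 1 / R j" for j :: nat
  have e: "e j > 0" for j using R(1) by (simp add: e_def)
  have p_eq: "p (z j) = (LINT y|lborel. M g y * capped (e j) (z j) y)" for j
  proof (rule p_eq_capped[OF e])
    show "g (z j) = 0" using g0[of j "z j"] R(1) by simp
    fix y assume "spread (e j) (z j) y \<noteq> 0"
    from spread_shell[OF e this] have "z j \<noteq> y" "1 / R j < 1 / \<gamma> (z j) y" by (auto simp: e_def G_\<gamma>)
    then have "\<gamma> (z j) y < R j" using \<gamma>_pos[of "z j" y] R(1)[of j] by (simp add: field_simps)
    then show "g y = 0" by (rule g0)
  qed
  \<comment> \<open>Two regimes. If \<open>y\<close> is at most \<open>K\<close> times as far from 0
    as \<open>z j\<close>, the cap 3 / (2 R j) is at most 3 K / (2 a) times \<open>G 0 y\<close>. If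
    \<open>y\<close> is farther, the quasi-triangle inequality compares the kernels with factor
    \<open>K\<close>.\<close>
  define C where "C = max K (3 * K / (2 * a))"
  have bound: "capped (e j) (z j) y \<le> C * G 0 y" if "y \<noteq> 0" for j y
  proof (cases "\<gamma> 0 y \<le> K * \<gamma> 0 (z j)")
    case True
    have y: "\<gamma> 0 y > 0" using \<gamma>_pos that by simp
    have "a * \<gamma> 0 y \<le> a * (K * \<gamma> 0 (z j))" using True a by simp
    also have "\<dots> = K * (a * \<gamma> 0 (z j))" by simp
    also have "\<dots> \<le> K * R j" using R(2)[of j] K(1) by (intro mult_left_mono) auto
    finally have "1 / R j \<le> K / (a * \<gamma> 0 y)" using y a R(1)[of j] by (simp add: field_simps)
    then have "3/2 * e j \<le> 3 * K / (2 * a) * G 0 y" by (simp add: e_def G_\<gamma> field_simps)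
    also have "\<dots> \<le> C * G 0 y" using G_nonneg by (intro mult_right_mono) (auto simp: C_def)
    finally show ?thesis using capped_bounds(1)[OF e, of j "z j" y] by linarith
  next
    case False
    have le: "\<gamma> 0 y \<le> K * max (\<gamma> 0 (z j)) (\<gamma> (z j) y)" by (rule K(2))
    then have le': "\<gamma> 0 y \<le> K * \<gamma> (z j) y" using False by (auto simp: max_def split: if_splits)
    have "y \<noteq> z j" using le' \<gamma>_pos[of 0 y] that by auto
    then have "G (z j) y \<le> K * G 0 y"
      using le' \<gamma>_pos[of 0 y] \<gamma>_pos[of "z j" y] that by (simp add: G_\<gamma> field_simps)
    also have "\<dots> \<le> C * G 0 y" using G_nonneg by (intro mult_right_mono) (auto simp: C_def)
    finally show ?thesis using capped_bounds(3)[OF e[of j] \<open>y \<noteq> z j\<close>] by linarith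
  qed
  have Gz: "(\<lambda>j. G 0 (z j)) \<longlonglongrightarrow> 0"
    by (rule filterlim_compose[OF G_tendsto_0]) (use z in \<open>simp add: filterlim_at_infinity_conv_norm_at_top\<close>)
  \<comment> \<open>At \<open>z j = 0\<close> the convention \<open>G 0 0 = 0\<close> would make the
    bound on \<open>e j\<close> false.\<close>
  have "eventually (\<lambda>j. norm (z j) > 0) sequentially"
    using z by (simp only: filterlim_at_top_dense)
  then have "eventually (\<lambda>j. z j \<noteq> 0) sequentially" by eventually_elim auto
  then have ev: "eventually (\<lambda>j. e j \<le> 1 / a * G 0 (z j)) sequentially"
  proof eventually_elim
    case (elim j)
    then show ?case using R(1,2)[of j] a \<gamma>_pos[of 0 "z j"] by (simp add: e_def G_\<gamma> field_simps)
  qed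
  have e0: "e \<longlonglongrightarrow> 0"
  proof (rule tendsto_sandwich[OF _ ev tendsto_const])
    show "(\<lambda>j. 1 / a * G 0 (z j)) \<longlonglongrightarrow> 0" using tendsto_mult_left[OF Gz, of "1 / a"] by simp
  qed (use e in \<open>auto intro!: always_eventually less_imp_le\<close>)
  have "(\<lambda>j. LINT y|lborel. M g y * capped (e j) (z j) y) \<longlonglongrightarrow> (LINT y|(lborel :: (real^'n) measure). 0 :: real)"
  proof (rule integral_dominated_convergence[where w="\<lambda>y. C * (G 0 y * M g y)"])
    show "integrable lborel (\<lambda>y. C * (G 0 y * M g y))" by (intro integrable_mult_right p_integrable)
    show "AE y in lborel. (\<lambda>j. M g y * capped (e j) (z j) y) \<longlonglongrightarrow> 0"
    proof (rule AE_I2)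
      fix y
      have "(\<lambda>j. capped (e j) (z j) y) \<longlonglongrightarrow> 0" by (rule capped_tendsto_0[OF e e0])
      from tendsto_mult[OF tendsto_const this] show "(\<lambda>j. M g y * capped (e j) (z j) y) \<longlonglongrightarrow> 0" by simp
    qed
    show "AE y in lborel. norm (M g y * capped (e j) (z j) y) \<le> C * (G 0 y * M g y)" for j
      using AE_lborel_singleton[of 0]
    proof eventually_elim
      case (elim y)
      have "M g y * capped (e j) (z j) y \<le> M g y * (C * G 0 y)"
        using bound[OF elim] Mg_nonneg by (rule mult_left_mono)
      then show ?case
        using Mg_nonneg[of y] capped_bounds(2)[OF e, of j "z j" y] by (simp add: abs_mult mult_ac)
    qed
    show "(\<lambda>y. M g y * capped (e j) (z j) y) \<in> borel_measurable lborel" for j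
      using measurable_capped[OF e] by measurable
  qed simp
  then show ?thesis by (simp add: p_eq)
qed

text \<open>The ball is intersected with the annulus of points about as far from 0 as
  \<open>x\<close>. There \<open>G 0 y\<close> is comparable to the reciprocal of \<gamma> 0 x, so
  masses can be measured by parts of the integral \<open>p 0\<close>, and a given \<open>y\<close>
  is concerned by few dyadic annuli of centres.\<close>

definition near_ball :: "real \<Rightarrow> real^'n \<Rightarrow> real \<Rightarrow> (real^'n) set" where
  "near_ball K x r = {y. \<gamma> 0 x / K \<le> \<gamma> 0 y \<and> \<gamma> 0 y \<le> K * \<gamma> 0 x \<and> \<gamma> x y < r}"

lemma near_ball_sets [measurable]: "near_ball K x r \<in> sets borel"
  unfolding near_ball_def by measurable

lemma near_ball_integrable: "integrable lborel (\<lambda>y. indicator (near_ball K x r) y * (G w y * M g y))"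
  using integrable_mult_indicator[OF _ p_integrable[of w], of "near_ball K x r"] by simp

text \<open>For points whose distance to 0 is not comparable to that of \<open>x\<close>, the kernel
  with pole \<open>x\<close> is at most a multiple of \<open>G 0\<close>, and the dominating
  function tends to 0 pointwise as \<open>x\<close> recedes. Dominated convergence gives a threshold
  that depends only on \<gamma> 0 x.\<close>

lemma potential_mostly_near:
  assumes K: "K \<ge> 1" "\<And>x y z. \<gamma> x y \<le> K * max (\<gamma> x z) (\<gamma> z y)" and k: "k > 0"
  obtains R0 where "R0 > 0" "\<And>x r. \<gamma> 0 x \<ge> R0 \<Longrightarrow> r > K\<^sup>2 * \<gamma> 0 x \<Longrightarrow>
    p x \<le> k + (LINT y|lborel. indicator (near_ball K x r) y * (G x y * M g y))"
proof -
  \<comment> \<open>Outer points satisfy \<open>G x y <= K * G 0 y\<close>, inner points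
    \<open>G x y <= K / R\<close>, both by the quasi-triangle inequality with \<open>R\<close>
    standing for \<gamma> 0 x.\<close>
  define b where "b R y = (if \<gamma> 0 y > K * R then K * G 0 y else if \<gamma> 0 y < R / K then K / R else 0) * M g y"
    for R y
  have [measurable]: "b R \<in> borel_measurable borel" for R
    unfolding b_def[abs_def] by measurable
  have Kp: "K > 0" using K(1) by simp
  have b_le: "norm (b R y) \<le> K * (G 0 y * M g y)" if "R > 0" "y \<noteq> 0" for R y
  proof -
    have y: "\<gamma> 0 y > 0" using \<gamma>_pos that by simp
    have "K / R \<le> K * G 0 y" if "\<gamma> 0 y < R / K"
    proof -
      have "K * \<gamma> 0 y < R" using that Kp by (simp add: field_simps)
      moreover have "\<gamma> 0 y \<le> K * \<gamma> 0 y" using K(1) y by simp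
      ultimately have "\<gamma> 0 y \<le> R" by simp
      then show ?thesis using y Kp by (simp add: G_\<gamma> frac_le)
    qed
    then have "K / R * M g y \<le> K * G 0 y * M g y" if "\<gamma> 0 y < R / K"
      using that mult_right_mono[OF _ Mg_nonneg] by blast
    then show ?thesis
      using Mg_nonneg[of y] G_nonneg[of 0 y] Kp \<open>R > 0\<close>
      by (auto simp: b_def abs_mult mult.assoc)
  qed
  have b_int: "integrable lborel (b R)" if "R > 0" for R
  proof (rule Bochner_Integration.integrable_bound[OF integrable_mult_right[OF p_integrable[of 0], of K]])
    show "AE y in lborel. norm (b R y) \<le> norm (K * (G 0 y * M g y))"
      using AE_lborel_singleton[of 0]
    proof eventually_elim
      case (elim y)
      show ?case using b_le[OF that elim] by simp
    qed
  qed measurable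
  have "((\<lambda>R. LINT y|lborel. b R y) \<longlongrightarrow> (LINT y|(lborel :: (real^'n) measure). 0 :: real)) at_top"
  proof (rule integral_dominated_convergence_at_top[where w="\<lambda>y. K * (G 0 y * M g y)"])
    show "integrable lborel (\<lambda>y. K * (G 0 y * M g y))" by (intro integrable_mult_right p_integrable)
    show "eventually (\<lambda>R. AE y in lborel. norm (b R y) \<le> K * (G 0 y * M g y)) at_top"
      using eventually_gt_at_top[of 0]
    proof eventually_elim
      case (elim R)
      show ?case using AE_lborel_singleton[of 0] by eventually_elim (rule b_le[OF elim])
    qed
    show "AE y in lborel. ((\<lambda>R. b R y) \<longlongrightarrow> 0) at_top"
    proof (rule AE_I2)
      fix y
      have "((\<lambda>R. K / R * M g y) \<longlongrightarrow> 0) at_top"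
        by (intro tendsto_mult_left_zero tendsto_divide_0[OF tendsto_const] filterlim_at_top_imp_at_infinity filterlim_ident)
      moreover have "eventually (\<lambda>R. norm (b R y) \<le> K / R * M g y) at_top"
        using eventually_gt_at_top[of "max 0 (\<gamma> 0 y)"]
      proof eventually_elim
        case (elim R)
        then have R: "0 < R" "\<gamma> 0 y < R" by auto
        then have "R \<le> K * R" using K(1) by simp
        then have "\<not> \<gamma> 0 y > K * R" using R by linarith
        then show ?case using Mg_nonneg[of y] Kp R by (auto simp: b_def abs_mult)
      qed
      ultimately show "((\<lambda>R. b R y) \<longlongrightarrow> 0) at_top" by (rule Lim_null_comparison[rotated])
    qed
  qed measurable
  then have "eventually (\<lambda>R. dist (LINT y|lborel. b R y) 0 < k) at_top"
    using k tendstoD by fastforce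
  then obtain R1 where R1: "\<And>R. R \<ge> R1 \<Longrightarrow> (LINT y|lborel. b R y) < k"
    unfolding eventually_at_top_linorder by (auto simp: abs_less_iff)
  show ?thesis
  proof (rule that[of "max R1 1"])
    fix x r assume x: "\<gamma> 0 x \<ge> max R1 1" and r: "r > K\<^sup>2 * \<gamma> 0 x"
    let ?R = "\<gamma> 0 x"
    have R: "?R > 0" using x by linarith
    have le: "G x y * M g y \<le> b ?R y + indicator (near_ball K x r) y * (G x y * M g y)" for y
    proof -
      consider "\<gamma> 0 y > K * ?R" | "\<gamma> 0 y < ?R / K" "\<not> \<gamma> 0 y > K * ?R" | "?R / K \<le> \<gamma> 0 y" "\<gamma> 0 y \<le> K * ?R" by linarith
      then show ?thesis
      proof cases
        case 1
        have "\<gamma> 0 y \<le> K * max ?R (\<gamma> x y)" by (rule K(2))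
        then have le: "\<gamma> 0 y \<le> K * \<gamma> x y" using 1 by (auto simp: max_def split: if_splits)
        have y: "\<gamma> 0 y > 0" using 1 R Kp by (meson le_less_trans less_le_trans mult_pos_pos less_trans)
        then have "\<gamma> x y > 0" using le Kp by (meson less_le_trans zero_less_mult_pos)
        then have "G x y \<le> K * G 0 y" using le y by (simp add: G_\<gamma> field_simps)
        then have "G x y * M g y \<le> b ?R y" using 1 Mg_nonneg[of y] by (simp add: b_def mult_right_mono)
        then show ?thesis using Mg_nonneg[of y] G_nonneg[of x y] by (simp add: add_increasing2)
      next
        case 2
        have "?R \<le> K * max (\<gamma> 0 y) (\<gamma> y x)" by (rule K(2))
        moreover have "K * \<gamma> 0 y < ?R" using 2(1) Kp by (simp add: field_simps)
        ultimately have le: "?R \<le> K * \<gamma> x y" by (auto simp: max_def \<gamma>_sym[of y x] split: if_splits)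
        then have "\<gamma> x y > 0" using R Kp by (meson less_le_trans zero_less_mult_pos)
        then have "G x y \<le> K / ?R" using le R by (simp add: G_\<gamma> field_simps)
        from mult_right_mono[OF this Mg_nonneg[of y]]
        have "G x y * M g y \<le> b ?R y" using 2 by (simp add: b_def)
        then show ?thesis using Mg_nonneg[of y] G_nonneg[of x y] by (simp add: add_increasing2)
      next
        case 3
        \<comment> \<open>Two uses of \<open>K\<close> explain why the radius must exceed K^2 times
          \<gamma> 0 x: the whole comparable annulus then lies in the ball.\<close>
        have "\<gamma> x y \<le> K * max (\<gamma> x 0) (\<gamma> 0 y)" by (rule K(2))
        also have "\<dots> \<le> K * (K * ?R)"
        proof (rule mult_left_mono)
          have "?R \<le> K * ?R" using K(1) R by simp
          then show "max (\<gamma> x 0) (\<gamma> 0 y) \<le> K * ?R" using 3(2) by (simp add: \<gamma>_sym[of x 0])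
        qed (use Kp in simp)
        finally have "\<gamma> x y < r" using r by (simp add: power2_eq_square mult.assoc)
        then have "y \<in> near_ball K x r" using 3 by (simp add: near_ball_def)
        then show ?thesis using 3 by (simp add: b_def)
      qed
    qed
    have "p x \<le> (LINT y|lborel. b ?R y + indicator (near_ball K x r) y * (G x y * M g y))"
      unfolding p_def
      by (rule integral_mono[OF p_integrable Bochner_Integration.integrable_add[OF b_int[OF R] near_ball_integrable] le])
    also have "\<dots> = (LINT y|lborel. b ?R y) + (LINT y|lborel. indicator (near_ball K x r) y * (G x y * M g y))"
      by (rule Bochner_Integration.integral_add[OF b_int[OF R] near_ball_integrable])
    finally show "p x \<le> k + (LINT y|lborel. indicator (near_ball K x r) y * (G x y * M g y))"
      using R1[of ?R] x by simp
  qed simp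
qed

text \<open>If the near masses at all dyadic scales were smaller than the stated power, summing the
  dyadic shells around \<open>x\<close> would make the near part of the potential too small.\<close>

lemma large_mass_radius:
  assumes K: "K \<ge> 1" "\<And>x y z. \<gamma> x y \<le> K * max (\<gamma> x z) (\<gamma> z y)" and k: "k > 0" and s: "s > 1"
  obtains R0 C where "R0 > 0" "C > 0" "\<And>x. p x \<ge> k \<Longrightarrow> \<gamma> 0 x \<ge> R0 \<Longrightarrow> \<exists>r. 0 < r \<and> r \<le> 2 * K\<^sup>2 * \<gamma> 0 x \<and>
    (r / \<gamma> 0 x) powr s \<le> C * (LINT y|lborel. indicator (near_ball K x r) y * (G 0 y * M g y))"
proof -
  obtain R0 where R0: "R0 > 0" "\<And>x r. \<gamma> 0 x \<ge> R0 \<Longrightarrow> r > K\<^sup>2 * \<gamma> 0 x \<Longrightarrow>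
    p x \<le> k / 2 + (LINT y|lborel. indicator (near_ball K x r) y * (G x y * M g y))"
    using potential_mostly_near[OF K, of "k / 2"] k by auto
  \<comment> \<open>A mass of order 2^(-n s) within distance 2^-n, divided by that distance, leaves
    a multiple of \<open>q ^ n\<close>.\<close>
  define q where "q = (1/2) powr (s - 1)"
  have q: "0 < q" "q < 1"
    using s powr_less_mono2_neg[of "-(s-1)" 1 2] by (auto simp: q_def powr_divide powr_minus_divide)
  \<comment> \<open>Chosen so that the series 2 \<tau> q^n sums to k/4, below the share k/2 that the
    near part must carry.\<close>
  define \<tau> where "\<tau> = k * (1 - q) / 8"
  have \<tau>: "\<tau> > 0" using k q by (simp add: \<tau>_def)
  have Kp: "K > 0" using K(1) by simp
  \<comment> \<open>The radius is 2 K^2 \<gamma> 0 x / 2^n, which accounts for the numerator; the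
    denominator collects the mass bound \<tau>, the radius and the comparison of \<open>G 0\<close>
    with the reciprocal of \<gamma> 0 x.\<close>
  define C where "C = (2 * K\<^sup>2) powr s / (2 * K * \<tau>)"
  have C: "C > 0" using Kp \<tau> by (simp add: C_def)
  show ?thesis
  proof (rule that[OF R0(1) C])
    fix x assume px: "p x \<ge> k" and x: "\<gamma> 0 x \<ge> R0"
    define R where "R = \<gamma> 0 x"
    have R: "R > 0" using x R0(1) by (simp add: R_def)
    \<comment> \<open>The factor 2 provides the strict inequality demanded by
      \<open>potential_mostly_near\<close>.\<close>
    define R' where "R' = 2 * K\<^sup>2 * R"
    have R': "R' > 0" "R' > K\<^sup>2 * R" using R Kp by (auto simp: R'_def)
    define N where "N n = near_ball K x (R' / 2 ^ n)" for n :: nat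
    have [measurable]: "N n \<in> sets borel" for n by (simp add: N_def)
    have N_G0: "1 \<le> K * R * G 0 y" if "y \<in> N n" for y n
    proof -
      have le: "R / K \<le> \<gamma> 0 y" "\<gamma> 0 y \<le> K * R" using that by (auto simp: N_def near_ball_def R_def)
      have "0 < R / K" using R Kp by simp
      then have "0 < \<gamma> 0 y" using le(1) by linarith
      then show ?thesis using le(2) by (simp add: G_\<gamma>)
    qed
    have le_G0: "indicator (N n) y * M g y \<le> K * R * (indicator (N n) y * (G 0 y * M g y))" for n y
      using mult_right_mono[OF N_G0 Mg_nonneg, of y n y] by (cases "y \<in> N n") (auto simp: mult_ac)
    have intN: "integrable lborel (\<lambda>y. indicator (N n) y * M g y)" for n
    proof (rule Bochner_Integration.integrable_bound)
      show "integrable lborel (\<lambda>y. K * R * (indicator (N n) y * (G 0 y * M g y)))"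
        unfolding N_def by (intro integrable_mult_right near_ball_integrable)
      show "AE y in lborel. norm (indicator (N n) y * M g y) \<le> norm (K * R * (indicator (N n) y * (G 0 y * M g y)))"
      proof (rule AE_I2)
        fix y
        have "norm (indicator (N n) y * M g y) = indicator (N n) y * M g y"
          using Mg_nonneg[of y] by (simp add: abs_mult)
        also note le_G0
        also note abs_ge_self
        finally show "norm (indicator (N n) y * M g y) \<le> norm (K * R * (indicator (N n) y * (G 0 y * M g y)))" by simp
      qed
    qed measurable
    have "\<exists>n. \<tau> * (R' / 2 ^ n) * q ^ n \<le> (LINT y|lborel. indicator (N n) y * M g y)"
    proof (rule ccontr)
      assume "\<not> ?thesis"
      then have small: "(LINT y|lborel. indicator (N n) y * M g y) \<le> \<tau> * (R' / 2 ^ n) * q ^ n" for n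
        by (meson not_le less_imp_le)
      \<comment> \<open>On the shell between R' / 2^(n+1) and R' / 2^n the kernel is at most 2^(n+1)
        / R'; \<open>h n\<close> uses this bound on the full near ball.\<close>
      define h where "h n y = 2 ^ Suc n / R' * (indicator (N n) y * M g y)" for n y
      have h_nonneg: "h n y \<ge> 0" for n y using R'(1) Mg_nonneg by (simp add: h_def)
      have [measurable]: "h n \<in> borel_measurable borel" for n unfolding h_def[abs_def] by measurable
      have h_int: "(\<integral>\<^sup>+y. ennreal (h n y) \<partial>lborel) \<le> ennreal (2 * \<tau> * q ^ n)" for n
      proof -
        have "integrable lborel (h n)" unfolding h_def[abs_def] by (intro integrable_mult_right intN)
        then have "(\<integral>\<^sup>+y. ennreal (h n y) \<partial>lborel) = ennreal (LINT y|lborel. h n y)"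
          by (rule nn_integral_eq_integral) (simp add: h_nonneg)
        also have "(LINT y|lborel. h n y) = 2 ^ Suc n / R' * (LINT y|lborel. indicator (N n) y * M g y)"
          unfolding h_def by simp
        also have "\<dots> \<le> 2 ^ Suc n / R' * (\<tau> * (R' / 2 ^ n) * q ^ n)"
          using small R'(1) by (intro mult_left_mono) auto
        also have "\<dots> = 2 * \<tau> * q ^ n" using R'(1) by simp
        finally show ?thesis by (simp add: ennreal_leI)
      qed
      \<comment> \<open>At \<open>y = x\<close> the left side is 0 by the convention for
        \<open>G\<close>, so only points at positive distance need a shell.\<close>
      have pt: "ennreal (indicator (N 0) y * (G x y * M g y)) \<le> (\<Sum>n. ennreal (h n y))" for y
      proof (cases "y \<in> N 0 \<and> y \<noteq> x")
        case True
        have \<gamma>: "0 < \<gamma> x y" "\<gamma> x y < R'" using True \<gamma>_pos[of x y] by (auto simp: N_def near_ball_def)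
        obtain n where n: "R' / 2 ^ Suc n \<le> \<gamma> x y" "\<gamma> x y < R' / 2 ^ n" using dyadic_scale[OF \<gamma>] .
        have "G x y \<le> 2 ^ Suc n / R'" using n(1) \<gamma>(1) R'(1) by (simp add: G_\<gamma> field_simps)
        moreover have "y \<in> N n" using True n(2) by (auto simp: N_def near_ball_def)
        ultimately have "indicator (N 0) y * (G x y * M g y) \<le> h n y"
          using True mult_right_mono[OF _ Mg_nonneg[of y], of "G x y" "2 ^ Suc n / R'"] by (simp add: h_def)
        then have "ennreal (indicator (N 0) y * (G x y * M g y)) \<le> (\<Sum>n\<in>{n}. ennreal (h n y))"
          by (simp add: ennreal_leI)
        also have "\<dots> \<le> (\<Sum>n. ennreal (h n y))" by (rule sum_le_suminf) auto
        finally show ?thesis .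
      qed auto
      have "(LINT y|lborel. indicator (N 0) y * (G x y * M g y)) \<ge> k / 2"
        using R0(2)[OF x, of R'] R'(2) px by (simp add: N_def R_def)
      then have "ennreal (k / 2) \<le> ennreal (LINT y|lborel. indicator (N 0) y * (G x y * M g y))"
        by (rule ennreal_leI)
      also have "\<dots> = (\<integral>\<^sup>+y. ennreal (indicator (N 0) y * (G x y * M g y)) \<partial>lborel)"
        unfolding N_def
        by (rule nn_integral_eq_integral[symmetric, OF near_ball_integrable]) (simp add: G_nonneg Mg_nonneg)
      also have "\<dots> \<le> (\<integral>\<^sup>+y. (\<Sum>n. ennreal (h n y)) \<partial>lborel)" by (intro nn_integral_mono pt)
      also have "\<dots> = (\<Sum>n. \<integral>\<^sup>+y. ennreal (h n y) \<partial>lborel)" by (rule nn_integral_suminf) measurable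
      also have "\<dots> \<le> (\<Sum>n. ennreal (2 * \<tau> * q ^ n))" by (intro suminf_le h_int) auto
      also have "\<dots> = ennreal (2 * \<tau> * (1 / (1 - q)))"
      proof (rule suminf_ennreal_eq)
        show "(\<lambda>n. 2 * \<tau> * q ^ n) sums (2 * \<tau> * (1 / (1 - q)))"
          by (rule sums_mult[OF geometric_sums]) (use q in simp)
      qed (use q \<tau> in simp)
      also have "2 * \<tau> * (1 / (1 - q)) = k / 4" using q by (simp add: \<tau>_def field_simps)
      finally show False using k by simp
    qed
    then obtain n where n: "\<tau> * (R' / 2 ^ n) * q ^ n \<le> (LINT y|lborel. indicator (N n) y * M g y)" by blast
    let ?J = "LINT y|lborel. indicator (N n) y * (G 0 y * M g y)"
    define t where "t = (1/2) ^ n * q ^ n"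
    have "(LINT y|lborel. indicator (N n) y * M g y) \<le> (LINT y|lborel. K * R * (indicator (N n) y * (G 0 y * M g y)))"
      by (rule integral_mono[OF intN _ le_G0]) (unfold N_def, intro integrable_mult_right near_ball_integrable)
    also have "\<dots> = K * R * ?J" by simp
    finally have "\<tau> * (R' / 2 ^ n) * q ^ n \<le> K * R * ?J" using n by linarith
    then have "K * R * (2 * K * \<tau> * t) \<le> K * R * ?J"
      by (simp add: R'_def t_def power2_eq_square power_one_over field_simps)
    then have tJ: "2 * K * \<tau> * t \<le> ?J" using Kp R by simp
    have "(R' / 2 ^ n / R) powr s = (2 * K\<^sup>2 * (1/2) ^ n) powr s"
      using R by (simp add: R'_def power_one_over)
    also have "\<dots> = (2 * K\<^sup>2) powr s * ((1/2) ^ n) powr s" using Kp by (simp add: powr_mult)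
    also have "((1/2::real) ^ n) powr s = t"
    proof -
      have "((1/2::real) ^ n) powr s = ((1/2) ^ n) powr (1 + (s - 1))" by simp
      also have "\<dots> = (1/2) ^ n * ((1/2) ^ n) powr (s - 1)" by (subst powr_add) simp
      also have "((1/2::real) ^ n) powr (s - 1) = q ^ n"
        unfolding q_def by (simp add: powr_realpow[symmetric] powr_powr mult.commute)
      finally show ?thesis by (simp add: t_def)
    qed
    also have "(2 * K\<^sup>2) powr s * t = C * (2 * K * \<tau> * t)" using Kp \<tau> by (simp add: C_def)
    also have "\<dots> \<le> C * ?J" using tJ C by (intro mult_left_mono) auto
    finally have fin: "(R' / 2 ^ n / R) powr s \<le> C * ?J" .
    have "R' / 2 ^ n \<le> R'" using R'(1) by (simp add: divide_le_eq)
    then show "\<exists>r. 0 < r \<and> r \<le> 2 * K\<^sup>2 * \<gamma> 0 x \<and>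
        (r / \<gamma> 0 x) powr s \<le> C * (LINT y|lborel. indicator (near_ball K x r) y * (G 0 y * M g y))"
      using R'(1) fin by (intro exI[of _ "R' / 2 ^ n"]) (auto simp: R'_def R_def N_def)
  qed
qed

text \<open>Selected balls of one annulus are disjoint, and only boundedly many annuli have near
  balls through a given \<open>y\<close>. Adding up the mass estimates therefore counts each point
  at most \<open>L\<close> times, and the sum of the powers is at most C L p(0).\<close>

lemma superlevel_p_bounded:
  assumes K: "K \<ge> 1" "\<And>x y z. \<gamma> x y \<le> K * max (\<gamma> x z) (\<gamma> z y)" and k: "k > 0" and s: "s > 1"
  shows "p_bounded \<Gamma> s {x. p x \<ge> k}"
proof -
  obtain R0 C where R0: "R0 > 0" and C: "C > 0"
    and rad: "\<And>x. p x \<ge> k \<Longrightarrow> \<gamma> 0 x \<ge> R0 \<Longrightarrow> \<exists>r. 0 < r \<and> r \<le> 2 * K\<^sup>2 * \<gamma> 0 x \<and>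
      (r / \<gamma> 0 x) powr s \<le> C * (LINT y|lborel. indicator (near_ball K x r) y * (G 0 y * M g y))"
    by (rule large_mass_radius[OF K k s]) blast
  have Kp: "K > 0" using K(1) by simp
  define E where "E = {x. p x \<ge> k \<and> \<gamma> 0 x \<ge> R0}"
  define J where "J x r = (LINT y|lborel. indicator (near_ball K x r) y * (G 0 y * M g y))" for x r
  have "\<forall>x\<in>E. \<exists>r. 0 < r \<and> r \<le> 2 * K\<^sup>2 * \<gamma> 0 x \<and> (r / \<gamma> 0 x) powr s \<le> C * J x r"
    using rad by (auto simp: E_def J_def)
  then obtain r where r: "\<And>x. x \<in> E \<Longrightarrow> 0 < r x" "\<And>x. x \<in> E \<Longrightarrow> r x \<le> 2 * K\<^sup>2 * \<gamma> 0 x"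
    "\<And>x. x \<in> E \<Longrightarrow> (r x / \<gamma> 0 x) powr s \<le> C * J x (r x)"
    by metis
  have E_pos: "\<gamma> 0 x > 0" if "x \<in> E" for x using that R0 by (auto simp: E_def)
  define B where "B x = Gball \<Gamma> x (r x)" for x
  \<comment> \<open>Within one dyadic annulus the radii are bounded, as
    \<open>vitali_selection\<close> requires; over all of \<open>E\<close> they need not be.\<close>
  define idx where "idx x = \<lfloor>log 2 (\<gamma> 0 x)\<rfloor>" for x
  define sel where "sel j D \<longleftrightarrow> D \<subseteq> {x\<in>E. idx x = j} \<and> (\<forall>x\<in>D. \<forall>y\<in>D. x \<noteq> y \<longrightarrow> B x \<inter> B y = {}) \<and>
      (\<forall>x\<in>E. idx x = j \<longrightarrow> (\<exists>c\<in>D. B x \<inter> B c \<noteq> {} \<and> r x \<le> 2 * r c))" for j D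
  have ex: "\<exists>D. sel j D" for j
  proof -
    have 1: "0 < r x \<and> r x \<le> 2 * K\<^sup>2 * 2 powr (j + 1)" if "x \<in> {x\<in>E. idx x = j}" for x
    proof -
      have x: "x \<in> E" "idx x = j" using that by auto
      have "log 2 (\<gamma> 0 x) < j + 1" using x(2) unfolding idx_def by linarith
      then have "\<gamma> 0 x \<le> 2 powr (j + 1)" using E_pos[OF x(1)] by (simp add: log_less_iff)
      then have "2 * K\<^sup>2 * \<gamma> 0 x \<le> 2 * K\<^sup>2 * 2 powr (j + 1)" by (intro mult_left_mono) auto
      then show ?thesis using r(1,2)[OF x(1)] by linarith
    qed
    have 2: "B x \<noteq> {}" if "x \<in> {x\<in>E. idx x = j}" for x
    proof -
      have "x \<in> B x" using r(1)[of x] that by (simp add: B_def Gball_def)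
      then show ?thesis by blast
    qed
    show ?thesis
    proof (rule vitali_selection[OF 1 2])
      fix D assume D: "D \<subseteq> {x\<in>E. idx x = j}" "\<And>x y. x \<in> D \<Longrightarrow> y \<in> D \<Longrightarrow> x \<noteq> y \<Longrightarrow> B x \<inter> B y = {}"
        "\<And>x. x \<in> {x\<in>E. idx x = j} \<Longrightarrow> \<exists>c\<in>D. B x \<inter> B c \<noteq> {} \<and> r x \<le> 2 * r c"
      have "\<forall>x\<in>E. idx x = j \<longrightarrow> (\<exists>c\<in>D. B x \<inter> B c \<noteq> {} \<and> r x \<le> 2 * r c)"
        using D(3) by simp
      then show ?thesis using D(1,2) by (intro exI[of _ D]) (simp add: sel_def)
    qed
  qed
  obtain D where "\<forall>j. sel j (D j)" using choice[of sel] ex by blast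
  then have D: "\<And>j. D j \<subseteq> {x\<in>E. idx x = j}"
    "\<And>j x y. x \<in> D j \<Longrightarrow> y \<in> D j \<Longrightarrow> x \<noteq> y \<Longrightarrow> B x \<inter> B y = {}"
    "\<And>j x. x \<in> E \<Longrightarrow> idx x = j \<Longrightarrow> \<exists>c\<in>D j. B x \<inter> B c \<noteq> {} \<and> r x \<le> 2 * r c"
    unfolding sel_def by blast+
  define U where "U = (\<Union>j. D j)"
  have UE: "U \<subseteq> E" using D(1) by (auto simp: U_def)
  have U_disj: "B x \<inter> B y = {}" if xy: "x \<in> U" "y \<in> U" "idx x = idx y" "x \<noteq> y" for x y
  proof -
    obtain i j where "x \<in> D i" "y \<in> D j" using xy(1,2) by (auto simp: U_def)
    moreover have "idx x = i" "idx y = j" using calculation D(1) by blast+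
    ultimately show ?thesis using D(2)[of x i y] xy(3,4) by simp
  qed
  have cover: "\<exists>c\<in>U. \<gamma> c x < 2 * K * r c" if xE: "x \<in> E" for x
  proof -
    obtain c where c: "c \<in> D (idx x)" "B x \<inter> B c \<noteq> {}" "r x \<le> 2 * r c" using D(3)[OF xE refl] by blast
    then obtain z where z: "\<gamma> x z < r x" "\<gamma> c z < r c" by (auto simp: B_def Gball_def)
    have "\<gamma> c x \<le> K * max (\<gamma> c z) (\<gamma> z x)" by (rule K(2))
    also have "\<dots> < K * (2 * r c)"
    proof (rule mult_strict_left_mono[OF _ Kp])
      have "0 < r c" using r(1)[of c] c(1) D(1) by blast
      then show "max (\<gamma> c z) (\<gamma> z x) < 2 * r c" using z c(3) \<gamma>_sym[of z x] by simp
    qed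
    finally show ?thesis using c(1) by (intro bexI[of _ c]) (auto simp: U_def)
  qed
  \<comment> \<open>The indices of annuli concerned by \<open>y\<close> lie between the floors of
    log \<gamma> 0 y minus and plus log K, in base 2; this bounds their number.\<close>
  define L where "L = 2 * log 2 K + 2"
  have L0: "L \<ge> 0" using K(1) by (simp add: L_def)
  have overlap: "(\<Sum>x\<in>X. indicator (near_ball K x (r x)) y) \<le> L" if X: "finite X" "X \<subseteq> U" for X y
  proof -
    define Z where "Z = {x\<in>X. y \<in> near_ball K x (r x)}"
    have Z: "Z \<subseteq> E" "Z \<subseteq> U" "finite Z" using X UE by (auto simp: Z_def)
    have sum_eq: "(\<Sum>x\<in>X. indicator (near_ball K x (r x)) y) = real (card Z)"
      using X(1) by (simp add: Z_def indicator_def sum.If_cases Int_def of_bool_def)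
    define a where "a = \<lfloor>log 2 (\<gamma> 0 y) - log 2 K\<rfloor>"
    define b where "b = \<lfloor>log 2 (\<gamma> 0 y) + log 2 K\<rfloor>"
    have sub: "idx ` Z \<subseteq> {a..b}"
    proof
      fix i assume "i \<in> idx ` Z"
      then obtain x where x: "x \<in> Z" "i = idx x" by blast
      have xp: "\<gamma> 0 x > 0" using E_pos x(1) Z(1) by blast
      have le: "\<gamma> 0 x / K \<le> \<gamma> 0 y" "\<gamma> 0 y \<le> K * \<gamma> 0 x" using x(1) by (auto simp: Z_def near_ball_def)
      have "0 < \<gamma> 0 x / K" using xp Kp by simp
      then have yp: "\<gamma> 0 y > 0" using le(1) by linarith
      have "log 2 (\<gamma> 0 x) \<le> log 2 (\<gamma> 0 y * K)"
        using le(1) xp yp Kp by (subst log_le_cancel_iff) (auto simp: field_simps)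
      then have 1: "log 2 (\<gamma> 0 x) \<le> log 2 (\<gamma> 0 y) + log 2 K" using yp Kp by (simp add: log_mult)
      have "log 2 (\<gamma> 0 y) \<le> log 2 (K * \<gamma> 0 x)"
        using le(2) xp yp Kp by (subst log_le_cancel_iff) auto
      then have 2: "log 2 (\<gamma> 0 y) - log 2 K \<le> log 2 (\<gamma> 0 x)" using xp Kp by (simp add: log_mult)
      show "i \<in> {a..b}" using floor_mono[OF 1] floor_mono[OF 2] by (simp add: a_def b_def idx_def x(2))
    qed
    \<comment> \<open>Two different centres with the same index have disjoint balls, so
      \<open>y\<close> cannot lie in both.\<close>
    have inj: "inj_on idx Z"
    proof (rule inj_onI, rule ccontr)
      fix x x' assume xx: "x \<in> Z" "x' \<in> Z" "idx x = idx x'" "x \<noteq> x'"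
      then have "B x \<inter> B x' = {}" using U_disj Z(2) by blast
      moreover have "y \<in> B x" "y \<in> B x'" using xx by (auto simp: Z_def near_ball_def B_def Gball_def)
      ultimately show False by blast
    qed
    have "card Z = card (idx ` Z)" using card_image[OF inj] by simp
    also have "\<dots> \<le> card {a..b}" by (intro card_mono sub) simp
    finally have "real (card Z) \<le> real (nat (b - a + 1))" by simp
    also have "\<dots> \<le> L"
    proof -
      have "real_of_int (b - a + 1) \<le> L" unfolding L_def a_def b_def by linarith
      then show ?thesis using L0 by (cases "b - a + 1 \<ge> 0") auto
    qed
    finally show ?thesis using sum_eq by simp
  qed
  let ?w = "\<lambda>x. (r x / \<gamma> 0 x) powr s"
  have sum_le: "sum ?w X \<le> C * (L * p 0)" if X: "finite X" "X \<subseteq> U" for X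
  proof -
    have "sum ?w X \<le> (\<Sum>x\<in>X. C * J x (r x))" using X UE by (intro sum_mono r(3)) auto
    also have "\<dots> = C * (\<Sum>x\<in>X. J x (r x))" by (simp add: sum_distrib_left)
    also have "(\<Sum>x\<in>X. J x (r x)) = (LINT y|lborel. (\<Sum>x\<in>X. indicator (near_ball K x (r x)) y * (G 0 y * M g y)))"
      unfolding J_def by (rule Bochner_Integration.integral_sum[symmetric]) (rule near_ball_integrable)
    also have "\<dots> \<le> (LINT y|lborel. L * (G 0 y * M g y))"
    proof (rule integral_mono)
      show "integrable lborel (\<lambda>y. \<Sum>x\<in>X. indicator (near_ball K x (r x)) y * (G 0 y * M g y))"
        by (rule Bochner_Integration.integrable_sum) (rule near_ball_integrable)
      show "integrable lborel (\<lambda>y. L * (G 0 y * M g y))" by (intro integrable_mult_right p_integrable)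
      show "(\<Sum>x\<in>X. indicator (near_ball K x (r x)) y * (G 0 y * M g y)) \<le> L * (G 0 y * M g y)" for y
        unfolding sum_distrib_right[symmetric]
        by (rule mult_right_mono[OF overlap[OF X]]) (simp add: G_nonneg Mg_nonneg)
    qed
    also have "\<dots> = L * p 0" by (simp add: p_def)
    finally show ?thesis using C by simp
  qed
  have sumU: "?w summable_on U"
  proof (rule nonneg_bdd_above_summable_on)
    show "bdd_above (sum ?w ` {F. F \<subseteq> U \<and> finite F})" using sum_le by (intro bdd_aboveI[of _ "C * (L * p 0)"]) auto
  qed simp
  \<comment> \<open>All terms are nonzero, so summability makes the set of centres countable, as the
    indexing of the covering by naturals requires.\<close>
  have "?w x \<noteq> 0" if "x \<in> U" for x
  proof -
    have "x \<in> E" using that UE by blast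
    then show ?thesis using r(1)[of x] E_pos[of x] by simp
  qed
  then have "{x\<in>U. ?w x \<noteq> 0} = U" by blast
  then have cU: "countable U" using summable_countable_real[OF sumU] by simp
  \<comment> \<open>The remaining part, where \<gamma> 0 x < R0, is covered by one more ball. Its
    centre must differ from 0, and its single term does not affect convergence.\<close>
  obtain x1 :: "real^'n" where x1: "x1 \<noteq> 0" by (metis axis_eq_0_iff zero_neq_one)
  define \<rho>1 where "\<rho>1 = K * max (\<gamma> x1 0) R0 + 1"
  \<comment> \<open>The extra centre may already have been selected, hence the maximum of the two
    radii.\<close>
  define \<rho> where "\<rho> x = (if x = x1 then max \<rho>1 (2 * K * r x1) else 2 * K * r x)" for x
  define U' where "U' = insert x1 U"
  have cU': "countable U'" using cU by (simp add: U'_def)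
  have \<rho>1: "\<rho>1 > 0" using Kp R0 by (simp add: \<rho>1_def add_nonneg_pos)
  have \<rho>_pos: "\<rho> x > 0" if "x \<in> U'" for x
    using that \<rho>1 Kp r(1)[of x] UE by (auto simp: \<rho>_def U'_def)
  have U'0: "x \<noteq> 0" if "x \<in> U'" for x
    using that x1 E_pos[of 0] UE by (auto simp: U'_def)
  have cover': "\<exists>c\<in>U'. \<gamma> c x < \<rho> c" if "p x \<ge> k" for x
  proof (cases "\<gamma> 0 x \<ge> R0")
    case True
    then obtain c where "c \<in> U" "\<gamma> c x < 2 * K * r c" using cover[of x] \<open>p x \<ge> k\<close> by (auto simp: E_def)
    then show ?thesis by (intro bexI[of _ c]) (auto simp: \<rho>_def U'_def)
  next
    case False
    have "\<gamma> x1 x \<le> K * max (\<gamma> x1 0) (\<gamma> 0 x)" by (rule K(2))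
    also have "\<dots> \<le> K * max (\<gamma> x1 0) R0" using False Kp by (intro mult_left_mono) auto
    finally have "\<gamma> x1 x < \<rho> x1" by (simp add: \<rho>_def \<rho>1_def)
    then show ?thesis by (intro bexI[of _ x1]) (auto simp: U'_def)
  qed
  have "(\<lambda>x. (2 * K) powr s * ?w x) summable_on (U - {x1})"
    by (intro summable_on_cmult_right summable_on_subset_banach[OF sumU]) auto
  moreover have "(\<rho> x / \<gamma> 0 x) powr s = (2 * K) powr s * ?w x" if "x \<in> U - {x1}" for x
  proof -
    have "(\<rho> x / \<gamma> 0 x) powr s = (2 * K * (r x / \<gamma> 0 x)) powr s" using that by (simp add: \<rho>_def)
    also have "\<dots> = (2 * K) powr s * ?w x"
      by (rule powr_mult)
    finally show ?thesis .
  qed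
  ultimately have "(\<lambda>x. (\<rho> x / \<gamma> 0 x) powr s) summable_on (U - {x1})"
    using summable_on_cong by (metis (no_types, lifting))
  then have "(\<lambda>x. (\<rho> x / \<gamma> 0 x) powr s) summable_on insert x1 (U - {x1})"
    by (subst summable_on_insert_iff)
  moreover have "insert x1 (U - {x1}) = U'" by (auto simp: U'_def)
  ultimately have sumU': "(\<lambda>x. (\<rho> x / \<gamma> 0 x) powr s) summable_on U'" by simp
  define N where "N = to_nat_on U' ` U'"
  define ctr where "ctr = from_nat_into U'"
  have ctr: "ctr (to_nat_on U' x) = x" if "x \<in> U'" for x
    unfolding ctr_def using cU' that by (rule from_nat_into_to_nat_on)
  show ?thesis
    unfolding p_bounded_def
  proof (intro exI conjI ballI)
    show "\<rho> (ctr n) > 0" "ctr n \<noteq> 0" if "n \<in> N" for n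
      using that ctr \<rho>_pos U'0 by (auto simp: N_def)
    show "{x. p x \<ge> k} \<subseteq> (\<Union>n\<in>N. Gball \<Gamma> (ctr n) (\<rho> (ctr n)))"
    proof
      fix x assume "x \<in> {x. p x \<ge> k}"
      then obtain c where "c \<in> U'" "\<gamma> c x < \<rho> c" using cover' by blast
      then show "x \<in> (\<Union>n\<in>N. Gball \<Gamma> (ctr n) (\<rho> (ctr n)))"
        using ctr by (intro UN_I[of "to_nat_on U' c"]) (auto simp: N_def Gball_def)
    qed
    have "(\<lambda>n. (\<rho> (ctr n) / \<gamma> 0 (ctr n)) powr s) \<circ> to_nat_on U' summable_on U'"
      using sumU' by (rule summable_on_cong[THEN iffD1, rotated]) (simp add: ctr)
    then show "(\<lambda>n. (\<rho> (ctr n) / \<gamma> 0 (ctr n)) powr s) summable_on N"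
      unfolding N_def using summable_on_reindex[OF inj_on_to_nat_on[OF cU']] by blast
  qed
qed

text \<open>On a sufficiently large sphere \<open>g\<close> is below any given positive number, and
  the weak maximum principle carries this inside.\<close>

lemma limsup_nonpos_imp_le_0:
  assumes "Limsup at_infinity (\<lambda>x. ereal (g x)) \<le> 0"
  shows "g x \<le> 0"
proof (rule ccontr)
  assume "\<not> g x \<le> 0"
  define e where "e = g x / 2"
  have e: "e > 0" using \<open>\<not> g x \<le> 0\<close> by (simp add: e_def)
  then have "Limsup at_infinity (\<lambda>x. ereal (g x)) < ereal e" using assms by (simp add: le_less_trans)
  then have "eventually (\<lambda>x. g x < e) at_infinity" by (auto dest: Limsup_lessD)
  then obtain R where R: "\<And>y. norm y \<ge> R \<Longrightarrow> g y < e" unfolding eventually_at_infinity by blast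
  define W where "W = ball (0::real^'n) (max R (norm x) + 1)"
  have W: "open W" "bounded W" "x \<in> W" by (auto simp: W_def)
  have gW: "C2_on W g" using C2_on_subset[OF g_C2] by simp
  have "g x - e \<le> 0"
  proof (rule weak_maximum_principle[OF W(1,2) C2_on_diff[OF W(1) gW C2_on_const] _ _ W(3)])
    show "M (\<lambda>x. g x - e) y \<ge> 0" if "y \<in> W" for y
      using M_diff[OF W(1) gW C2_on_const that, of e] M_const[of e y] Mg_nonneg[of y] by simp
    fix y and d :: real assume y: "y \<in> frontier W" and d: "d > 0"
    have "y \<in> sphere 0 (max R (norm x) + 1)"
      using y unfolding W_def by (subst (asm) frontier_ball) (auto simp: add_nonneg_pos le_max_iff_disj)
    then have "g y < e" using R[of y] by simp
    moreover have "open {x. g x < e}"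
      using C2_on_continuous[OF g_C2] by (intro open_Collect_less continuous_on_const)
    moreover have "\<forall>x\<in>{x. g x < e} \<inter> W. g x - e < d" using d by auto
    ultimately show "\<exists>U. open U \<and> y \<in> U \<and> (\<forall>x\<in>U \<inter> W. g x - e < d)" by blast
  qed
  then show False using e by (simp add: e_def)
qed

end

theorem corollary1p10:
  fixes V :: "real^'n::finite \<Rightarrow> real"
    and A :: "real^'n \<Rightarrow> real^'n^'n"
    and \<Gamma> :: "real^'n \<Rightarrow> real^'n \<Rightarrow> real"
    and \<Omega> :: "(real^'n) set"
    and f :: "real^'n \<Rightarrow> real \<Rightarrow> real"
    and u :: "real^'n \<Rightarrow> real"
  assumes H1: "smooth_coefficients V A"
    and H2: "degenerate_elliptic A"
    and H3: "hypoelliptic_assumption V A"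
    and FS: "fundamental_solution V A \<Gamma>"
    and G: "ball_separation \<Gamma>"
    and L: "liouville_property V A"
    and D: "ball_doubling \<Gamma>"
    and Omega: "open \<Omega>"
    and cond: "L_large_at_infinity V A (- \<Omega>) \<or>
               (\<exists>p>1. \<not> p_bounded \<Gamma> p (- \<Omega>)) \<or>
               (\<exists>K. Gcone \<Gamma> K \<and> K \<subseteq> - \<Omega>)"
    and f: "\<And>x z. x \<in> \<Omega> \<Longrightarrow> z \<ge> 0 \<Longrightarrow> f x z \<le> 0"
    and C2: "Ck_on 2 \<Omega> u"
    and bdd: "bdd_above (u ` \<Omega>)"
    and ineq: "\<And>x. x \<in> \<Omega> \<Longrightarrow> Lop V A u x + f x (u x) \<ge> 0"
    and bdry: "\<And>y. y \<in> frontier \<Omega> \<Longrightarrow> Limsup (at y within \<Omega>) (\<lambda>x. ereal (u x)) \<le> 0"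
  shows "\<forall>x\<in>\<Omega>. u x \<le> 0"
proof (rule ccontr)
  assume "\<not> ?thesis"
  then obtain x0 where x0: "x0 \<in> \<Omega>" "u x0 > 0" by auto
  \<comment> \<open>Positive, so that it exceeds the boundary values of u, and below
    \<open>u x0\<close>, so that the truncation does not vanish identically.\<close>
  define d where "d = u x0 / 2"
  have d: "d > 0" "u x0 > d" using x0 by (auto simp: d_def)
  define g where "g = (\<lambda>x. if x \<in> \<Omega> then (max 0 (u x - d)) ^ 3 else 0)"
  interpret DO: degenerate_operator_fs V A \<Gamma>
    by unfold_locales (use H1 H2 FS in auto)
  have u: "C2_on \<Omega> u" by (rule C2_on_Ck[OF C2])
  have bd: "\<exists>U. open U \<and> y \<in> U \<and> (\<forall>x\<in>U \<inter> \<Omega>. u x < d)" if y: "y \<in> frontier \<Omega>" for y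
  proof -
    have "Limsup (at y within \<Omega>) (\<lambda>x. ereal (u x)) < ereal d"
      using bdry[OF y] d(1) by (simp add: le_less_trans)
    then have "eventually (\<lambda>x. u x < d) (at y within \<Omega>)" by (auto dest: Limsup_lessD)
    moreover have "y \<notin> \<Omega>" using y Omega by (simp add: frontier_def interior_open)
    ultimately obtain U where U: "open U" "y \<in> U" "\<forall>x\<in>U. x \<noteq> y \<longrightarrow> x \<in> \<Omega> \<longrightarrow> u x < d" "y \<notin> \<Omega>"
      unfolding eventually_at_topological by auto
    then have "\<forall>x\<in>U \<inter> \<Omega>. u x < d" by auto
    then show ?thesis using U(1,2) by (intro exI[of _ U]) simp
  qed
  obtain N where g_C2: "C2_on UNIV g" and N: "open N" "- \<Omega> \<subseteq> N" "\<And>x. x \<in> N \<Longrightarrow> g x = 0"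
    by (rule truncated_extension[OF Omega u bd g_def]) (assumption, rule that)
  have Mu: "DO.M u x \<ge> 0" if "x \<in> \<Omega>" "u x > d" for x
  proof -
    have "Lop V A u x \<ge> 0" using ineq[OF that(1)] f[OF that(1), of "u x"] that(2) d(1) by simp
    then show ?thesis using DO.Lop_M[of x u] DO.V_pos[of x] by (metis less_imp_le mult_nonneg_nonneg)
  qed
  have Mg: "DO.M g x \<ge> 0" for x
    by (rule DO.M_truncated_nonneg[OF Omega u Mu g_def N])
  obtain b where b: "\<And>x. x \<in> \<Omega> \<Longrightarrow> u x \<le> b" using bdd by (auto simp: bdd_above_def)
  have g_le: "g x \<le> (max 0 (b - d)) ^ 3" for x
    using b[of x] by (auto simp: g_def intro!: power_mono)
  have g_nonneg: "g x \<ge> 0" for x by (simp add: g_def)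
  interpret bounded_subsolution V A \<Gamma> g "(max 0 (b - d)) ^ 3"
    by unfold_locales (use g_C2 g_nonneg g_le Mg in auto)
  have gx0: "g x0 > 0" using x0 d by (simp add: g_def)
  have g0: "g x = 0" if "x \<in> - \<Omega>" for x using that by (simp add: g_def)
  show False
  proof (cases "L_large_at_infinity V A (- \<Omega>)")
    case True
    let ?g = "\<lambda>x. ereal (g x)"
    have "?g \<in> bounded_above_subharmonic V A UNIV"
      using DO.subharmonicI[OF g_C2 Mg] g_le by (auto simp: bounded_above_subharmonic_def)
    then have not_less: "\<not> (if bounded (- \<Omega>) then (SUP x\<in>- \<Omega>. ?g x) < (SUP x. ?g x)
        else Limsup (inf at_infinity (principal (- \<Omega>))) ?g < Limsup at_infinity ?g)"
      using True unfolding L_large_at_infinity_def L_thin_at_infinity_def by blast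
    show False
    proof (cases "bounded (- \<Omega>)")
      case True
      have "(SUP x\<in>- \<Omega>. ?g x) \<le> 0" using g0 by (intro SUP_least) simp
      also have "0 < ?g x0" using gx0 by simp
      also have "?g x0 \<le> (SUP x. ?g x)" by (intro SUP_upper) simp
      finally show False using not_less True by simp
    next
      case False
      \<comment> \<open>Largeness transfers the bound from the complement to all of space: the
        limsup at infinity cannot exceed the one taken along the complement, where \<open>g\<close>
        is 0.\<close>
      have "eventually (\<lambda>x. ?g x \<le> 0) (inf at_infinity (principal (- \<Omega>)))"
        using g0 by (auto simp: eventually_inf_principal intro!: always_eventually)
      then have "Limsup (inf at_infinity (principal (- \<Omega>))) ?g \<le> 0" by (rule Limsup_bounded)
      then have "Limsup at_infinity ?g \<le> 0" using not_less False by (simp add: not_less)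
      then show False using limsup_nonpos_imp_le_0[of x0] gx0 by simp
    qed
  next
    case not_large: False
    obtain k where "\<And>\<psi>. Cc \<psi> \<Longrightarrow> (LINT x|lborel. (g x + p x) * \<psi> x) = k * (LINT x|lborel. \<psi> x)"
      by (rule weakly_constant[OF H3 L]) blast
    then have k: "g x + p x = k" for x by (rule constant_everywhere)
    have k_pos: "k > 0" using k[of x0] gx0 p_nonneg[of x0] by simp
    obtain K where K: "K \<ge> 1" "\<And>x y z. gam \<Gamma> x y \<le> K * max (gam \<Gamma> x z) (gam \<Gamma> z y)"
      by (rule DO.quasi_metric[OF G]) blast
    from cond not_large consider q where "q > 1" "\<not> p_bounded \<Gamma> q (- \<Omega>)"
      | Z where "Gcone \<Gamma> Z" "Z \<subseteq> - \<Omega>" by blast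
    then show False
    proof cases
      case 1
      have "p x \<ge> k" if "x \<in> - \<Omega>" for x using k[of x] g0[OF that] by simp
      then have "- \<Omega> \<subseteq> {x. p x \<ge> k}" by blast
      moreover have "p_bounded \<Gamma> q {x. p x \<ge> k}" by (rule superlevel_p_bounded[OF K k_pos 1(1)])
      ultimately have "p_bounded \<Gamma> q (- \<Omega>)" unfolding p_bounded_def by (meson subset_trans)
      then show False using 1(2) by simp
    next
      case 2
      then obtain z R where zR: "\<And>j. R j > 0" "\<And>j. Gball \<Gamma> (z j) (R j) \<subseteq> Z"
        and z: "filterlim (\<lambda>j. norm (z j)) at_top sequentially"
        and lim: "liminf (\<lambda>j. ereal (R j / gam \<Gamma> 0 (z j))) > 0"
        unfolding Gcone_def by blast
      obtain a where a: "0 < ereal a" "ereal a < liminf (\<lambda>j. ereal (R j / gam \<Gamma> 0 (z j)))"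
        using ereal_dense2[OF lim] by blast
      have "eventually (\<lambda>j. a < R j / gam \<Gamma> 0 (z j)) sequentially"
        using less_LiminfD[OF a(2)] by simp
      \<comment> \<open>The liminf controls the radii only from some index on, so the sequence of
        cone balls is shifted by \<open>m\<close>.\<close>
      then obtain m where m: "\<And>j. j \<ge> m \<Longrightarrow> a < R j / gam \<Gamma> 0 (z j)"
        unfolding eventually_sequentially by blast
      have aR: "a * gam \<Gamma> 0 (z (j + m)) \<le> R (j + m)" for j
      proof (cases "gam \<Gamma> 0 (z (j + m)) = 0")
        case False
        then have "gam \<Gamma> 0 (z (j + m)) > 0" using DO.\<gamma>_nonneg[of 0 "z (j + m)"] by simp
        then show ?thesis using m[of "j + m"] by (simp add: pos_less_divide_eq)
      qed (use zR(1)[of "j + m"] in simp)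
      have gz: "g y = 0" if "gam \<Gamma> (z (j + m)) y < R (j + m)" for j y
        using that zR(2)[of "j + m"] 2(2) g0[of y] by (auto simp: Gball_def)
      have "filterlim (\<lambda>j. norm (z (j + m))) at_top sequentially"
        using filterlim_compose[OF z filterlim_add_const_nat_at_top[of m]] by simp
      moreover have "a > 0" using a(1) by simp
      ultimately have "(\<lambda>j. p (z (j + m))) \<longlonglongrightarrow> 0"
        using cone_potential_tendsto_0[where R="\<lambda>j. R (j + m)" and z="\<lambda>j. z (j + m)", OF K _ zR(1) aR _ gz]
        by simp
      moreover have "p (z (j + m)) = k" for j
      proof -
        have "g (z (j + m)) = 0" by (rule gz[of j]) (use zR(1) in simp)
        then show ?thesis using k[of "z (j + m)"] by simp
      qed
      ultimately have "k = 0" by (simp add: LIMSEQ_const_iff)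
      then show False using k_pos by simp
    qed
  qed
qed

end
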